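(* Let $m,n$ be positive integers with $m\ge 2$, and let $G\cong C_m\oplus C_{mn}$. Let $T$ be a zero-sumfree sequence over $G$ with $|T|=\mathsf{D}(G)-1$, and let $U$ be a non-empty sequence over $G$ such that every element occurring in $U$ also occurs in $T$. If $m$ satisfies Property B, then every non-empty zero-sum subsequence $S'$ of the sequence $S=TU$ (the concatenation of $T$ and $U$) satisfies $|S'|\ge m$.
   Context: $C_k$ denotes the cyclic group of order $k$. A sequence over a finite Abelian group $G$ (written additively) is a finite multiset of elements of $G$; its length $|S|$ is the number of terms counted with multiplicity, and a subsequence is a sub-multiset. $S$ is a zero-sum sequence if its terms sum to $0$; it is a minimal zero-sum sequence if it is a non-empty zero-sum sequence and no proper non-empty subsequence is zero-sum; it is zero-sumfree if no non-empty subsequence has sum $0$. The Davenport constant $\mathsf{D}(G)$ is the smallest positive integer $t$ such that every sequence over $G$ of length at least $t$ contains a non-empty zero-sum subsequence. An integer $k\ge 2$ satisfies Property B if every minimal zero-sum sequence over $C_k\oplus C_k$ of length $2k-1$ contains some element with multiplicity (at least) $k-1$. *)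

theory Defs
  imports "HOL-Library.Multiset"
begin

(* Concrete model of C_k1 (+) C_k2: carrier {0..<k1} x {0..<k2}, addition componentwise
   modulo k1 resp. k2.  Sequences over the group are finite multisets of carrier elements. *)

type_synonym elt = "nat \<times> nat"

definition grp :: "nat \<Rightarrow> nat \<Rightarrow> elt set" where
  "grp k1 k2 = {0..<k1} \<times> {0..<k2}"

definition seq_over :: "nat \<Rightarrow> nat \<Rightarrow> elt multiset \<Rightarrow> bool" where
  "seq_over k1 k2 S \<longleftrightarrow> set_mset S \<subseteq> grp k1 k2"

definition zero_sum :: "nat \<Rightarrow> nat \<Rightarrow> elt multiset \<Rightarrow> bool" where
  "zero_sum k1 k2 S \<longleftrightarrow>
     (\<Sum>x\<in>#S. fst x) mod k1 = 0 \<and> (\<Sum>x\<in>#S. snd x) mod k2 = 0"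

definition zero_sumfree :: "nat \<Rightarrow> nat \<Rightarrow> elt multiset \<Rightarrow> bool" where
  "zero_sumfree k1 k2 S \<longleftrightarrow>
     (\<forall>S'. S' \<subseteq># S \<and> S' \<noteq> {#} \<longrightarrow> \<not> zero_sum k1 k2 S')"

definition min_zero_sum :: "nat \<Rightarrow> nat \<Rightarrow> elt multiset \<Rightarrow> bool" where
  "min_zero_sum k1 k2 S \<longleftrightarrow> S \<noteq> {#} \<and> zero_sum k1 k2 S \<and>
     (\<forall>S'. S' \<subseteq># S \<and> S' \<noteq> {#} \<and> S' \<noteq> S \<longrightarrow> \<not> zero_sum k1 k2 S')"

definition davenport :: "nat \<Rightarrow> nat \<Rightarrow> nat" where
  "davenport k1 k2 = (LEAST t. 0 < t \<and>
     (\<forall>S. seq_over k1 k2 S \<and> t \<le> size S \<longrightarrow> \<not> zero_sumfree k1 k2 S))"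

definition property_B :: "nat \<Rightarrow> bool" where
  "property_B k \<longleftrightarrow> 2 \<le> k \<and>
     (\<forall>S. seq_over k k S \<and> min_zero_sum k k S \<and> size S = 2 * k - 1
        \<longrightarrow> (\<exists>g. k - 1 \<le> count S g))"

end

theory Submission
  imports Defs "HOL-Number_Theory.Number_Theory" "HOL-Library.Disjoint_Sets"
begin

text \<open>Let \<open>K = C_m \<oplus> C_m\<close> be the quotient of \<open>G\<close> by the subgroup \<open>N\<close> of order \<open>n\<close>.  Appending
  minus its sum to \<open>T\<close> gives a minimal zero-sum sequence of length \<open>mn + m - 1\<close>.  Every sequence
  over \<open>K\<close> of length \<open>3m - 2\<close> has a zero-sum subsequence of length at most \<open>m\<close>, so this sequence
  splits into \<open>n\<close> blocks with sums in \<open>N\<close>, one block \<open>V0\<close> of length \<open>2m - 1\<close> and \<open>n - 1\<close> blocks of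
  length \<open>m\<close>; the block sums form a minimal zero-sum sequence of length \<open>n\<close> over \<open>N\<close>, hence are all
  equal.  By Property B the image of \<open>V0\<close> in \<open>K\<close> consists of \<open>m - 1\<close> copies of \<open>e\<close> and \<open>m\<close> terms
  in \<open>e' + \<langle>e\<rangle>\<close> for a basis \<open>(e, e')\<close>.

  The theorem holds once all terms lie over \<open>{e} \<union> (e' + \<langle>e\<rangle>)\<close>: in a zero-sum over such a set the
  number of terms outside \<open>\<langle>e\<rangle>\<close> is a multiple of \<open>m\<close>, and if it is zero, the length is.

  Suppose a term \<open>b\<close> of another block \<open>B\<close> lies outside.  All proper non-empty subsequences of
  \<open>B V0\<close> that vanish in \<open>K\<close> have the same sum \<open>k0 \<noteq> 0\<close> in \<open>N\<close>; exchanging terms shows that all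
  lifts of \<open>e\<close> agree and that \<open>m\<close> times this lift is not zero.  Re-splitting \<open>B V0\<close> so that \<open>b\<close> falls
  in the block of length \<open>2m - 1\<close> and comparing the two structures, one of these two blocks has two
  distinct terms of multiplicity \<open>m - 1\<close>.  If some decomposition has such a block \<open>V0\<close>, over
  \<open>e\<close>, \<open>e'\<close> and \<open>e + e'\<close>, then both \<open>{e} \<union> (e' + \<langle>e\<rangle>)\<close> and \<open>{e'} \<union> (e + \<langle>e'\<rangle>)\<close> are
  candidates, and failure of the first makes \<open>m\<close> times the lift of \<open>e'\<close> vanish while failure of the
  second makes it non-zero.\<close>

section \<open>Short zero-sums in rank two\<close>

definition low_degree :: "'i set \<Rightarrow> nat \<Rightarrow> ('i set \<Rightarrow> int) \<Rightarrow> bool" where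
  "low_degree A d P \<longleftrightarrow>
     (\<forall>C\<subseteq>A. card C + d < card A \<longrightarrow> (\<Sum>I | I \<subseteq> A \<and> C \<subseteq> I. (-1) ^ card I * P I) = 0)"

lemma low_degreeD:
  "low_degree A d P \<Longrightarrow> C \<subseteq> A \<Longrightarrow> card C + d < card A \<Longrightarrow>
     (\<Sum>I | I \<subseteq> A \<and> C \<subseteq> I. (-1) ^ card I * P I) = 0"
  by (simp add: low_degree_def)

lemma low_degree_const:
  assumes "finite A"
  shows "low_degree A d (\<lambda>_. c)"
  unfolding low_degree_def
proof (intro allI impI)
  fix C assume C: "C \<subseteq> A" "card C + d < card A"
  then have "C \<subset> A" by auto
  then have "(\<Sum>I | I \<subseteq> A \<and> C \<subseteq> I. (-1) ^ card I) = (0::int)"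
    using card_subsupersets_even_odd[OF assms \<open>C \<subset> A\<close>] assms
    by (intro sum_alternating_cancels) (simp_all add: conj_commute conj_left_commute)
  then show "(\<Sum>I | I \<subseteq> A \<and> C \<subseteq> I. (-1) ^ card I * c) = 0"
    by (simp flip: sum_distrib_right)
qed

lemma low_degree_diff:
  assumes "low_degree A d P" "low_degree A d Q"
  shows "low_degree A d (\<lambda>I. P I - Q I)"
  using assms by (simp add: low_degree_def right_diff_distrib sum_subtractf)

lemma low_degree_mono: "low_degree A d P \<Longrightarrow> d \<le> e \<Longrightarrow> low_degree A e P"
  by (auto simp: low_degree_def)

text \<open>\<open>low_degree A d P\<close> says that \<open>P\<close>, as a multilinear polynomial
  in the membership indicators, has degree at most \<open>d\<close>: a monomial over M survives the
  alternating sum only if C \<union> M = A. A linear form combines indicators, and multiplying by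
  the indicator of i replaces C by \<open>insert i C\<close>, at most one larger; hence the
  quantification over all C.\<close>

lemma low_degree_mult:
  assumes "finite A" "low_degree A d P"
  shows "low_degree A (Suc d) (\<lambda>I. P I * sum a I)"
  unfolding low_degree_def
proof (intro allI impI)
  fix C assume C: "C \<subseteq> A" "card C + Suc d < card A"
  have fin: "finite {I. I \<subseteq> A \<and> C \<subseteq> I}"
    using assms(1) by (auto intro: finite_subset[of _ "Pow A"])
  have "(\<Sum>I | I \<subseteq> A \<and> C \<subseteq> I. (-1) ^ card I * (P I * sum a I)) =
        (\<Sum>I | I \<subseteq> A \<and> C \<subseteq> I. \<Sum>i\<in>A. if i \<in> I then a i * ((-1) ^ card I * P I) else 0)"
  proof (rule sum.cong[OF refl])
    fix I assume "I \<in> {I. I \<subseteq> A \<and> C \<subseteq> I}"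
    then have "A \<inter> I = I" by auto
    then have "sum a I = (\<Sum>i\<in>A. if i \<in> I then a i else 0)"
      using assms(1) by (simp flip: sum.inter_restrict)
    then show "(-1) ^ card I * (P I * sum a I) =
      (\<Sum>i\<in>A. if i \<in> I then a i * ((-1) ^ card I * P I) else 0)"
      by (auto simp: sum_distrib_left intro!: sum.cong)
  qed
  also have "\<dots> = (\<Sum>i\<in>A. \<Sum>I | I \<subseteq> A \<and> C \<subseteq> I. if i \<in> I then a i * ((-1) ^ card I * P I) else 0)"
    by (rule sum.swap)
  also have "\<dots> = (\<Sum>i\<in>A. a i * (\<Sum>I | I \<subseteq> A \<and> insert i C \<subseteq> I. (-1) ^ card I * P I))"
  proof (rule sum.cong[OF refl])
    fix i assume "i \<in> A"
    have "{I. I \<subseteq> A \<and> insert i C \<subseteq> I} = {I \<in> {I. I \<subseteq> A \<and> C \<subseteq> I}. i \<in> I}" by auto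
    then show "(\<Sum>I | I \<subseteq> A \<and> C \<subseteq> I. if i \<in> I then a i * ((-1) ^ card I * P I) else 0) =
      a i * (\<Sum>I | I \<subseteq> A \<and> insert i C \<subseteq> I. (-1) ^ card I * P I)"
      unfolding \<open>{I. I \<subseteq> A \<and> insert i C \<subseteq> I} = _\<close> sum.inter_filter[OF fin] sum_distrib_left
      by (intro sum.cong) auto
  qed
  also have "\<dots> = 0"
  proof (intro sum.neutral ballI)
    fix i assume "i \<in> A"
    have "card (insert i C) \<le> Suc (card C)" by (rule card_insert_le_m1) auto
    then show "a i * (\<Sum>I | I \<subseteq> A \<and> insert i C \<subseteq> I. (-1) ^ card I * P I) = 0"
      using low_degreeD[OF assms(2), of "insert i C"] C \<open>i \<in> A\<close> by auto
  qed
  finally show "(\<Sum>I | I \<subseteq> A \<and> C \<subseteq> I. (-1) ^ card I * (P I * sum a I)) = 0" .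
qed

lemma low_degree_mult_power:
  assumes "finite A" "low_degree A d P"
  shows "low_degree A (d + k) (\<lambda>I. P I * sum a I ^ k)"
proof (induction k)
  case (Suc k)
  then show ?case using low_degree_mult[OF assms(1), of "d + k" "\<lambda>I. P I * sum a I ^ k" a]
    by (simp add: algebra_simps)
qed (use assms in simp)

lemma low_degree_prod:
  assumes "finite A" "finite K"
  shows "low_degree A (card K * e) (\<lambda>I. \<Prod>k\<in>K. 1 - sum (a k) I ^ e)"
  using assms(2)
proof (induction K rule: finite_induct)
  case empty
  then show ?case using low_degree_const[OF assms(1)] by simp
next
  case (insert k K)
  let ?P = "\<lambda>I. \<Prod>k\<in>K. 1 - sum (a k) I ^ e"
  have "low_degree A (card K * e + e) (\<lambda>I. ?P I - ?P I * sum (a k) I ^ e)"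
    using low_degree_mult_power[OF assms(1) insert.IH] low_degree_mono[OF insert.IH]
    by (intro low_degree_diff) auto
  then show ?case using insert.hyps by (simp add: algebra_simps)
qed

text \<open>The polynomial method: with at most \<open>d (p - 1)\<close> factors, the product below has degree
  less than \<open>card A\<close>, so its alternating sum over all subsets vanishes; modulo \<open>p\<close> only the
  subsets annihilating every functional contribute.\<close>

lemma prime_zero_sum_exists:
  fixes a :: "'k \<Rightarrow> 'i \<Rightarrow> int"
  assumes "prime p" "finite K" "finite A" "card K * (p - 1) < card A"
  obtains Q where "Q \<subseteq> A" "Q \<noteq> {}" "\<And>k. k \<in> K \<Longrightarrow> int p dvd sum (a k) Q"
proof -
  have "\<exists>Q\<subseteq>A. Q \<noteq> {} \<and> (\<forall>k\<in>K. int p dvd sum (a k) Q)"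
  proof (rule ccontr)
    assume no: "\<not> (\<exists>Q\<subseteq>A. Q \<noteq> {} \<and> (\<forall>k\<in>K. int p dvd sum (a k) Q))"
    let ?P = "\<lambda>I. \<Prod>k\<in>K. 1 - sum (a k) I ^ (p - 1)"
    have p1: "p > 1" using assms(1) prime_gt_1_nat by blast
    have P0: "int p dvd ?P I" if "I \<subseteq> A" "I \<noteq> {}" for I
    proof -
      have "\<not> (\<forall>k\<in>K. int p dvd sum (a k) I)"
      proof
        assume "\<forall>k\<in>K. int p dvd sum (a k) I"
        then have "I \<subseteq> A \<and> I \<noteq> {} \<and> (\<forall>k\<in>K. int p dvd sum (a k) I)" using that by simp
        then show False using no by (elim notE) (rule exI)
      qed
      then obtain k where k: "k \<in> K" "\<not> int p dvd sum (a k) I" by auto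
      have "int p dvd 1 - sum (a k) I ^ (p - 1)"
      proof -
        let ?s = "sum (a k) I"
        have s: "\<not> p dvd nat (?s mod int p)"
        proof
          assume "p dvd nat (?s mod int p)"
          then have "int p dvd ?s mod int p"
            using p1 by (simp add: int_dvd_int_iff[symmetric])
          then show False using k(2) by (simp add: dvd_mod_iff)
        qed
        have "[nat (?s mod int p) ^ (p - 1) = 1] (mod p)"
          by (rule fermat_theorem[OF assms(1) s])
        then have "[int (nat (?s mod int p) ^ (p - 1)) = int 1] (mod int p)"
          by (simp only: cong_int_iff)
        then have "[(?s mod int p) ^ (p - 1) = 1] (mod int p)"
          using p1 by simp
        then have "[?s ^ (p - 1) = 1] (mod int p)"
          by (simp add: cong_def power_mod)
        then show ?thesis by (metis cong_iff_dvd_diff cong_sym)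
      qed
      moreover have "1 - sum (a k) I ^ (p - 1) dvd ?P I" by (rule dvd_prodI[OF assms(2) k(1)])
      ultimately show ?thesis by (rule dvd_trans)
    qed
    let ?S = "{I. I \<subseteq> A \<and> I \<noteq> {}}"
    have S: "{I. I \<subseteq> A \<and> {} \<subseteq> I} = insert {} ?S" "finite ?S" "{} \<notin> ?S"
      using assms(3) by (auto intro: finite_subset[of _ "Pow A"])
    have "(\<Sum>I | I \<subseteq> A \<and> {} \<subseteq> I. (-1) ^ card I * ?P I) = 0"
      by (rule low_degreeD[OF low_degree_prod[OF assms(3,2)]]) (use assms in auto)
    then have "(-1) ^ card ({} :: 'i set) * ?P {} + (\<Sum>I | I \<subseteq> A \<and> I \<noteq> {}. (-1) ^ card I * ?P I) = 0"
      unfolding S(1) sum.insert[OF S(2,3)] .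
    moreover have "?P {} = 1" using p1 by (intro prod.neutral) simp
    ultimately have eq: "1 + (\<Sum>I | I \<subseteq> A \<and> I \<noteq> {}. (-1) ^ card I * ?P I) = 0"
      by simp
    have "int p dvd (\<Sum>I | I \<subseteq> A \<and> I \<noteq> {}. (-1) ^ card I * ?P I)"
      by (rule dvd_sum) (use P0 in auto)
    then have "int p dvd - (\<Sum>I | I \<subseteq> A \<and> I \<noteq> {}. (-1) ^ card I * ?P I)" by simp
    moreover have "- (\<Sum>I | I \<subseteq> A \<and> I \<noteq> {}. (-1) ^ card I * ?P I) = 1" using eq by linarith
    ultimately have "int p dvd 1" by (simp only:)
    then show False using p1 by simp
  qed
  then show ?thesis using that by blast
qed

section \<open>Zero-sum bounds over two copies of the cyclic group of order m\<close>

definition zs :: "nat \<Rightarrow> ('i \<Rightarrow> int) \<Rightarrow> ('i \<Rightarrow> int) \<Rightarrow> 'i set \<Rightarrow> bool" where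
  "zs m f g Q \<longleftrightarrow> int m dvd sum f Q \<and> int m dvd sum g Q"

lemma zs_Diff:
  "finite A \<Longrightarrow> B \<subseteq> A \<Longrightarrow> zs m f g A \<Longrightarrow> zs m f g B \<Longrightarrow> zs m f g (A - B)"
  by (simp add: zs_def sum_diff)

lemma zs_Un:
  "finite A \<Longrightarrow> finite B \<Longrightarrow> A \<inter> B = {} \<Longrightarrow> zs m f g A \<Longrightarrow> zs m f g B \<Longrightarrow> zs m f g (A \<union> B)"
  by (simp add: zs_def sum.union_disjoint)

lemma prime_dav:
  assumes "prime p" "finite A" "2 * p - 1 \<le> card A"
  obtains Q where "Q \<subseteq> A" "Q \<noteq> {}" "zs p f g Q"
proof -
  have "p > 1" using assms(1) prime_gt_1_nat by blast
  then have "card (UNIV :: bool set) * (p - 1) < card A" using assms(3) by auto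
  from prime_zero_sum_exists[OF assms(1) _ assms(2) this, of "\<lambda>k. if k then f else g"]
  obtain Q where Q: "Q \<subseteq> A" "Q \<noteq> {}" "\<And>k. int p dvd sum (if k then f else g) Q" by auto
  show ?thesis using that[OF Q(1,2)] Q(3)[of True] Q(3)[of False] by (simp add: zs_def)
qed

text \<open>A third functional, constantly 1, makes the length a multiple of p below 3p. For length
  2p one term is dropped, the other 2p - 1 contain a zero-sum, and either this or its complement in
  Q has at most p terms; the dropped term keeps the complement non-empty.\<close>

lemma prime_eta:
  assumes "prime p" "finite A" "3 * p - 2 \<le> card A"
  obtains Q where "Q \<subseteq> A" "Q \<noteq> {}" "card Q \<le> p" "zs p f g Q"
proof -
  have p1: "p > 1" using assms(1) prime_gt_1_nat by blast
  obtain A' where A': "A' \<subseteq> A" "card A' = 3 * p - 2" "finite A'"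
    by (rule obtain_subset_with_card_n[OF assms(3)])
  define a :: "nat \<Rightarrow> 'a \<Rightarrow> int" where "a k = (if k = 0 then f else if k = 1 then g else (\<lambda>_. 1))" for k
  have "card {..<3::nat} * (p - 1) < card A'" using A' p1 by auto
  from prime_zero_sum_exists[OF assms(1) _ A'(3) this, of a]
  obtain Q where Q: "Q \<subseteq> A'" "Q \<noteq> {}" "\<And>k. k \<in> {..<3} \<Longrightarrow> int p dvd sum (a k) Q" by auto
  have zQ: "zs p f g Q" using Q(3)[of 0] Q(3)[of 1] by (simp add: zs_def a_def)
  have "int p dvd int (card Q)" using Q(3)[of 2] by (simp add: a_def)
  then obtain k where k: "card Q = p * k" by (auto simp: int_dvd_int_iff)
  have finQ: "finite Q" using Q(1) A'(3) finite_subset by blast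
  have "card Q \<le> 3 * p - 2" using card_mono[OF A'(3) Q(1)] A'(2) by simp
  then have "p * k < p * 3" using k p1 by linarith
  then have "k < 3" by simp
  moreover have "k \<noteq> 0" using k Q(2) finQ by auto
  ultimately consider "k = 1" | "k = 2" by linarith
  then show ?thesis
  proof cases
    case 1
    then show ?thesis using that[of Q] Q A'(1) zQ k by auto
  next
    case 2
    obtain x where x: "x \<in> Q" using Q(2) by auto
    have "2 * p - 1 \<le> card (Q - {x})" using x finQ k 2 by simp
    from prime_dav[OF assms(1) _ this, of f g] finQ obtain R
      where R: "R \<subseteq> Q - {x}" "R \<noteq> {}" "zs p f g R" by auto
    have RQ: "R \<subseteq> Q" "Q - R \<noteq> {}" using R x by auto
    have "card R + card (Q - R) = 2 * p"
      using RQ finQ k 2 card_mono[OF finQ RQ(1)]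
      by (simp add: card_Diff_subset finite_subset)
    then consider "card R \<le> p" | "card (Q - R) \<le> p" by linarith
    then show ?thesis
    proof cases
      case 1 then show ?thesis using that[of R] R RQ Q(1) A'(1) by blast
    next
      case 2 then show ?thesis using that[of "Q - R"] RQ Q(1) A'(1) zs_Diff[OF finQ RQ(1) zQ R(3)] by blast
    qed
  qed
qed

text \<open>The index type is fixed to \<open>nat\<close> so that this is a property of m alone;
  blocks are numbered by \<open>nat\<close> in order to apply it again to their sums.\<close>

definition eta_bound :: "nat \<Rightarrow> bool" where
  "eta_bound m \<longleftrightarrow> (\<forall>A (f::nat \<Rightarrow> int) g. finite A \<longrightarrow> 3 * m - 2 \<le> card A \<longrightarrow>
     (\<exists>Q\<subseteq>A. Q \<noteq> {} \<and> card Q \<le> m \<and> zs m f g Q))"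

definition dav_bound :: "nat \<Rightarrow> bool" where
  "dav_bound m \<longleftrightarrow> (\<forall>A (f::nat \<Rightarrow> int) g. finite A \<longrightarrow> 2 * m - 1 \<le> card A \<longrightarrow>
     (\<exists>Q\<subseteq>A. Q \<noteq> {} \<and> zs m f g Q))"

lemma disjoint_family_on_fun_upd:
  assumes "disjoint_family_on B {..<k::nat}" "\<And>j. j < k \<Longrightarrow> B j \<inter> R = {}"
  shows "disjoint_family_on (B(k := R)) {..<Suc k}"
  unfolding disjoint_family_on_def
proof (intro ballI impI)
  fix i j assume "i \<in> {..<Suc k}" "j \<in> {..<Suc k}" "i \<noteq> j"
  then consider "i < k" "j < k" | "i = k" "j < k" | "i < k" "j = k" by (auto simp: less_Suc_eq)
  then show "(B(k := R)) i \<inter> (B(k := R)) j = {}"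
    using assms \<open>i \<noteq> j\<close> unfolding disjoint_family_on_def by cases (auto simp: Int_commute)
qed

text \<open>Greedy removal: before the last of the k blocks is taken, at most (k - 1) m terms have
  gone and 3m - 2 remain.\<close>

lemma extract_blocks:
  fixes f g :: "nat \<Rightarrow> int"
  assumes "eta_bound m" "finite A" "k * m + 2 * m - 2 \<le> card A"
  obtains B where "\<And>j. j < k \<Longrightarrow> B j \<subseteq> A \<and> B j \<noteq> {} \<and> card (B j) \<le> m \<and> zs m f g (B j)"
    "disjoint_family_on B {..<k::nat}"
proof -
  have "\<exists>B. (\<forall>j<k. B j \<subseteq> A \<and> B j \<noteq> {} \<and> card (B j) \<le> m \<and> zs m f g (B j)) \<and>
          disjoint_family_on B {..<k::nat}"
    using assms(2,3)
  proof (induction k arbitrary: A)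
    case 0
    then show ?case by (auto simp: disjoint_family_on_def)
  next
    case (Suc k)
    have "3 * m - 2 \<le> card A" using Suc.prems by simp
    then obtain Q where Q: "Q \<subseteq> A" "Q \<noteq> {}" "card Q \<le> m" "zs m f g Q"
      using assms(1)[unfolded eta_bound_def, rule_format, OF Suc.prems(1), of f g] by auto
    have "k * m + 2 * m - 2 \<le> card (A - Q)"
      using Suc.prems Q by (simp add: card_Diff_subset finite_subset)
    with Suc.IH[of "A - Q"] Suc.prems(1) obtain B where
      B: "\<forall>j<k. B j \<subseteq> A - Q \<and> B j \<noteq> {} \<and> card (B j) \<le> m \<and> zs m f g (B j)"
        "disjoint_family_on B {..<k}" by auto
    let ?B = "B(k := Q)"
    have "\<forall>j<Suc k. ?B j \<subseteq> A \<and> ?B j \<noteq> {} \<and> card (?B j) \<le> m \<and> zs m f g (?B j)"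
      using B Q by (auto simp: less_Suc_eq)
    moreover have "disjoint_family_on ?B {..<Suc k}"
    proof -
      have "B j \<inter> Q = {}" if "j < k" for j using B that by blast
      then show ?thesis using B(2) by (intro disjoint_family_on_fun_upd)
    qed
    ultimately show ?case by blast
  qed
  then show ?thesis using that by blast
qed

text \<open>One term more than in \<open>extract_blocks\<close> leaves at least 2m - 1 terms after k
  short blocks, enough for a further block of uncontrolled length.\<close>

lemma extract_blocks_extra:
  fixes f g :: "nat \<Rightarrow> int"
  assumes "eta_bound m" "dav_bound m" "finite A" "k * m + 2 * m - 1 \<le> card A"
  obtains B where "\<And>j. j < Suc k \<Longrightarrow> B j \<subseteq> A \<and> B j \<noteq> {} \<and> zs m f g (B j)"
    "disjoint_family_on B {..<Suc k}"
proof -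
  have "k * m + 2 * m - 2 \<le> card A" using assms(4) by simp
  from extract_blocks[OF assms(1,3) this, of f g] obtain B where
    B: "\<And>j. j < k \<Longrightarrow> B j \<subseteq> A \<and> B j \<noteq> {} \<and> card (B j) \<le> m \<and> zs m f g (B j)"
      "disjoint_family_on B {..<k}" by blast
  let ?U = "\<Union>j<k. B j"
  have UA: "?U \<subseteq> A" using B(1) by auto
  have "card ?U \<le> (\<Sum>j<k. card (B j))" by (rule card_UN_le) simp
  also have "\<dots> \<le> (\<Sum>j<k. m)" using B(1) by (intro sum_mono) auto
  finally have "card ?U \<le> k * m" by simp
  then have c: "2 * m - 1 \<le> card (A - ?U)"
    using assms(4) card_Diff_subset[OF finite_subset[OF UA assms(3)] UA] by linarith
  obtain R where R: "R \<subseteq> A - ?U" "R \<noteq> {}" "zs m f g R"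
    using assms(2)[unfolded dav_bound_def, rule_format, OF finite_Diff[OF assms(3)] c, of f g] by auto
  let ?B = "B(k := R)"
  have "?B j \<subseteq> A \<and> ?B j \<noteq> {} \<and> zs m f g (?B j)" if "j < Suc k" for j
    using B(1)[of j] R that by (auto simp: less_Suc_eq)
  moreover have "disjoint_family_on ?B {..<Suc k}"
    by (rule disjoint_family_on_fun_upd[OF B(2)]) (use R(1) in auto)
  ultimately show ?thesis by (rule that)
qed

text \<open>Inductive method: the block sums of a family of \<open>p\<close>-zero-sums are divisible by \<open>p\<close>, and
  a \<open>q\<close>-zero-sum among the quotients gives a \<open>pq\<close>-zero-sum.\<close>

lemma zs_blocks:
  assumes "finite J" "\<And>j. j \<in> J \<Longrightarrow> finite (B j) \<and> zs p f g (B j)" "disjoint_family_on B J"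
    and "zs q (\<lambda>j. sum f (B j) div int p) (\<lambda>j. sum g (B j) div int p) J"
  shows "zs (p * q) f g (\<Union>j\<in>J. B j)"
proof -
  have *: "int (p * q) dvd sum h (\<Union>j\<in>J. B j)"
    if h: "\<And>j. j \<in> J \<Longrightarrow> int p dvd sum h (B j)" "int q dvd (\<Sum>j\<in>J. sum h (B j) div int p)" for h
  proof -
    have "sum h (\<Union>j\<in>J. B j) = (\<Sum>j\<in>J. sum h (B j))"
      using assms(1-3) by (intro sum.UNION_disjoint) (auto simp: disjoint_family_on_def)
    also have "\<dots> = (\<Sum>j\<in>J. int p * (sum h (B j) div int p))"
      using h(1) by (intro sum.cong) auto
    also have "\<dots> = int p * (\<Sum>j\<in>J. sum h (B j) div int p)" by (simp add: sum_distrib_left)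
    finally show ?thesis using h(2) by simp
  qed
  show ?thesis unfolding zs_def
    by (intro conjI *) (use assms(2,4) in \<open>auto simp: zs_def\<close>)
qed

lemma eta_dav_mult:
  assumes "prime p" "eta_bound q" "dav_bound q" "q > 0"
  shows "eta_bound (p * q)" "dav_bound (p * q)"
proof -
  have p1: "p > 1" using assms(1) prime_gt_1_nat by blast
  have ep: "eta_bound p"
    unfolding eta_bound_def by (meson prime_eta[OF assms(1)])
  have dp: "dav_bound p"
    unfolding dav_bound_def by (meson prime_dav[OF assms(1)])
  show "eta_bound (p * q)" unfolding eta_bound_def
  proof (intro allI impI)
    fix A :: "nat set" and f g :: "nat \<Rightarrow> int" assume A: "finite A" "3 * (p * q) - 2 \<le> card A"
    \<comment> \<open>\<open>eta_bound q\<close> asks for 3q - 2 block sums, and k p + 2p = 3pq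
      makes the supply exact. At most q blocks of length at most p are then united.\<close>
    define k where "k = 3 * q - 2"
    have "k * p + 2 * p = 3 * (p * q)"
    proof -
      have "k + 2 = 3 * q" using assms(4) k_def by simp
      then have "(k + 2) * p = 3 * q * p" by simp
      then show ?thesis by (simp add: algebra_simps)
    qed
    then have "k * p + 2 * p - 2 \<le> card A" using A(2) by simp
    from extract_blocks[OF ep A(1) this, of f g] obtain B where
      B: "\<And>j. j < k \<Longrightarrow> B j \<subseteq> A \<and> B j \<noteq> {} \<and> card (B j) \<le> p \<and> zs p f g (B j)"
        "disjoint_family_on B {..<k}" by metis
    obtain J where J: "J \<subseteq> {..<k}" "J \<noteq> {}" "card J \<le> q"
      "zs q (\<lambda>j. sum f (B j) div int p) (\<lambda>j. sum g (B j) div int p) J"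
    proof -
      have "\<exists>J\<subseteq>{..<k}. J \<noteq> {} \<and> card J \<le> q \<and>
          zs q (\<lambda>j. sum f (B j) div int p) (\<lambda>j. sum g (B j) div int p) J"
        using assms(2)[unfolded eta_bound_def, rule_format, of "{..<k}"] k_def by simp
      then show ?thesis using that by blast
    qed
    have finJ: "finite J" using J(1) finite_subset by auto
    have "zs (p * q) f g (\<Union>j\<in>J. B j)"
    proof (rule zs_blocks[OF finJ _ _ J(4)])
      show "disjoint_family_on B J" using B(2) J(1) disjoint_family_on_mono by blast
      show "finite (B j) \<and> zs p f g (B j)" if "j \<in> J" for j
        using B(1)[of j] that J(1) A(1) finite_subset by auto
    qed
    moreover have "card (\<Union>j\<in>J. B j) \<le> p * q"
    proof -
      have "card (\<Union>j\<in>J. B j) \<le> (\<Sum>j\<in>J. card (B j))" by (rule card_UN_le[OF finJ])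
      also have "\<dots> \<le> (\<Sum>j\<in>J. p)" using B J(1) by (intro sum_mono) auto
      also have "\<dots> = card J * p" by simp
      also have "\<dots> \<le> q * p" using J(3) by simp
      finally show ?thesis by (simp add: mult.commute)
    qed
    moreover have "B j \<subseteq> A" "B j \<noteq> {}" if "j \<in> J" for j
      using B(1)[of j] J(1) that by blast+
    then have "(\<Union>j\<in>J. B j) \<subseteq> A" "(\<Union>j\<in>J. B j) \<noteq> {}" using J(2) by blast+
    ultimately show "\<exists>Q\<subseteq>A. Q \<noteq> {} \<and> card Q \<le> p * q \<and> zs (p * q) f g Q" by blast
  qed
  show "dav_bound (p * q)" unfolding dav_bound_def
  proof (intro allI impI)
    fix A :: "nat set" and f g :: "nat \<Rightarrow> int" assume A: "finite A" "2 * (p * q) - 1 \<le> card A"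
    \<comment> \<open>Only 2q - 2 short blocks are available; the block of uncontrolled length is
      number 2q - 1.\<close>
    define k where "k = 2 * q - 2"
    have kp: "k * p + 2 * p = 2 * (p * q)"
    proof -
      have "k + 2 = 2 * q" using assms(4) k_def by simp
      then have "(k + 2) * p = 2 * q * p" by simp
      then show ?thesis by (simp add: algebra_simps)
    qed
    then have "k * p + 2 * p - 1 \<le> card A" using A(2) by simp
    from extract_blocks_extra[OF ep dp A(1) this, of f g] obtain B where
      B: "\<And>j. j < Suc k \<Longrightarrow> B j \<subseteq> A \<and> B j \<noteq> {} \<and> zs p f g (B j)"
        "disjoint_family_on B {..<Suc k}" by blast
    have "2 * q - 1 \<le> card {..<Suc k}" using k_def assms(4) by simp
    then obtain J where J: "J \<subseteq> {..<Suc k}" "J \<noteq> {}"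
      "zs q (\<lambda>j. sum f (B j) div int p) (\<lambda>j. sum g (B j) div int p) J"
    proof -
      have "\<exists>J\<subseteq>{..<Suc k}. J \<noteq> {} \<and>
          zs q (\<lambda>j. sum f (B j) div int p) (\<lambda>j. sum g (B j) div int p) J"
        using assms(3)[unfolded dav_bound_def, rule_format, of "{..<Suc k}"] \<open>2 * q - 1 \<le> card {..<Suc k}\<close>
        by blast
      then show ?thesis using that by blast
    qed
    have finJ: "finite J" using J(1) finite_subset by auto
    have "zs (p * q) f g (\<Union>j\<in>J. B j)"
    proof (rule zs_blocks[OF finJ _ _ J(3)])
      show "disjoint_family_on B J" using B(2) J(1) disjoint_family_on_mono by blast
      show "finite (B j) \<and> zs p f g (B j)" if "j \<in> J" for j
        using B(1)[of j] that J(1) A(1) finite_subset by blast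
    qed
    moreover have "B j \<subseteq> A" "B j \<noteq> {}" if "j \<in> J" for j
      using B(1)[of j] J(1) that by blast+
    then have "(\<Union>j\<in>J. B j) \<subseteq> A" "(\<Union>j\<in>J. B j) \<noteq> {}" using J(2) by blast+
    ultimately show "\<exists>Q\<subseteq>A. Q \<noteq> {} \<and> zs (p * q) f g Q" by blast
  qed
qed

lemma eta_dav: "m > 0 \<Longrightarrow> eta_bound m \<and> dav_bound m"
proof (induction m rule: less_induct)
  case (less m)
  show ?case
  proof (cases "m = 1")
    case True
    have *: "\<exists>Q\<subseteq>A. Q \<noteq> {} \<and> card Q \<le> 1 \<and> zs 1 f g Q"
      if "finite A" "1 \<le> card A" for A and f g :: "nat \<Rightarrow> int"
    proof -
      obtain x where "x \<in> A" using \<open>1 \<le> card A\<close> by fastforce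
      then show ?thesis by (intro exI[of _ "{x}"]) (auto simp: zs_def)
    qed
    have "eta_bound 1" unfolding eta_bound_def using * by simp
    moreover have "dav_bound 1" unfolding dav_bound_def using * by (metis diff_add_inverse mult_2 nat_mult_1_right)
    ultimately show ?thesis using True by simp
  next
    case False
    then obtain p where p: "prime p" "p dvd m" using prime_factor_nat by blast
    then obtain q where q: "m = p * q" by auto
    then have "q > 0" "q < m" using less.prems p(1) prime_gt_1_nat[OF p(1)] by auto
    then have "eta_bound q" "dav_bound q" using less.IH[of q] by blast+
    then show ?thesis using eta_dav_mult[OF p(1) _ _ \<open>q > 0\<close>] q by blast
  qed
qed

lemma eta:
  fixes f g :: "nat \<Rightarrow> int"
  assumes "m > 0" "finite A" "3 * m - 2 \<le> card A"
  obtains Q where "Q \<subseteq> A" "Q \<noteq> {}" "card Q \<le> m" "zs m f g Q"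
  using eta_dav[OF assms(1), THEN conjunct1, unfolded eta_bound_def, rule_format, OF assms(2,3), of f g]
  by auto

lemma dav:
  fixes f g :: "nat \<Rightarrow> int"
  assumes "m > 0" "finite A" "2 * m - 1 \<le> card A"
  obtains Q where "Q \<subseteq> A" "Q \<noteq> {}" "zs m f g Q"
  using eta_dav[OF assms(1), THEN conjunct2, unfolded dav_bound_def, rule_format, OF assms(2,3), of f g]
  by auto

section \<open>Zero-sums in cyclic groups\<close>

lemma cyclic_zero_sum_exists:
  fixes f :: "'i \<Rightarrow> int"
  assumes "finite A" "n > 0" "n \<le> card A"
  obtains Q where "Q \<subseteq> A" "Q \<noteq> {}" "int n dvd sum f Q"
proof -
  obtain A' where A': "A' \<subseteq> A" "card A' = n" "finite A'"
    by (rule obtain_subset_with_card_n[OF assms(3)])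
  obtain e where e: "bij_betw e {..<n} A'"
    using ex_bij_betw_nat_finite[OF A'(3)] A'(2) by (auto simp: atLeast0LessThan)
  define s where "s k = (\<Sum>i<k. f (e i)) mod int n" for k
  have "\<not> inj_on s {..n}"
  proof (rule pigeonhole)
    have "s ` {..n} \<subseteq> {0..<int n}" using assms(2) by (auto simp: s_def)
    then have "card (s ` {..n}) \<le> card {0..<int n}" by (intro card_mono) auto
    then show "card (s ` {..n}) < card {..n}" by simp
  qed
  then obtain k l where kl: "k < l" "l \<le> n" "s k = s l"
  proof -
    obtain i j where ij: "i \<le> n" "j \<le> n" "s i = s j" "i \<noteq> j"
      using \<open>\<not> inj_on s {..n}\<close> unfolding inj_on_def by blast
    then show ?thesis using that[of i j] that[of j i] by (cases "i < j") auto
  qed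
  have sub: "{k..<l} \<subseteq> {..<n}" using kl by auto
  have "(\<Sum>i<l. f (e i)) = (\<Sum>i<k. f (e i)) + (\<Sum>i\<in>{k..<l}. f (e i))"
    using sum.atLeastLessThan_concat[of 0 k l "\<lambda>i. f (e i)"] kl by (simp add: atLeast0LessThan)
  then have "int n dvd (\<Sum>i\<in>{k..<l}. f (e i))"
    using kl(3) unfolding s_def by (simp add: mod_eq_dvd_iff dvd_diff_commute[of "int n"])
  moreover have "sum f (e ` {k..<l}) = (\<Sum>i\<in>{k..<l}. f (e i))"
    using e sub by (intro sum.reindex_cong[OF _ refl]) (auto simp: bij_betw_def intro: inj_on_subset)
  moreover have "e ` {k..<l} \<subseteq> A" using e sub A'(1) unfolding bij_betw_def by blast
  ultimately show ?thesis using that[of "e ` {k..<l}"] kl by auto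
qed

text \<open>Enumerate A starting with x, y. The sums of the first 1, ..., n - 1 terms are nonzero
  and distinct modulo n, so f y equals one of them. A partial sum containing further terms besides y
  cannot equal f y, since those terms would sum to zero; only the first one, f x, remains.\<close>

lemma cyclic_extremal_all_cong:
  fixes f :: "'i \<Rightarrow> int"
  assumes "finite A" "card A = n"
    and nz: "\<And>Q. Q \<subseteq> A \<Longrightarrow> Q \<noteq> {} \<Longrightarrow> Q \<noteq> A \<Longrightarrow> \<not> int n dvd sum f Q"
    and "x \<in> A" "y \<in> A"
  shows "[f x = f y] (mod int n)"
proof (cases "x = y")
  case False
  have n2: "n \<ge> 2" using card_mono[of A "{x, y}"] assms(1,2,4,5) False by simp
  obtain zs where zs: "set zs = A - {x, y}" "distinct zs"
    using finite_distinct_list[of "A - {x, y}"] assms(1) by auto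
  define xs where "xs = x # y # zs"
  have xs: "set xs = A" "distinct xs" using zs assms(4,5) False by (auto simp: xs_def)
  then have len: "length xs = n" using distinct_card[OF xs(2)] assms(2) by simp
  define S where "S k = set (take (Suc k) xs)" for k
  have cS: "card (S k) = Suc k" if "k < n" for k
    using distinct_card[OF distinct_take[OF xs(2)], of "Suc k"] that len by (simp add: S_def)
  have S: "S k \<subseteq> A" "S k \<noteq> {}" "S k \<noteq> A" if "k < n - 1" for k
  proof -
    show "S k \<subseteq> A" unfolding S_def xs(1)[symmetric] by (rule set_take_subset)
    show "S k \<noteq> {}" by (simp add: S_def xs_def)
    have "k < n" using that by simp
    then have "card (S k) = Suc k" by (rule cS)
    then show "S k \<noteq> A" using that assms(2) by auto
  qed
  have Smono: "S k \<subset> S l" if "k < l" "l < n - 1" for k l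
  proof -
    have "k < n" "l < n" using that by simp_all
    then have "card (S k) \<noteq> card (S l)" using cS[of k] cS[of l] that(1) by simp
    moreover have "S k \<subseteq> S l" unfolding S_def by (rule set_take_subset_set_take) (use that in simp)
    ultimately show ?thesis by (auto simp: psubset_eq)
  qed
  \<comment> \<open>The slot n - 1 holds f y, the slots below it the n - 1 partial sums: n values
    among n - 1 nonzero residues.\<close>
  have ninj: "\<not> inj_on (\<lambda>k. (if k = n - 1 then f y else sum f (S k)) mod int n) {..<n}" (is "\<not> inj_on ?h _")
  proof (rule pigeonhole)
    have "?h ` {..<n} \<subseteq> {1..<int n}"
    proof
      fix v assume "v \<in> ?h ` {..<n}"
      then obtain k where k: "k < n" "v = ?h k" by auto
      have "\<not> int n dvd (if k = n - 1 then f y else sum f (S k))"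
      proof (cases "k = n - 1")
        case True
        have "{y} \<noteq> A" using False assms(4) by auto
        then show ?thesis using nz[of "{y}"] assms(5) True by simp
      next
        case False
        then show ?thesis using nz[of "S k"] S[of k] k by simp
      qed
      then have "v \<noteq> 0" unfolding k(2) by (simp only: dvd_eq_mod_eq_0 not_False_eq_True)
      moreover have "0 \<le> v" "v < int n" using k(2) n2 by auto
      ultimately show "v \<in> {1..<int n}" by auto
    qed
    then have "card (?h ` {..<n}) \<le> card {1..<int n}" by (intro card_mono) auto
    then show "card (?h ` {..<n}) < card {..<n}" using n2 by simp
  qed
  then obtain k l where kl: "k < l" "l < n" "?h k = ?h l"
  proof -
    obtain i j where ij: "i < n" "j < n" "?h i = ?h j" "i \<noteq> j"
      using ninj unfolding inj_on_def by blast
    then show ?thesis using that[of i j] that[of j i] by (cases "i < j") auto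
  qed
  have Sfin: "finite (S k)" for k by (simp add: S_def)
  have l: "l = n - 1"
  proof (rule ccontr)
    assume "l \<noteq> n - 1"
    then have l': "l < n - 1" using kl by simp
    have sub: "S k \<subset> S l" by (rule Smono[OF kl(1) l'])
    have "int n dvd sum f (S l) - sum f (S k)"
      using kl l' by (simp add: mod_eq_dvd_iff[symmetric])
    then have "int n dvd sum f (S l - S k)" using sub Sfin by (simp add: sum_diff psubset_imp_subset)
    moreover have "S l - S k \<subseteq> A" "S l - S k \<noteq> {}" using S[OF l'] sub by auto
    moreover have "S l - S k \<noteq> A" using S(1,2)[of k] kl l' by fastforce
    ultimately show False using nz by blast
  qed
  then have c: "[sum f (S k) = f y] (mod int n)" using kl by (simp add: cong_def)
  have "k = 0"
  proof (rule ccontr)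
    assume k0: "k \<noteq> 0"
    then have yS: "y \<in> S k" by (cases k) (simp_all add: S_def xs_def)
    have kn: "k < n - 1" using kl l by simp
    have "int n dvd sum f (S k) - f y" using c by (simp add: cong_iff_dvd_diff)
    then have "int n dvd sum f (S k - {y})" using yS Sfin[of k] by (simp add: sum_diff1)
    moreover have "S k - {y} \<noteq> {}" using False by (auto simp: S_def xs_def)
    moreover have "S k - {y} \<noteq> A" using assms(5) by auto
    moreover have "S k - {y} \<subseteq> A" using S[OF kn] by auto
    ultimately show False using nz by blast
  qed
  then show ?thesis using c by (simp add: S_def xs_def)
qed simp

section \<open>Coordinates adapted to a term of high multiplicity\<close>

text \<open>An automorphism of K, given by a matrix with determinant invertible modulo m. Indices
  and the lift data h are untouched by it.\<close>

definition coords :: "nat \<Rightarrow> ('i \<Rightarrow> int) \<Rightarrow> ('i \<Rightarrow> int) \<Rightarrow> ('i \<Rightarrow> int) \<Rightarrow> ('i \<Rightarrow> int) \<Rightarrow> bool" where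
  "coords m f g f' g' \<longleftrightarrow> (\<exists>a b c d. coprime (a * d - b * c) (int m) \<and>
     (\<forall>i. [f' i = a * f i + b * g i] (mod int m) \<and> [g' i = c * f i + d * g i] (mod int m)))"

text \<open>In K this reads k = l + t e. Unlike an equation between coordinate values, it survives
  every change of coordinates.\<close>

definition rel :: "nat \<Rightarrow> ('i \<Rightarrow> int) \<Rightarrow> ('i \<Rightarrow> int) \<Rightarrow> 'i \<Rightarrow> 'i \<Rightarrow> int \<Rightarrow> 'i \<Rightarrow> bool" where
  "rel m f g k l t e \<longleftrightarrow>
     [f k = f l + t * f e] (mod int m) \<and> [g k = g l + t * g e] (mod int m)"

definition cls :: "nat \<Rightarrow> ('i \<Rightarrow> int) \<Rightarrow> ('i \<Rightarrow> int) \<Rightarrow> 'i \<Rightarrow> 'i \<Rightarrow> bool" where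
  "cls m f g i j \<longleftrightarrow> [f i = f j] (mod int m) \<and> [g i = g j] (mod int m)"

lemma cls_refl [simp]: "cls m f g i i"
  by (simp add: cls_def)

lemma cls_sym: "cls m f g i j \<Longrightarrow> cls m f g j i"
  by (simp add: cls_def cong_sym)

lemma cls_trans: "cls m f g i j \<Longrightarrow> cls m f g j k \<Longrightarrow> cls m f g i k"
  unfolding cls_def by (blast intro: cong_trans)

lemma cls_iff_rel: "cls m f g i j \<longleftrightarrow> rel m f g i j 0 k"
  by (simp add: cls_def rel_def)

lemma coordsE:
  assumes "coords m f g f' g'"
  obtains a b c d where "coprime (a * d - b * c) (int m)"
    and "\<And>i. [f' i = a * f i + b * g i] (mod int m)"
    and "\<And>i. [g' i = c * f i + d * g i] (mod int m)"
  using assms that unfolding coords_def by auto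

lemma coords_sym:
  assumes "coords m f g f' g'"
  shows "coords m f' g' f g"
proof -
  obtain a b c d where D: "coprime (a * d - b * c) (int m)"
    and f': "\<And>i. [f' i = a * f i + b * g i] (mod int m)"
    and g': "\<And>i. [g' i = c * f i + d * g i] (mod int m)"
    using assms by (rule coordsE) blast
  obtain u where u: "[(a * d - b * c) * u = 1] (mod int m)"
    using cong_solve_coprime_int[OF D] by blast
  have "coprime ((u * d) * (u * a) - (- (u * b)) * (- (u * c))) (int m)"
    unfolding coprime_iff_invertible_int
  proof
    have "[((a * d - b * c) * u) * ((a * d - b * c) * u) = 1 * 1] (mod int m)"
      by (rule cong_mult[OF u u])
    then show "[((u * d) * (u * a) - (- (u * b)) * (- (u * c))) * (a * d - b * c) = 1] (mod int m)"
      by (simp add: algebra_simps)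
  qed
  moreover have "[f i = u * d * f' i + - (u * b) * g' i] (mod int m)" for i
  proof -
    have "[u * d * f' i + - (u * b) * g' i =
        u * d * (a * f i + b * g i) + - (u * b) * (c * f i + d * g i)] (mod int m)"
      by (intro cong_add cong_scalar_left f' g')
    also have "u * d * (a * f i + b * g i) + - (u * b) * (c * f i + d * g i) =
        ((a * d - b * c) * u) * f i" by (simp add: algebra_simps)
    also have "[\<dots> = 1 * f i] (mod int m)" by (rule cong_scalar_right[OF u])
    finally show ?thesis by (simp add: cong_sym)
  qed
  moreover have "[g i = - (u * c) * f' i + u * a * g' i] (mod int m)" for i
  proof -
    have "[- (u * c) * f' i + u * a * g' i =
        - (u * c) * (a * f i + b * g i) + u * a * (c * f i + d * g i)] (mod int m)"
      by (intro cong_add cong_scalar_left f' g')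
    also have "- (u * c) * (a * f i + b * g i) + u * a * (c * f i + d * g i) =
        ((a * d - b * c) * u) * g i" by (simp add: algebra_simps)
    also have "[\<dots> = 1 * g i] (mod int m)" by (rule cong_scalar_right[OF u])
    finally show ?thesis by (simp add: cong_sym)
  qed
  ultimately show ?thesis unfolding coords_def by blast
qed

lemma coords_trans:
  assumes "coords m f g f' g'" "coords m f' g' f'' g''"
  shows "coords m f g f'' g''"
proof -
  obtain a b c d where D: "coprime (a * d - b * c) (int m)"
    and f': "\<And>i. [f' i = a * f i + b * g i] (mod int m)"
    and g': "\<And>i. [g' i = c * f i + d * g i] (mod int m)"
    using assms(1) by (rule coordsE) blast
  obtain p q r s where D': "coprime (p * s - q * r) (int m)"
    and f'': "\<And>i. [f'' i = p * f' i + q * g' i] (mod int m)"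
    and g'': "\<And>i. [g'' i = r * f' i + s * g' i] (mod int m)"
    using assms(2) by (rule coordsE) blast
  have "coprime ((p * a + q * c) * (r * b + s * d) - (p * b + q * d) * (r * a + s * c)) (int m)"
  proof -
    have "(p * a + q * c) * (r * b + s * d) - (p * b + q * d) * (r * a + s * c) =
        (p * s - q * r) * (a * d - b * c)" by (simp add: algebra_simps)
    then show ?thesis using D D' by simp
  qed
  moreover have "[x * f' i + y * g' i = (x * a + y * c) * f i + (x * b + y * d) * g i] (mod int m)" for x y i
  proof -
    have "[x * f' i + y * g' i = x * (a * f i + b * g i) + y * (c * f i + d * g i)] (mod int m)"
      by (intro cong_add cong_scalar_left f' g')
    then show ?thesis by (simp add: algebra_simps)
  qed
  ultimately show ?thesis unfolding coords_def using f'' g'' by (blast intro: cong_trans)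
qed

lemma coords_rel:
  assumes "coords m f g f' g'" "rel m f g k l t e"
  shows "rel m f' g' k l t e"
proof -
  obtain a b c d where
    f': "\<And>i. [f' i = a * f i + b * g i] (mod int m)"
    and g': "\<And>i. [g' i = c * f i + d * g i] (mod int m)"
    using assms(1) by (rule coordsE) blast
  have *: "[h k = h l + t * h e] (mod int m)" if h: "\<And>i. [h i = x * f i + y * g i] (mod int m)" for h x y
  proof -
    have "[x * f k + y * g k = x * (f l + t * f e) + y * (g l + t * g e)] (mod int m)"
      by (intro cong_add cong_scalar_left) (use assms(2) in \<open>auto simp: rel_def\<close>)
    also have "x * (f l + t * f e) + y * (g l + t * g e) =
        (x * f l + y * g l) + t * (x * f e + y * g e)" by (simp add: algebra_simps)
    also have "[\<dots> = h l + t * h e] (mod int m)"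
      by (intro cong_add cong_scalar_left) (use h in \<open>auto intro: cong_sym\<close>)
    finally show ?thesis using h[of k] by (rule cong_trans[rotated])
  qed
  show ?thesis unfolding rel_def using *[OF f'] *[OF g'] by blast
qed

lemma coords_cls: "coords m f g f' g' \<Longrightarrow> cls m f' g' i j \<longleftrightarrow> cls m f g i j"
  using coords_rel[of m f g f' g' i j 0 i] coords_rel[OF coords_sym, of m f g f' g' i j 0 i]
  by (auto simp: cls_iff_rel[where k = i])

lemma coords_zs:
  assumes "coords m f g f' g'"
  shows "zs m f' g' Q \<longleftrightarrow> zs m f g Q"
proof -
  have *: "zs m f' g' Q" if co: "coords m f g f' g'" and z: "zs m f g Q" for f g f' g' :: "'a \<Rightarrow> int"
  proof -
    obtain a b c d where
      f': "\<And>i. [f' i = a * f i + b * g i] (mod int m)"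
      and g': "\<And>i. [g' i = c * f i + d * g i] (mod int m)"
      using co by (rule coordsE) blast
    have "int m dvd sum h Q" if h: "\<And>i. [h i = x * f i + y * g i] (mod int m)" for h x y
    proof -
      have "[sum h Q = (\<Sum>i\<in>Q. x * f i + y * g i)] (mod int m)"
        by (rule cong_sum) (rule h)
      also have "(\<Sum>i\<in>Q. x * f i + y * g i) = x * sum f Q + y * sum g Q"
        by (simp add: sum.distrib sum_distrib_left)
      finally have "[sum h Q = x * sum f Q + y * sum g Q] (mod int m)" .
      moreover have "int m dvd x * sum f Q + y * sum g Q"
        using z by (simp add: zs_def)
      ultimately show ?thesis by (simp add: cong_dvd_iff)
    qed
    then show ?thesis using f' g' unfolding zs_def by blast
  qed
  show ?thesis using *[OF assms] *[OF coords_sym[OF assms]] by blast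
qed

text \<open>Bridge between Property B, which speaks of multisets, and index sets: subsequences of
  the image of W come from subsets of W.\<close>

lemma submset_image_mset_set:
  assumes "finite W" "S \<subseteq># image_mset h (mset_set W)"
  obtains Q where "Q \<subseteq> W" "S = image_mset h (mset_set Q)"
proof -
  obtain R where "image_mset h (mset_set W) = S + R"
    using assms(2) by (auto simp: mset_subset_eq_exists_conv)
  then obtain A B where AB: "mset_set W = A + B" "S = image_mset h A"
    using image_mset_eq_plusD by metis
  have "A \<subseteq># mset_set W" using AB(1) by simp
  then have le: "count A x \<le> count (mset_set W) x" for x by (rule mset_subset_eq_count)
  have "A = mset_set (set_mset A)"
  proof (rule multiset_eqI)
    fix x
    have "count A x \<le> 1" using le[of x] assms(1) by (auto simp: count_mset_set' split: if_splits)
    show "count A x = count (mset_set (set_mset A)) x"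
    proof (cases "x \<in># A")
      case True
      then have "0 < count A x" by (simp only: count_greater_zero_iff)
      then have "count A x = 1" using \<open>count A x \<le> 1\<close> by linarith
      then show ?thesis using True by simp
    next
      case False
      then show ?thesis by (simp add: not_in_iff)
    qed
  qed
  moreover have "set_mset A \<subseteq> W" using set_mset_mono[OF \<open>A \<subseteq># mset_set W\<close>] assms(1) by simp
  ultimately show ?thesis using that[of "set_mset A"] AB(2) by simp
qed

lemma property_B_cls:
  fixes f g :: "nat \<Rightarrow> int"
  assumes "property_B m" "finite W" "card W = 2 * m - 1" "zs m f g W"
    and min: "\<And>Q. Q \<subseteq> W \<Longrightarrow> Q \<noteq> {} \<Longrightarrow> Q \<noteq> W \<Longrightarrow> \<not> zs m f g Q"
  obtains e where "e \<in> W" "m - 1 \<le> card {i \<in> W. cls m f g i e}"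
proof -
  have m2: "2 \<le> m" using assms(1) by (simp add: property_B_def)
  define h where "h i = (nat (f i mod int m), nat (g i mod int m))" for i
  define S where "S = image_mset h (mset_set W)"
  have sums: "zero_sum m m (image_mset h (mset_set Q)) \<longleftrightarrow> zs m f g Q" if "finite Q" for Q
  proof -
    have *: "(\<Sum>i\<in>Q. nat (x i mod int m)) mod m = 0 \<longleftrightarrow> int m dvd sum x Q" for x
    proof -
      have "int ((\<Sum>i\<in>Q. nat (x i mod int m))) = (\<Sum>i\<in>Q. x i mod int m)"
        using m2 by simp
      moreover have "[(\<Sum>i\<in>Q. x i mod int m) = sum x Q] (mod int m)"
        by (rule cong_sum) (simp add: cong_def)
      ultimately have "int m dvd int ((\<Sum>i\<in>Q. nat (x i mod int m))) \<longleftrightarrow> int m dvd sum x Q"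
        by (simp add: cong_dvd_iff)
      then show ?thesis by (simp only: int_dvd_int_iff mod_eq_0_iff_dvd)
    qed
    show ?thesis
      unfolding zero_sum_def zs_def
      using * by (simp add: image_mset.compositionality o_def h_def sum_unfold_sum_mset[symmetric])
  qed
  have "seq_over m m S"
    using m2 by (auto simp: seq_over_def S_def grp_def h_def nat_less_iff)
  moreover have "size S = 2 * m - 1" using assms(3) by (simp add: S_def)
  moreover have "min_zero_sum m m S" unfolding min_zero_sum_def
  proof (intro conjI allI impI)
    have "W \<noteq> {}" using assms(3) m2 by auto
    then show "S \<noteq> {#}" using assms(2) by (simp add: S_def mset_set_empty_iff)
    show "zero_sum m m S" using sums[OF assms(2)] assms(4) by (simp add: S_def)
    fix S' assume S': "S' \<subseteq># S \<and> S' \<noteq> {#} \<and> S' \<noteq> S"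
    then obtain Q where Q: "Q \<subseteq> W" "S' = image_mset h (mset_set Q)"
      using submset_image_mset_set[OF assms(2)] unfolding S_def by metis
    have "Q \<noteq> {}" "Q \<noteq> W" using S' Q by (auto simp: S_def)
    then show "\<not> zero_sum m m S'"
      using min[OF Q(1)] sums[of Q] Q assms(2) finite_subset by blast
  qed
  ultimately obtain v where v: "m - 1 \<le> count S v"
    using assms(1) unfolding property_B_def by blast
  have cnt: "count S v = card {i \<in> W. h i = v}"
  proof -
    have "count S v = (\<Sum>i | i \<in> W \<and> v = h i. count (mset_set W) i)"
      using assms(2) by (simp add: S_def count_image_mset')
    also have "\<dots> = (\<Sum>i | i \<in> W \<and> v = h i. 1)" by (rule sum.cong) (use assms(2) in auto)
    finally show ?thesis by (simp add: eq_commute)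
  qed
  then have "card {i \<in> W. h i = v} \<noteq> 0" using v m2 by linarith
  then have "{i \<in> W. h i = v} \<noteq> {}" by (intro notI) simp
  then obtain e where e: "e \<in> W" "h e = v" by blast
  have "{i \<in> W. h i = v} = {i \<in> W. cls m f g i e}"
  proof -
    have "h i = h e \<longleftrightarrow> cls m f g i e" for i
      using m2 by (auto simp: h_def cls_def cong_def eq_nat_nat_iff)
    then show ?thesis using e by auto
  qed
  then show ?thesis using that[OF e(1)] v cnt by simp
qed

text \<open>The terms in \<open>E\<close> lie over the basis element \<open>e = (1, 0)\<close>, the other terms of \<open>W\<close> over
  \<open>e' + \<langle>e\<rangle>\<close> with \<open>e' = (0, 1)\<close>; coordinates are normalised to \<open>{0..<m}\<close>.\<close>

definition adapted :: "nat \<Rightarrow> ('i \<Rightarrow> int) \<Rightarrow> ('i \<Rightarrow> int) \<Rightarrow> 'i set \<Rightarrow> 'i set \<Rightarrow> bool" where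
  "adapted m f g W E \<longleftrightarrow> E \<subseteq> W \<and> card E = m - 1 \<and> (\<forall>i\<in>E. f i = 1 \<and> g i = 0) \<and>
     (\<forall>i\<in>W-E. g i = 1) \<and> (\<forall>i. 0 \<le> f i \<and> f i < int m \<and> 0 \<le> g i \<and> g i < int m) \<and>
     [sum f (W - E) = 1] (mod int m)"

text \<open>A common divisor d > 1 of w and m would make the multiple by q = m / d vanish. So an
  element of order m in the cyclic group of order m is a unit.\<close>

lemma exists_multiple_coprime:
  fixes w :: int
  assumes "m > 0" "\<And>q. 0 < q \<Longrightarrow> q < m \<Longrightarrow> \<not> int m dvd int q * w"
  shows "coprime w (int m)"
proof (rule ccontr)
  assume "\<not> coprime w (int m)"
  define d where "d = gcd w (int m)"
  have d: "d > 0" "d dvd w" "d dvd int m" "d \<noteq> 1"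
    using assms(1) \<open>\<not> coprime w (int m)\<close> by (auto simp: d_def coprime_iff_gcd_eq_1)
  then obtain k where k: "int m = d * k" by blast
  have kpos: "k > 0" using k d(1) assms(1) by (metis of_nat_0_less_iff zero_less_mult_pos)
  have "k < int m" using k d kpos by simp
  then have "\<not> int m dvd int (nat k) * w" using kpos by (intro assms(2)) auto
  moreover have "int m dvd int (nat k) * w"
  proof -
    obtain w' where "w = d * w'" using d(2) by blast
    then have "int (nat k) * w = int m * w'" using k kpos by simp
    then show ?thesis by simp
  qed
  ultimately show False by blast
qed

text \<open>The second hypothesis is a vanishing determinant; as (a, b) is unimodular, (x, y) is a
  multiple of it, and the Bezout coefficients r, s read off the factor.\<close>

lemma cong_multiple_of_unit:
  fixes a b :: int
  assumes "[r * a + s * b = 1] (mod N)" "[a * y = b * x] (mod N)"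
  shows "[x = (r * x + s * y) * a] (mod N)"
proof -
  have "(r * x + s * y) * a = r * a * x + s * (a * y)" by (simp add: algebra_simps)
  also have "[\<dots> = r * a * x + s * (b * x)] (mod N)"
    by (intro cong_add cong_scalar_left assms(2)) simp
  also have "r * a * x + s * (b * x) = (r * a + s * b) * x" by (simp add: algebra_simps)
  also have "[\<dots> = 1 * x] (mod N)" by (rule cong_scalar_right[OF assms(1)])
  finally show ?thesis by (simp add: cong_sym)
qed

text \<open>Modulo the subgroup generated by a term \<open>e\<close> of multiplicity \<open>m - 1\<close>, the other \<open>m\<close>
  terms form a minimal zero-sum sequence over a cyclic group of order \<open>m\<close>, so they are all
  equal there.\<close>

lemma adapted_exists:
  fixes f g :: "nat \<Rightarrow> int"
  assumes "property_B m" "finite W" "card W = 2 * m - 1" "zs m f g W"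
    and min: "\<And>Q. Q \<subseteq> W \<Longrightarrow> Q \<noteq> {} \<Longrightarrow> Q \<noteq> W \<Longrightarrow> \<not> zs m f g Q"
  obtains f' g' E where "coords m f g f' g'" "adapted m f' g' W E"
proof -
  have m2: "2 \<le> m" using assms(1) by (simp add: property_B_def)
  obtain e where e: "e \<in> W" "m - 1 \<le> card {i \<in> W. cls m f g i e}"
    using property_B_cls[OF assms] by blast
  define E where "E = {i \<in> W. cls m f g i e}"
  have EW: "E \<subseteq> W" by (auto simp: E_def)
  have finE: "finite E" using EW assms(2) finite_subset by blast
  have sumE: "[sum f J = int (card J) * f e] (mod int m)" "[sum g J = int (card J) * g e] (mod int m)"
    if "J \<subseteq> E" for J
  proof -
    have "[sum f J = (\<Sum>i\<in>J. f e)] (mod int m)" "[sum g J = (\<Sum>i\<in>J. g e)] (mod int m)"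
      by (rule cong_sum; use that in \<open>auto simp: E_def cls_def\<close>)+
    then show "[sum f J = int (card J) * f e] (mod int m)" "[sum g J = int (card J) * g e] (mod int m)"
      by simp_all
  qed
  have ord: "\<not> (int m dvd int q * f e \<and> int m dvd int q * g e)" if q: "0 < q" "q \<le> card E" "q < 2 * m - 1" for q
  proof
    assume *: "int m dvd int q * f e \<and> int m dvd int q * g e"
    obtain J where J: "J \<subseteq> E" "card J = q" by (rule obtain_subset_with_card_n[OF q(2)])
    have "zs m f g J" using sumE[OF J(1)] J(2) * by (simp add: zs_def cong_dvd_iff)
    moreover have "J \<noteq> {}" "J \<noteq> W" using J(2) q assms(3) by auto
    ultimately show False using min[of J] J(1) EW by blast
  qed
  \<comment> \<open>m equal terms would be a zero-sum, and a proper one because m < 2m - 1.\<close>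
  have cardE: "card E = m - 1"
  proof (rule ccontr)
    assume "card E \<noteq> m - 1"
    then have "m \<le> card E" using e(2) E_def by simp
    moreover have "m < 2 * m - 1" "0 < m" using m2 by linarith+
    ultimately show False using ord[of m] by simp
  qed
  have "coprime (gcd (f e) (g e)) (int m)"
  proof (rule exists_multiple_coprime)
    fix q assume q: "0 < q" "q < m"
    show "\<not> int m dvd int q * gcd (f e) (g e)"
    proof
      assume a: "int m dvd int q * gcd (f e) (g e)"
      have "int m dvd int q * f e" "int m dvd int q * g e"
        by (rule dvd_trans[OF a mult_dvd_mono], simp, simp)+
      moreover have "q \<le> card E" "q < 2 * m - 1" using q cardE by linarith+
      ultimately show False using ord[of q] q(1) by blast
    qed
  qed (use m2 in simp)
  then obtain u where u: "[gcd (f e) (g e) * u = 1] (mod int m)" using cong_solve_coprime_int by blast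
  \<comment> \<open>After multiplication by u, the form r f + s g takes the value 1 at e; it becomes
    the first new coordinate.\<close>
  obtain r0 s0 where rs0: "r0 * f e + s0 * g e = gcd (f e) (g e)" using bezout_int by blast
  define r where "r = r0 * u"
  define s where "s = s0 * u"
  have rs: "[r * f e + s * g e = 1] (mod int m)"
    using u unfolding rs0[symmetric] r_def s_def by (simp add: algebra_simps)
  \<comment> \<open>The determinant against e vanishes modulo m exactly on \<langle>e\<rangle>, so
    it is a coordinate on the quotient by \<langle>e\<rangle>; the unit w is its common value on
    F.\<close>
  define p where "p i = f e * g i - g e * f i" for i
  define F where "F = W - E"
  have finF: "finite F" using assms(2) F_def by simp
  have cardF: "card F = m" using cardE assms(3) EW finE m2 by (simp add: F_def card_Diff_subset)
  have pnz: "\<not> int m dvd sum p Q" if Q: "Q \<subseteq> F" "Q \<noteq> {}" "Q \<noteq> F" for Q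
  proof
    assume a: "int m dvd sum p Q"
    have finQ: "finite Q" using Q(1) finF finite_subset by blast
    have sp: "sum p Q = f e * sum g Q - g e * sum f Q"
      by (simp add: p_def sum_subtractf sum_distrib_left)
    then have fg: "[f e * sum g Q = g e * sum f Q] (mod int m)" using a by (simp add: cong_iff_dvd_diff)
    define t where "t = r * sum f Q + s * sum g Q"
    have tf: "[sum f Q = t * f e] (mod int m)"
      unfolding t_def by (rule cong_multiple_of_unit[OF rs fg])
    have tg: "[sum g Q = t * g e] (mod int m)"
      using cong_multiple_of_unit[of s "g e" r "f e" _ "sum f Q" "sum g Q"] rs cong_sym[OF fg]
      by (simp add: t_def add.commute)
    \<comment> \<open>If p vanishes on Q, then Q sums to t e in K. At most m - 1 copies of e cancel
      this, and E supplies them; part of F stays outside, so the zero-sum is proper.\<close>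
    define j where "j = nat ((- t) mod int m)"
    have j: "int j = (- t) mod int m" using m2 by (simp add: j_def)
    have "(- t) mod int m < int m" using m2 by simp
    then have "j \<le> card E" using j cardE by linarith
    then obtain J where J: "J \<subseteq> E" "card J = j" using obtain_subset_with_card_n by blast
    have finJ: "finite J" and dis: "Q \<inter> J = {}"
      using J Q(1) finE finite_subset by (auto simp: F_def)
    have jt: "[int j = - t] (mod int m)" unfolding j by simp
    have *: "int m dvd sum h (Q \<union> J)"
      if h: "[sum h Q = t * h e] (mod int m)" "[sum h J = int (card J) * h e] (mod int m)" for h
    proof -
      have "[sum h Q + sum h J = t * h e + int j * h e] (mod int m)"
        using cong_add[OF h] J(2) by simp
      also have "[t * h e + int j * h e = t * h e + (- t) * h e] (mod int m)"
        by (intro cong_add cong_scalar_right jt) simp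
      finally have "[sum h Q + sum h J = 0] (mod int m)" by simp
      then show ?thesis
        using finQ finJ dis by (simp add: sum.union_disjoint cong_0_iff)
    qed
    have "zs m f g (Q \<union> J)" unfolding zs_def
      using *[OF tf sumE(1)[OF J(1)]] *[OF tg sumE(2)[OF J(1)]] by blast
    moreover have "Q \<union> J \<noteq> W" using Q(1,3) J(1) by (auto simp: F_def)
    ultimately show False using min[of "Q \<union> J"] Q(1,2) J(1) EW by (auto simp: F_def)
  qed
  obtain i0 where i0: "i0 \<in> F" using cardF m2 by fastforce
  define w where "w = p i0"
  have pw: "[p i = w] (mod int m)" if "i \<in> F" for i
    unfolding w_def using pnz that i0 by (intro cyclic_extremal_all_cong[OF finF cardF]) auto
  have cw: "coprime w (int m)"
  proof (rule exists_multiple_coprime)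
    fix q assume q: "0 < q" "q < m"
    obtain Q where Q: "Q \<subseteq> F" "card Q = q" using obtain_subset_with_card_n[of q F] q cardF by auto
    have "[sum p Q = (\<Sum>i\<in>Q. w)] (mod int m)" by (rule cong_sum) (use pw Q(1) in auto)
    then have "[sum p Q = int q * w] (mod int m)" using Q(2) by simp
    moreover have "Q \<noteq> {}" "Q \<noteq> F" using Q(2) q cardF by auto
    then have "\<not> int m dvd sum p Q" by (rule pnz[OF Q(1)])
    ultimately show "\<not> int m dvd int q * w" by (simp add: cong_dvd_iff)
  qed (use m2 in simp)
  then obtain v where v: "[w * v = 1] (mod int m)" using cong_solve_coprime_int by blast
  define f' where "f' i = (r * f i + s * g i) mod int m" for i
  define g' where "g' i = (v * p i) mod int m" for i
  have co: "coords m f g f' g'"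
  proof -
    have "coprime (r * (v * f e) - s * (- (v * g e))) (int m)"
      unfolding coprime_iff_invertible_int
    proof
      have "[(r * f e + s * g e) * (w * v) = 1 * 1] (mod int m)" by (rule cong_mult[OF rs v])
      then show "[(r * (v * f e) - s * (- (v * g e))) * w = 1] (mod int m)" by (simp add: algebra_simps)
    qed
    moreover have "[f' i = r * f i + s * g i] (mod int m)" for i by (simp add: f'_def)
    moreover have "[g' i = - (v * g e) * f i + v * f e * g i] (mod int m)" for i
      by (simp add: g'_def p_def algebra_simps)
    ultimately show ?thesis unfolding coords_def by blast
  qed
  have E': "f' i = 1 \<and> g' i = 0" if "i \<in> E" for i
  proof -
    have i: "[f i = f e] (mod int m)" "[g i = g e] (mod int m)" using that by (auto simp: E_def cls_def)
    have "[r * f i + s * g i = r * f e + s * g e] (mod int m)" by (intro cong_add cong_scalar_left i)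
    also have "[r * f e + s * g e = 1] (mod int m)" by (rule rs)
    finally have "f' i = 1" using m2 by (simp add: f'_def cong_def)
    moreover have "[p i = f e * g e - g e * f e] (mod int m)"
      unfolding p_def by (intro cong_diff cong_scalar_left i)
    then have "[v * p i = v * 0] (mod int m)" by (intro cong_scalar_left) (simp add: mult.commute)
    then have "g' i = 0" by (simp add: g'_def cong_def)
    ultimately show ?thesis by simp
  qed
  have F': "g' i = 1" if "i \<in> F" for i
  proof -
    have "[v * p i = v * w] (mod int m)" by (rule cong_scalar_left[OF pw[OF that]])
    also have "[v * w = 1] (mod int m)" using v by (simp add: mult.commute)
    finally show ?thesis using m2 by (simp add: g'_def cong_def)
  qed
  have "[sum f' F = 1] (mod int m)"
  proof -
    have "int m dvd sum f' W" using coords_zs[OF co, of W] assms(4) by (simp add: zs_def)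
    also have "sum f' W = sum f' F + sum f' E"
      unfolding F_def using assms(2) EW by (simp add: sum.subset_diff)
    also have "sum f' E = int m - 1" using E' cardE m2 by (simp add: of_nat_diff)
    finally have "int m dvd (sum f' F - 1) + int m" by (simp add: algebra_simps)
    then have "int m dvd sum f' F - 1" by (simp only: dvd_add_left_iff dvd_refl)
    then show ?thesis by (simp add: cong_iff_dvd_diff)
  qed
  then have "adapted m f' g' W E"
    unfolding adapted_def using EW cardE E' F' m2 by (auto simp: F_def f'_def g'_def)
  then show ?thesis using that[OF co] by blast
qed

section \<open>A block of length \<open>2m - 1\<close> and a block of length \<open>m\<close>\<close>

text \<open>Along an enumeration of B the partial sums pass from at most t to more than t at some
  term v; D is the part before it.\<close>

lemma subset_sum_crossing:
  fixes f :: "'i \<Rightarrow> int"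
  assumes "finite B" "0 \<le> t" "t < sum f B"
  obtains D v where "D \<subseteq> B" "v \<in> B - D" "sum f D \<le> t" "t < sum f D + f v"
proof -
  have "\<exists>D v. D \<subseteq> B \<and> v \<in> B - D \<and> sum f D \<le> t \<and> t < sum f D + f v"
    using assms
  proof (induction B rule: finite_induct)
    case (insert x B)
    show ?case
    proof (cases "t < sum f B")
      case True
      then obtain D v where "D \<subseteq> B" "v \<in> B - D" "sum f D \<le> t" "t < sum f D + f v"
        using insert.IH insert.prems by auto
      then show ?thesis by (intro exI[of _ D] exI[of _ v]) auto
    next
      case False
      then show ?thesis using insert.hyps insert.prems
        by (intro exI[of _ B] exI[of _ x]) (auto simp: add.commute)
    qed
  qed simp
  then show ?thesis using that by blast
qed

lemma subset_sum_window:
  fixes f :: "'i \<Rightarrow> int"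
  assumes "finite B" "\<And>i. i \<in> B \<Longrightarrow> 0 \<le> f i \<and> f i \<le> M" "0 \<le> t" "t < sum f B"
  obtains D where "D \<subseteq> B" "t < sum f D" "sum f D \<le> t + M"
proof -
  obtain D v where D: "D \<subseteq> B" "v \<in> B - D" "sum f D \<le> t" "t < sum f D + f v"
    by (rule subset_sum_crossing[OF assms(1,3,4)])
  have "sum f (insert v D) = sum f D + f v"
    using D(2) finite_subset[OF D(1) assms(1)] by (simp add: add.commute)
  then show ?thesis using that[of "insert v D"] D assms(2)[of v] by auto
qed

text \<open>The pair \<open>(f i, g i)\<close> modulo \<open>m\<close> is the image of the term \<open>i\<close> in \<open>K\<close>; for a subsequence that
  vanishes in \<open>K\<close>, the sum of \<open>h\<close> modulo \<open>N\<close> encodes its sum in the kernel.\<close>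

locale two_block =
  fixes m :: nat and N k0 :: int and V :: "nat set" and f g h :: "nat \<Rightarrow> int"
  assumes m3: "3 \<le> m" and fin: "finite V" and card_V: "card V = 3 * m - 1"
    and zV: "zs m f g V"
    and uni: "\<And>Q. Q \<subseteq> V \<Longrightarrow> Q \<noteq> {} \<Longrightarrow> Q \<noteq> V \<Longrightarrow> zs m f g Q \<Longrightarrow> [sum h Q = k0] (mod N)"
    and nz: "\<not> N dvd k0"
begin

lemma uni': "Q \<subseteq> V \<Longrightarrow> Q \<noteq> {} \<Longrightarrow> card Q < 3 * m - 1 \<Longrightarrow> zs m f g Q \<Longrightarrow> [sum h Q = k0] (mod N)"
  by (rule uni) (use card_V in auto)

lemma finV: "Q \<subseteq> V \<Longrightarrow> finite Q"
  using fin finite_subset by blast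

text \<open>Otherwise the complement splits into two zero-sums, and three zero-sum blocks force
  \<open>k0 = 2 k0\<close>.\<close>

lemma short:
  assumes Q: "Q \<subseteq> V" "Q \<noteq> {}" "zs m f g Q"
  shows "m \<le> card Q"
proof (rule ccontr)
  assume "\<not> m \<le> card Q"
  have finQ: "finite Q" using finV[OF Q(1)] .
  have "card (V - Q) = 3 * m - 1 - card Q"
    using card_Diff_subset[OF finQ Q(1)] card_V by simp
  then have cVQ: "2 * m \<le> card (V - Q)" using \<open>\<not> m \<le> card Q\<close> by linarith
  then have "0 < card (V - Q)" using m3 by linarith
  then have "V - Q \<noteq> {}" using card_gt_0_iff by blast
  then obtain x where x: "x \<in> V - Q" by blast
  have "2 * m - 1 \<le> card (V - Q - {x})" using cVQ x fin by simp
  then obtain R where R: "R \<subseteq> V - Q - {x}" "R \<noteq> {}" "zs m f g R"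
    using dav[of m "V - Q - {x}" f g] m3 fin by auto
  have finR: "finite R" using R(1) finV by blast
  have z: "zs m f g (Q \<union> R)" using zs_Un[OF finQ finR _ Q(3) R(3)] R(1) by blast
  have "[sum h (Q \<union> R) = k0] (mod N)" using Q(1,2) R(1) x z by (intro uni) auto
  moreover have "[sum h Q = k0] (mod N)" using Q x by (intro uni) auto
  moreover have "[sum h R = k0] (mod N)" using R x by (intro uni) auto
  moreover have "sum h (Q \<union> R) = sum h Q + sum h R"
    using finQ finR R(1) by (intro sum.union_disjoint) auto
  ultimately have d: "N dvd sum h Q + sum h R - k0" "N dvd sum h Q - k0" "N dvd sum h R - k0"
    by (simp_all add: cong_iff_dvd_diff)
  have "N dvd (sum h Q - k0) + (sum h R - k0) - (sum h Q + sum h R - k0)"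
    by (rule dvd_diff[OF dvd_add[OF d(2,3)] d(1)])
  then show False using nz by simp
qed

text \<open>Both versions of the zero-sum have sum k0 in N, and the length bound keeps them
  different from V. This is how lifts of the same element of K are compared.\<close>

lemma swap:
  assumes "insert i A \<subseteq> V" "insert i' A \<subseteq> V" "i \<notin> A" "i' \<notin> A" "zs m f g (insert i A)"
    and "cls m f g i i'" "card A + 1 < 3 * m - 1"
  shows "[h i = h i'] (mod N)"
proof -
  have finA: "finite A" using assms(1) finV by blast
  have z: "zs m f g (insert i' A)"
  proof -
    have *: "int m dvd sum x (insert i' A)"
      if "int m dvd sum x (insert i A)" "[x i = x i'] (mod int m)" for x
    proof -
      have "[sum x (insert i A) = sum x (insert i' A)] (mod int m)"
        using assms(3,4) finA that(2) by (simp add: cong_add)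
      then show ?thesis using that(1) by (simp add: cong_dvd_iff)
    qed
    show ?thesis using assms(5,6) * unfolding zs_def cls_def by blast
  qed
  have "card (insert i A) < 3 * m - 1" "card (insert i' A) < 3 * m - 1"
    using assms(3,4,7) finA by simp_all
  then have "[sum h (insert i A) = k0] (mod N)" "[sum h (insert i' A) = k0] (mod N)"
    using assms(1,2,5) z by (auto intro!: uni')
  then have "[h i + sum h A = h i' + sum h A] (mod N)"
    using assms(3,4) finA by (metis cong_sym cong_trans sum.insert)
  then show ?thesis by (simp only: cong_add_rcancel)
qed

end

lemma two_block_coords:
  assumes "two_block m N k0 V f g h" "coords m f g f' g'"
  shows "two_block m N k0 V f' g' h"
  using assms(1) unfolding two_block_def coords_zs[OF assms(2)] .

locale base = two_block +
  fixes V0 E :: "nat set"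
  assumes V0: "V0 \<subseteq> V" and card_V0: "card V0 = 2 * m - 1" and zV0: "zs m f g V0"
    and ad: "adapted m f g V0 E"
begin

definition F where "F = V0 - E"
definition P where "P = {v \<in> V. f v = 1 \<and> g v = 0}"
definition bad where "bad b \<longleftrightarrow> b \<in> V - V0 \<and> g b \<noteq> 1 \<and> \<not> (f b = 1 \<and> g b = 0)"

lemma ranges: "0 \<le> f i" "f i < int m" "0 \<le> g i" "g i < int m"
  using ad by (auto simp: adapted_def)

lemma E: "E \<subseteq> V0" "card E = m - 1" "\<And>i. i \<in> E \<Longrightarrow> f i = 1" "\<And>i. i \<in> E \<Longrightarrow> g i = 0"
  using ad by (auto simp: adapted_def)

lemma gF: "i \<in> F \<Longrightarrow> g i = 1"
  using ad by (auto simp: adapted_def F_def)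

lemma fF: "[sum f F = 1] (mod int m)"
  using ad by (auto simp: adapted_def F_def)

lemma sub: "E \<subseteq> V" "F \<subseteq> V" "F \<subseteq> V0" "E \<subseteq> P" "P \<subseteq> V" "E \<inter> F = {}" "P \<inter> F = {}" "V0 = E \<union> F"
  using E V0 gF by (auto simp: F_def P_def)

lemma fins: "finite V0" "finite E" "finite F" "finite P" "finite (V - V0)"
  using sub V0 fin finV by blast+

lemma card_F: "card F = m"
  using card_V0 E(1,2) fins m3 by (simp add: F_def card_Diff_subset)

lemma card_B: "card (V - V0) = m"
  using card_V0 card_V V0 fins m3 by (simp add: card_Diff_subset)

lemma zB: "zs m f g (V - V0)"
  by (rule zs_Diff[OF fin V0 zV zV0])

lemma sum_P: "J \<subseteq> P \<Longrightarrow> sum f J = int (card J)" "J \<subseteq> P \<Longrightarrow> sum g J = 0"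
proof -
  assume "J \<subseteq> P"
  then have "sum f J = (\<Sum>i\<in>J. 1)" "sum g J = (\<Sum>i\<in>J. 0)"
    by (intro sum.cong; auto simp: P_def)+
  then show "sum f J = int (card J)" "sum g J = 0" by simp_all
qed

lemma sum_g_F: "L \<subseteq> F \<Longrightarrow> sum g L = int (card L)"
proof -
  assume "L \<subseteq> F"
  then have "sum g L = (\<Sum>i\<in>L. 1)" by (intro sum.cong) (auto simp: gF)
  then show ?thesis by simp
qed

text \<open>The number of copies of e, from 0 to m - 1, that cancels the first coordinate of X; E is
  just large enough to supply it.\<close>

definition jj where "jj X = nat ((- sum f X) mod int m)"

lemma int_jj: "int (jj X) = (- sum f X) mod int m"
  using m3 by (simp add: jj_def)

lemma jj_le: "jj X \<le> m - 1"
proof -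
  have "(- sum f X) mod int m < int m" using m3 by simp
  then show ?thesis using int_jj[of X] by linarith
qed

lemma dvd_jj: "int m dvd sum f X + int (jj X)"
  unfolding int_jj by (metis add.right_inverse dvd_0_right mod_0_imp_dvd mod_add_right_eq mod_0)

lemma jj_eq:
  assumes "[sum f X + int j = 0] (mod int m)" "j < m"
  shows "jj X = j"
proof -
  have "[int j = - sum f X] (mod int m)" using assms(1) by (simp add: cong_iff_dvd_diff add.commute)
  then have "int j mod int m = (- sum f X) mod int m" by (simp add: cong_def)
  then have "int j = int (jj X)" using assms(2) int_jj by simp
  then show ?thesis by simp
qed

lemma zs_complete:
  assumes "X \<subseteq> V" "J \<subseteq> P" "X \<inter> J = {}" "card J = jj X" "int m dvd sum g X"
  shows "zs m f g (X \<union> J)"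
proof -
  have fins': "finite X" "finite J" using assms(1,2) finV sub(5) by auto
  then show ?thesis
    using assms dvd_jj[of X] sum_P[OF assms(2)] by (simp add: zs_def sum.union_disjoint)
qed

lemma length_complete:
  assumes "X \<subseteq> V - E" "X \<noteq> {}" "int m dvd sum g X"
  shows "m \<le> card X + jj X"
proof -
  obtain J where J: "J \<subseteq> E" "card J = jj X"
    using obtain_subset_with_card_n[of "jj X" E] jj_le E(2) by metis
  have fins': "finite X" "finite J" using assms(1) J(1) finV sub(1) by blast+
  have "zs m f g (X \<union> J)" using assms J sub by (intro zs_complete) blast+
  then have "m \<le> card (X \<union> J)" using assms J sub by (intro short) blast+
  also have "\<dots> \<le> card X + card J" by (rule card_Un_le)
  finally show ?thesis using J(2) by simp
qed

text \<open>A term in \<langle>e\<rangle> is completed by copies of e alone; length at least m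
  forces m - 1 of them, so the term lies over e itself. Hence a bad term has g-coordinate neither 0
  nor 1.\<close>

lemma bad_g: assumes "bad b" shows "2 \<le> g b" "g b \<le> int m - 1" "b \<in> V - V0" "b \<notin> P" "b \<notin> F" "b \<notin> E"
proof -
  show b: "b \<in> V - V0" "b \<notin> P" "b \<notin> F" "b \<notin> E" using assms sub by (auto simp: bad_def P_def)
  show "g b \<le> int m - 1" using ranges by simp
  have "g b \<noteq> 0"
  proof
    assume g0: "g b = 0"
    have "m \<le> card {b} + jj {b}" using b g0 sub by (intro length_complete) auto
    then have "jj {b} = m - 1" using jj_le[of "{b}"] by simp
    then have "(- f b) mod int m = int m - 1" using int_jj[of "{b}"] m3 by (simp add: of_nat_diff)
    then have "[- f b = - 1] (mod int m)" using m3 by (simp add: cong_def zmod_minus1)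
    then have "[f b = 1] (mod int m)" using cong_minus_minus_iff by blast
    then have "f b = 1" using ranges[of b] m3 by (simp add: cong_def)
    then show False using g0 assms by (simp add: bad_def)
  qed
  moreover have "g b \<noteq> 1" using assms by (simp add: bad_def)
  ultimately show "2 \<le> g b" using ranges(3)[of b] by linarith
qed

definition y where "y b = nat (g b)"

lemma y: assumes "bad b" shows "int (y b) = g b" "2 \<le> y b" "y b \<le> m - 1"
  using bad_g[OF assms] by (auto simp: y_def)

lemma bad_sum_g:
  assumes "bad b" "L \<subseteq> F" "card L = m - y b"
  shows "int m dvd sum g (insert b L)" "insert b L \<subseteq> V" "insert b L \<inter> P = {}"
    "card (insert b L) = Suc (m - y b)" "sum f (insert b L) = f b + sum f L"
proof -
  have "b \<notin> L" "finite L" using assms(2) bad_g[OF assms(1)] fins finite_subset by blast+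
  then show "int m dvd sum g (insert b L)" "card (insert b L) = Suc (m - y b)"
    "sum f (insert b L) = f b + sum f L"
    using assms(3) sum_g_F[OF assms(2)] y[OF assms(1)] by (simp_all add: of_nat_diff)
  show "insert b L \<subseteq> V" "insert b L \<inter> P = {}" using assms sub bad_g[OF assms(1)] by blast+
qed

text \<open>b and its m - y b partners in F are m - y b + 1 terms, so at least y b - 1 copies of e
  must follow; in particular at least one.\<close>

lemma bad_jj:
  assumes "bad b" "L \<subseteq> F" "card L = m - y b"
  shows "y b - 1 \<le> jj (insert b L)"
proof -
  have "m \<le> card (insert b L) + jj (insert b L)"
    using bad_sum_g[OF assms] sub by (intro length_complete) blast+
  then show ?thesis using bad_sum_g(4)[OF assms] y[OF assms(1)] by linarith
qed

lemma not_all_eq: obtains i i' where "i \<in> F" "i' \<in> F" "f i \<noteq> f i'"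
proof (rule ccontr)
  assume n: "\<not> thesis"
  obtain i0 where i0: "i0 \<in> F" using card_F m3 by fastforce
  have "f i = f i0" if "i \<in> F" for i using n that i0 \<open>\<And>i i'. \<lbrakk>i \<in> F; i' \<in> F; f i \<noteq> f i'\<rbrakk> \<Longrightarrow> thesis\<close> by blast
  then have "sum f F = int m * f i0" using card_F by simp
  then show False using fF m3 by (simp add: cong_def)
qed

lemma two_set_subset:
  assumes "finite A" "i \<in> A" "i' \<in> A" "i \<noteq> i'" "0 < c" "c < card A"
  obtains L where "L \<subseteq> A - {i, i'}" "card L = c - 1"
proof -
  have "card (A - {i, i'}) = card A - 2" using assms by (simp add: card_Diff_subset)
  then have "c - 1 \<le> card (A - {i, i'})" using assms by simp
  then show ?thesis using obtain_subset_with_card_n that by blast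
qed

text \<open>The exchange needs a zero-sum using some but not all available copies of e.
  \<open>bad_jj\<close> guarantees one copy; since f is not constant on F, one of two choices of L
  differing in a single term avoids the count m - 1.\<close>

lemma kP:
  assumes "bad b" "i \<in> P" "i' \<in> P"
  shows "[h i = h i'] (mod N)"
proof (cases "i = i'")
  case False
  note yb = y[OF assms(1)]
  obtain a a' where a: "a \<in> F" "a' \<in> F" "f a \<noteq> f a'" by (rule not_all_eq)
  have c: "0 < m - y b" "m - y b < card F" using yb m3 card_F by linarith+
  have aa': "a \<noteq> a'" using a(3) by blast
  obtain L0 where L0: "L0 \<subseteq> F - {a, a'}" "card L0 = (m - y b) - 1"
    by (rule two_set_subset[OF fins(3) a(1,2) aa' c])
  have finL0: "finite L0" using L0(1) fins finite_subset by blast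
  have LF: "insert x L0 \<subseteq> F" "card (insert x L0) = m - y b" if "x \<in> {a, a'}" for x
    using L0 a that finL0 yb m3 by (auto simp: card_insert_if)
  have "a \<notin> L0" "a' \<notin> L0" using L0(1) by blast+
  then have sums: "sum f (insert a L0) = f a + sum f L0" "sum f (insert a' L0) = f a' + sum f L0"
    using finL0 by simp_all
  obtain L where L: "L \<subseteq> F" "card L = m - y b" "jj (insert b L) \<le> m - 2"
  proof -
    have "jj (insert b (insert a L0)) \<noteq> m - 1 \<or> jj (insert b (insert a' L0)) \<noteq> m - 1"
    proof (rule ccontr)
      assume "\<not> ?thesis"
      then have "(- sum f (insert b (insert a L0))) mod int m = (- sum f (insert b (insert a' L0))) mod int m"
        using int_jj by metis
      then have "(- (f b + (f a + sum f L0))) mod int m = (- (f b + (f a' + sum f L0))) mod int m"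
        using bad_sum_g(5)[OF assms(1) LF, of a] bad_sum_g(5)[OF assms(1) LF, of a'] sums
        by simp
      then have "[- (f b + (f a + sum f L0)) = - (f b + (f a' + sum f L0))] (mod int m)"
        by (simp only: cong_def)
      then have "[f b + (f a + sum f L0) = f b + (f a' + sum f L0)] (mod int m)"
        by (simp only: cong_minus_minus_iff)
      then have "[f a = f a'] (mod int m)" by (simp only: cong_add_lcancel cong_add_rcancel)
      then show False using a(3) ranges by (simp add: cong_def)
    qed
    then show ?thesis
      using that[OF LF, of a] that[OF LF, of a'] jj_le[of "insert b (insert a L0)"]
        jj_le[of "insert b (insert a' L0)"] by fastforce
  qed
  define X where "X = insert b L"
  note X = bad_sum_g[OF assms(1) L(1,2), folded X_def]
  have jX: "1 \<le> jj X" "jj X \<le> m - 2"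
    using bad_jj[OF assms(1) L(1,2)] L(3) yb by (auto simp: X_def)
  have "m - 1 \<le> card P" using E(2) sub(4) fins card_mono by metis
  then have "jj X < card P" using jX m3 by linarith
  then obtain J0 where J0: "J0 \<subseteq> P - {i, i'}" "card J0 = jj X - 1"
    using two_set_subset[OF fins(4) assms(2,3) False _ \<open>jj X < card P\<close>] jX(1) by auto
  have finJ0: "finite J0" using J0(1) fins finite_subset by blast
  have "zs m f g (X \<union> insert i J0)"
    using X J0 assms(2) jX finJ0 by (intro zs_complete) (auto simp: card_insert_if)
  moreover have "card (X \<union> J0) + 1 < 3 * m - 1"
  proof -
    have "card (X \<union> J0) \<le> card X + card J0" by (rule card_Un_le)
    then show ?thesis using X(4) J0(2) jX yb m3 by linarith
  qed
  ultimately show ?thesis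
    using X J0 assms(2,3) sub(5) by (intro swap[of i "X \<union> J0"]) (auto simp: cls_def P_def)
qed simp

text \<open>If \<open>m * h e\<close> vanished, replacing \<open>h i\<close> by \<open>h i - f i * h e\<close> would leave a condition on the
  coordinate \<open>g\<close> alone; but the \<open>g\<close>-values of the other block add up to at least \<open>2m\<close>, so some of
  them can be completed to \<open>2m\<close> by terms of \<open>F\<close>, which gives \<open>2 k0 = k0\<close>.\<close>

lemma not_dvd:
  assumes b: "bad b" and e: "e \<in> E"
  shows "\<not> N dvd int m * h e"
proof
  assume N0: "N dvd int m * h e"
  define k1 where "k1 = h e"
  define h' where "h' i = h i - f i * k1" for i
  have eP: "e \<in> P" using e sub by blast
  have H: "[sum h' X = k0] (mod N)" if X: "X \<subseteq> V - E" "X \<noteq> {}" "X \<noteq> V - E" "int m dvd sum g X" for X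
  proof -
    obtain J where J: "J \<subseteq> E" "card J = jj X"
      using obtain_subset_with_card_n[of "jj X" E] jj_le E(2) by metis
    have fins': "finite X" "finite J" using X(1) J(1) finV sub(1) by blast+
    have dis: "X \<inter> J = {}" using X(1) J(1) by blast
    have "zs m f g (X \<union> J)" using X J sub dis by (intro zs_complete) blast+
    moreover have "X \<union> J \<noteq> V" using X(1,3) J(1) sub(1) by blast
    moreover have "X \<union> J \<subseteq> V" using X(1) J(1) sub(1) by blast
    ultimately have "[sum h (X \<union> J) = k0] (mod N)" using X(2) by (intro uni) auto
    then have 1: "[sum h X + sum h J = k0] (mod N)" using fins' dis by (simp add: sum.union_disjoint)
    have "[sum h J = (\<Sum>i\<in>J. k1)] (mod N)"
      by (rule cong_sum) (use kP[OF b _ eP] J(1) sub k1_def in blast)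
    then have 2: "[sum h J = int (jj X) * k1] (mod N)" using J(2) by simp
    have "int m dvd int (jj X) + sum f X" using dvd_jj[of X] by (simp add: add.commute)
    then obtain t where "int (jj X) + sum f X = int m * t" by blast
    then have "int (jj X) * k1 + sum f X * k1 = t * (int m * k1)" by (metis distrib_right mult.assoc mult.commute)
    then have 3: "N dvd int (jj X) * k1 + sum f X * k1" using N0 by (simp add: k1_def)
    have "sum h' X = sum h X - sum f X * k1"
      by (simp add: h'_def sum_subtractf sum_distrib_right)
    then have "sum h' X - k0 = (sum h X + sum h J - k0) - (sum h J - int (jj X) * k1) - (int (jj X) * k1 + sum f X * k1)"
      by simp
    moreover have "N dvd (sum h X + sum h J - k0) - (sum h J - int (jj X) * k1) - (int (jj X) * k1 + sum f X * k1)"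
      by (rule dvd_diff[OF dvd_diff[OF 1[unfolded cong_iff_dvd_diff] 2[unfolded cong_iff_dvd_diff]] 3])
    ultimately show ?thesis unfolding cong_iff_dvd_diff by (simp only:)
  qed
  note yb = y[OF b]
  obtain i0 where i0: "i0 \<in> F" using card_F m3 by fastforce
  define k2 where "k2 = h' i0"
  have VE: "F \<subseteq> V - E" "V - V0 \<subseteq> V - E" using sub by blast+
  have c: "0 < m - y b" "m - y b < card F" using yb m3 card_F by linarith+
  have kF: "[h' i = k2] (mod N)" if iF: "i \<in> F" for i
  proof (cases "i = i0")
    case False
    obtain L0 where L0: "L0 \<subseteq> F - {i, i0}" "card L0 = (m - y b) - 1"
      by (rule two_set_subset[OF fins(3) iF i0 False c])
    have finL0: "finite L0" using L0(1) fins finite_subset by blast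
    have *: "[h' b + (h' x + sum h' L0) = k0] (mod N)" if x: "x \<in> {i, i0}" for x
    proof -
      have LF: "insert x L0 \<subseteq> F" "card (insert x L0) = m - y b"
        using L0 i0 \<open>i \<in> F\<close> x finL0 yb m3 by (auto simp: card_insert_if)
      have "[sum h' (insert b (insert x L0)) = k0] (mod N)"
      proof (rule H)
        show "insert b (insert x L0) \<subseteq> V - E" using LF(1) VE bad_g[OF b] by blast
        show "insert b (insert x L0) \<noteq> V - E"
        proof
          assume "insert b (insert x L0) = V - E"
          then have "F \<subseteq> insert b (insert x L0)" using VE(1) by simp
          then have "F \<subseteq> insert x L0" by (rule subset_insert[THEN iffD1, OF bad_g(5)[OF b]])
          then have "card F \<le> card (insert x L0)" using finL0 by (intro card_mono) auto
          then show False using LF(2) c(1) card_F yb by linarith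
        qed
      qed (use bad_sum_g[OF b LF] in auto)
      moreover have "b \<notin> insert x L0" "x \<notin> L0" using LF(1) bad_g[OF b] L0 x by auto
      ultimately show ?thesis using finL0 by simp
    qed
    have "[h' b + (h' i + sum h' L0) = h' b + (h' i0 + sum h' L0)] (mod N)"
      using *[of i] *[of i0] cong_sym cong_trans by blast
    then show ?thesis unfolding k2_def by (simp only: cong_add_lcancel cong_add_rcancel)
  qed (simp add: k2_def)
  have sumF: "[sum h' L = int (card L) * k2] (mod N)" if "L \<subseteq> F" for L
  proof -
    have "[sum h' L = (\<Sum>i\<in>L. k2)] (mod N)" by (rule cong_sum) (use kF that in blast)
    then show ?thesis by simp
  qed
  have FV: "F \<noteq> V - E" using b sub by (auto simp: bad_def)
  have mk2: "[int m * k2 = k0] (mod N)"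
  proof -
    have "[sum h' F = k0] (mod N)" using VE FV i0 sum_g_F[of F] card_F by (intro H) auto
    moreover have "[int m * k2 = sum h' F] (mod N)" using cong_sym[OF sumF[of F]] card_F by simp
    ultimately show ?thesis by (rule cong_trans[rotated])
  qed
  \<comment> \<open>v is completed to g-sum m by terms of F and compared with F itself. If g v = 0,
    then v lies over e, so h' v vanishes, whereas \<open>H\<close> gives it the value k0.\<close>
  have hB: "1 \<le> g v \<and> [h' v = g v * k2] (mod N)" if v: "v \<in> V - V0" for v
  proof -
    have vE: "v \<in> V - E" "v \<notin> F" using v sub by blast+
    have g1: "1 \<le> g v"
    proof (rule ccontr)
      assume "\<not> 1 \<le> g v"
      then have g0: "g v = 0" using ranges(3)[of v] by linarith
      then have "\<not> bad v" using bad_g(1)[of v] by auto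
      then have f1: "f v = 1" using v g0 by (auto simp: bad_def)
      have "{v} \<noteq> V - E" using i0 VE vE by auto
      then have "[sum h' {v} = k0] (mod N)" using vE g0 by (intro H) auto
      moreover have "[h v = k1] (mod N)"
        unfolding k1_def using v f1 g0 by (intro kP[OF b _ eP]) (auto simp: P_def)
      ultimately have "N dvd h v - k1 - k0" "N dvd h v - k1"
        using f1 by (simp_all add: cong_iff_dvd_diff h'_def)
      then have "N dvd (h v - k1) - (h v - k1 - k0)" by (rule dvd_diff[rotated])
      then show False using nz by simp
    qed
    have gm: "nat (g v) \<le> m" using ranges(4)[of v] by linarith
    have gm2: "m - nat (g v) \<le> card F" using card_F by simp
    obtain L where L: "L \<subseteq> F" "card L = m - nat (g v)" by (rule obtain_subset_with_card_n[OF gm2])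
    have fL: "finite L" "v \<notin> L" using finite_subset[OF L(1) fins(3)] L(1) vE(2) by auto
    have cL: "int (card L) = int m - g v" using L(2) gm g1 by (simp add: of_nat_diff)
    have "insert v L \<noteq> V - E"
    proof
      assume "insert v L = V - E"
      then have "F \<subseteq> insert v L" using VE(1) by simp
      then have "F \<subseteq> L" by (rule subset_insert[THEN iffD1, OF vE(2)])
      then have "card F \<le> card L" by (rule card_mono[OF fL(1)])
      then show False using card_F cL g1 by linarith
    qed
    then have "[sum h' (insert v L) = k0] (mod N)"
      using L vE VE sum_g_F[OF L(1)] cL fL by (intro H) auto
    then have "[h' v + sum h' L = k0] (mod N)" using fL by simp
    then have "N dvd (h' v + sum h' L - k0) - (sum h' L - (int m - g v) * k2) - (int m * k2 - k0)"
      using \<open>[h' v + sum h' L = k0] (mod N)\<close> sumF[OF L(1)] mk2 unfolding cL cong_iff_dvd_diff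
      by (blast intro: dvd_diff)
    then show ?thesis using g1 by (simp add: cong_iff_dvd_diff algebra_simps)
  qed
  have "int m < sum g (V - V0)"
  proof -
    have "(\<Sum>v\<in>V - V0. 1) < sum g (V - V0)"
      using hB bad_g(1,3)[OF b] fins by (intro sum_strict_mono_ex1) (auto intro!: bexI[of _ b])
    then show ?thesis using card_B by simp
  qed
  \<comment> \<open>This window leaves between 1 and m - 1 terms of F to be added to reach 2m, so
    part of F stays outside and \<open>H\<close> applies.\<close>
  then obtain D where D: "D \<subseteq> V - V0" "int m < sum g D" "sum g D \<le> int m + (int m - 1)"
    using subset_sum_window[of "V - V0" g "int m - 1" "int m"] fins(5) ranges(3,4) m3
    by (auto simp: zle_diff1_eq)
  have finD: "finite D" by (rule finite_subset[OF D(1) fins(5)])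
  have le: "nat (2 * int m - sum g D) \<le> card F" using card_F D(2) by simp
  obtain L where L: "L \<subseteq> F" "card L = nat (2 * int m - sum g D)"
    by (rule obtain_subset_with_card_n[OF le])
  have cL: "int (card L) = 2 * int m - sum g D" using L(2) D(3) by simp
  have fL: "finite L" "D \<inter> L = {}" using finite_subset[OF L(1) fins(3)] L(1) D(1) sub(3) by auto
  have "D \<union> L \<noteq> V - E"
  proof
    assume "D \<union> L = V - E"
    then have "F \<subseteq> D \<union> L" using VE(1) by simp
    moreover have "D \<inter> F = {}" using D(1) sub(3) by auto
    ultimately have "F \<subseteq> L" by auto
    then have "card F \<le> card L" by (rule card_mono[OF fL(1)])
    then show False using card_F cL D(2) by linarith
  qed
  moreover have "D \<noteq> {}" using D(2) m3 by auto
  moreover have "int m dvd sum g (D \<union> L)"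
    using sum_g_F[OF L(1)] cL finD fL by (simp add: sum.union_disjoint)
  ultimately have "[sum h' (D \<union> L) = k0] (mod N)" using D(1) L(1) VE by (intro H) auto
  then have 1: "N dvd sum h' D + sum h' L - k0"
    using finD fL by (simp add: sum.union_disjoint cong_iff_dvd_diff)
  have "[sum h' D = (\<Sum>v\<in>D. g v * k2)] (mod N)" by (rule cong_sum) (use hB D(1) in blast)
  then have 2: "N dvd sum h' D - sum g D * k2"
    by (simp add: sum_distrib_right cong_iff_dvd_diff)
  have 3: "N dvd sum h' L - (2 * int m - sum g D) * k2"
    using sumF[OF L(1)] cL by (simp add: cong_iff_dvd_diff)
  have 4: "N dvd int m * k2 - k0" using mk2 by (simp add: cong_iff_dvd_diff)
  have "N dvd (sum h' D + sum h' L - k0) - (sum h' D - sum g D * k2)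
      - (sum h' L - (2 * int m - sum g D) * k2) - (int m * k2 - k0) - (int m * k2 - k0)"
    by (intro dvd_diff 1 2 3 4)
  then have "N dvd k0" by (simp add: algebra_simps)
  then show False using nz by blast
qed

end

section \<open>Exchanging a term between the two blocks\<close>

lemma sum_cong_const:
  fixes h :: "'i \<Rightarrow> int"
  assumes "\<And>i. i \<in> A \<Longrightarrow> [h i = k] (mod N)"
  shows "[sum h A = int (card A) * k] (mod N)"
proof -
  have "[sum h A = (\<Sum>i\<in>A. k)] (mod N)" by (rule cong_sum) (rule assms)
  then show ?thesis by simp
qed

lemma cong_small_eq:
  fixes a b :: int
  assumes "[a = b] (mod int m)" "0 \<le> a" "a < int m" "0 \<le> b" "b < int m"
  shows "a = b"
  using assms by (simp add: cong_def)

context base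
begin

definition P2 where "P2 = {v \<in> V. f v = 0 \<and> g v = 1}"

lemma P2: "P2 \<subseteq> V" "finite P2" "E \<inter> P2 = {}" "\<And>v. v \<in> P2 \<Longrightarrow> f v = 0" "\<And>v. v \<in> P2 \<Longrightarrow> g v = 1"
  using fin E(3) by (auto simp: P2_def)

lemma zs_E_P2:
  assumes "X \<subseteq> V" "J \<subseteq> E" "S \<subseteq> P2" "X \<inter> E = {}" "X \<inter> S = {}"
    "int m dvd sum f X + int (card J)" "int m dvd sum g X + int (card S)"
  shows "zs m f g (X \<union> (J \<union> S))"
proof -
  have f3: "finite X" "finite J" "finite S"
    using finV[OF assms(1)] finite_subset[OF assms(2) fins(2)] finite_subset[OF assms(3) P2(2)] by auto
  have JP: "J \<subseteq> P" using assms(2) sub(4) by (rule subset_trans)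
  have "sum f S = (\<Sum>i\<in>S. 0)" "sum g S = (\<Sum>i\<in>S. 1)"
    by (intro sum.cong; use assms(3) P2(4,5) in auto)+
  then have S: "sum f S = 0" "sum g S = int (card S)" by simp_all
  have d1: "J \<inter> S = {}" using assms(2,3) P2(3) by auto
  have d2: "X \<inter> (J \<union> S) = {}" using assms(2,4,5) by auto
  show ?thesis unfolding zs_def
    using f3 d1 d2 assms(6,7) sum_P[OF JP] S by (simp add: sum.union_disjoint)
qed

text \<open>The analogue of \<open>kP\<close> for e': b is completed by copies of e and by m - y b
  copies of e', and 1 \<le> m - y b \<le> m - 2 leaves room for the exchange.\<close>

lemma kP2:
  assumes b: "bad b" and c2: "m - 1 \<le> card P2" and i: "i \<in> P2" "i' \<in> P2"
  shows "[h i = h i'] (mod N)"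
proof (cases "i = i'")
  case False
  note yb = y[OF b]
  obtain J where J: "J \<subseteq> E" "card J = jj {b}"
    by (rule obtain_subset_with_card_n[of "jj {b}" E, unfolded E(2), OF jj_le])
  have q: "0 < m - y b" "m - y b < card P2" using yb m3 c2 by linarith+
  obtain S where S: "S \<subseteq> P2 - {i, i'}" "card S = m - y b - 1"
    by (rule two_set_subset[OF P2(2) i False q])
  have finS: "finite S" "i \<notin> S" "i' \<notin> S" using S(1) P2(2) finite_subset by auto
  have cS: "card (insert i S) = m - y b" using finS S(2) q(1) by simp
  have bP2: "b \<notin> P2" using bad_g(1)[OF b] by (auto simp: P2_def)
  have bV: "b \<in> V" "b \<notin> E" using bad_g[OF b] by auto
  have "zs m f g ({b} \<union> (J \<union> insert i S))"
  proof (rule zs_E_P2)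
    show "int m dvd sum f {b} + int (card J)" using dvd_jj[of "{b}"] J(2) by simp
    show "int m dvd sum g {b} + int (card (insert i S))"
      unfolding cS using yb m3 by (simp add: of_nat_diff)
  qed (use bP2 bV J(1) S(1) i in auto)
  then have z: "zs m f g (insert i ({b} \<union> J \<union> S))" by (simp add: Un_ac insert_commute)
  show ?thesis
  proof (rule swap[OF _ _ _ _ z])
    show "insert i ({b} \<union> J \<union> S) \<subseteq> V" "insert i' ({b} \<union> J \<union> S) \<subseteq> V"
      using i P2(1) bV sub(1) J(1) S(1) by auto
    show "i \<notin> {b} \<union> J \<union> S" "i' \<notin> {b} \<union> J \<union> S" using i bP2 J(1) P2(3) finS by auto
    show "cls m f g i i'" using i by (simp add: P2_def cls_def)
    have "card ({b} \<union> J \<union> S) \<le> card ({b} \<union> J) + card S" by (rule card_Un_le)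
    also have "\<dots> \<le> (card {b} + card J) + card S" using card_Un_le[of "{b}" J] by simp
    finally show "card ({b} \<union> J \<union> S) + 1 < 3 * m - 1"
      using S(2) J(2) jj_le[of "{b}"] yb m3 by simp
  qed
qed simp

text \<open>At most m terms of X and at most m - 1 copies each of e and e' make at most 3m - 2
  terms, one less than V, so the zero-sum is proper. \<open>S2\<close> may be smaller than
  \<open>P2\<close> so that X can contain further terms over e'.\<close>

lemma relation_E_P2:
  assumes b: "bad b" and ez: "e \<in> E" "z \<in> P2" and S2: "S2 \<subseteq> P2" "m - 1 \<le> card S2"
    and X: "X \<subseteq> V" "X \<noteq> {}" "X \<inter> E = {}" "X \<inter> S2 = {}" "card X \<le> m"
    and pq: "p \<le> m - 1" "q \<le> m - 1" "int m dvd sum f X + int p" "int m dvd sum g X + int q"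
  shows "N dvd sum h X + int p * h e + int q * h z - k0"
proof -
  obtain J where J: "J \<subseteq> E" "card J = p"
    by (rule obtain_subset_with_card_n[of p E, unfolded E(2), OF pq(1)])
  obtain S where S: "S \<subseteq> S2" "card S = q"
    by (rule obtain_subset_with_card_n[OF le_trans[OF pq(2) S2(2)]])
  have SP2: "S \<subseteq> P2" using S(1) S2(1) by (rule subset_trans)
  have f3: "finite X" "finite J" "finite S"
    using finV[OF X(1)] finite_subset[OF J(1) fins(2)] finite_subset[OF SP2 P2(2)] by auto
  have d1: "J \<inter> S = {}" using J(1) SP2 P2(3) by auto
  have d2: "X \<inter> (J \<union> S) = {}" using J(1) S(1) X(3,4) by auto
  have "zs m f g (X \<union> (J \<union> S))"
    using X(1,3) J SP2 d2 pq(3,4) S(2) by (intro zs_E_P2) auto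
  moreover have "card (X \<union> (J \<union> S)) < 3 * m - 1"
    using f3 d1 d2 J(2) S(2) X(5) pq(1,2) m3 by (simp add: card_Un_disjoint)
  ultimately have "[sum h (X \<union> (J \<union> S)) = k0] (mod N)"
    using X(1,2) J(1) SP2 sub(1) P2(1) by (intro uni') auto
  then have 1: "N dvd sum h X + (sum h J + sum h S) - k0"
    using f3 d1 d2 by (simp add: sum.union_disjoint cong_iff_dvd_diff)
  have "[sum h J = int (card J) * h e] (mod N)"
    by (intro sum_cong_const kP[OF b]) (use J(1) ez(1) sub(4) in auto)
  then have 2: "N dvd sum h J - int p * h e" using J(2) by (simp add: cong_iff_dvd_diff)
  have c2: "m - 1 \<le> card P2" using S2(2) card_mono[OF P2(2) S2(1)] by simp
  have "[sum h S = int (card S) * h z] (mod N)"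
    by (intro sum_cong_const kP2[OF b c2]) (use SP2 ez(2) in auto)
  then have 3: "N dvd sum h S - int q * h z" using S(2) by (simp add: cong_iff_dvd_diff)
  show ?thesis using dvd_diff[OF dvd_diff[OF 1 2] 3] by (simp add: algebra_simps)
qed

text \<open>For v in F not over e', the completions of b and of b, v give h v = k2 + f v * k1
  exactly: f b = 1 calls for m - 1 copies of e, so adding v merely saves f v of them. A subset of F
  with f-sum strictly between m and 2m, compared with a single v, would make m k1 vanish. So the
  nonzero f-values on F sum to at most m, hence to 1, and there is just one.\<close>

lemma second_class:
  assumes b: "bad b" "f b = 1" and c2: "m - 1 \<le> card P2"
  shows "m - 1 \<le> card {v \<in> F. f v = 0}"
proof -
  have bP2: "b \<notin> P2" "b \<notin> E" "b \<in> V" using b(2) bad_g[OF b(1)] by (auto simp: P2_def)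
  note yb = y[OF b(1)]
  obtain e where e: "e \<in> E" using E(2) m3 by fastforce
  have "0 < card P2" using c2 m3 by linarith
  then obtain z where z: "z \<in> P2" by (auto simp: card_gt_0_iff)
  define k1 where "k1 = h e"
  define k2 where "k2 = h z"
  note bld = relation_E_P2[OF b(1) e z subset_refl c2, folded k1_def k2_def]
  define X where "X = {v \<in> F. f v \<noteq> 0}"
  define Z where "Z = {v \<in> F. f v = 0}"
  have XF: "X \<subseteq> F" "finite X" using fins(3) by (auto simp: X_def)
  have XZ: "card X + card Z = m"
  proof -
    have "F = X \<union> Z" "X \<inter> Z = {}" "finite Z" using fins(3) by (auto simp: X_def Z_def)
    then show ?thesis using card_F XF(2) card_Un_disjoint by metis
  qed
  have fX: "sum f X = sum f F"
    by (rule sum.mono_neutral_left) (use fins(3) in \<open>auto simp: X_def\<close>)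
  have X1: "1 \<le> f v" "f v \<le> int m - 1" "g v = 1" "v \<in> V" "v \<notin> E" "v \<notin> P2" "v \<noteq> b" if "v \<in> X" for v
    using that ranges[of v] gF[of v] sub(2,6) bad_g(5)[OF b(1)] by (auto simp: X_def P2_def)
  have hX: "N dvd h v - (k2 + f v * k1)" if v: "v \<in> X" for v
  proof -
    define a where "a = nat (f v)"
    have a: "int a = f v" "a \<le> m - 1" using X1(1,2)[OF v] m3 by (auto simp: a_def)
    have "N dvd sum h {b} + int (m - 1) * k1 + int (m - y b) * k2 - k0"
      by (rule bld) (use bP2 b(2) yb m3 in \<open>auto simp: of_nat_diff\<close>)
    moreover have "N dvd sum h {b, v} + int (m - 1 - a) * k1 + int (m - 1 - y b) * k2 - k0"
    proof (rule bld)
      show "int m dvd sum f {b, v} + int (m - 1 - a)"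
        using b(2) X1(7)[OF v] a m3 by (simp add: of_nat_diff)
      show "int m dvd sum g {b, v} + int (m - 1 - y b)"
        using X1(3,7)[OF v] yb m3 by (simp add: of_nat_diff)
      show "card {b, v} \<le> m" using m3 by (simp add: card_insert_if)
    qed (use bP2 X1[OF v] in auto)
    ultimately have "N dvd (sum h {b, v} + int (m - 1 - a) * k1 + int (m - 1 - y b) * k2 - k0) -
        (sum h {b} + int (m - 1) * k1 + int (m - y b) * k2 - k0)" by (rule dvd_diff[rotated])
    also have "(sum h {b, v} + int (m - 1 - a) * k1 + int (m - 1 - y b) * k2 - k0) -
        (sum h {b} + int (m - 1) * k1 + int (m - y b) * k2 - k0) = h v - (k2 + f v * k1)"
      using X1(7)[OF v] a yb m3 by (simp add: of_nat_diff algebra_simps)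
    finally show ?thesis .
  qed
  have "sum f X \<le> int m"
  proof (rule ccontr)
    assume "\<not> sum f X \<le> int m"
    then have gt: "int m < sum f X" by simp
    obtain D where D: "D \<subseteq> X" "int m < sum f D" "sum f D \<le> int m + (int m - 1)"
      by (rule subset_sum_window[of X f "int m - 1" "int m"]) (use XF(2) X1 gt in force)+
    have finD: "finite D" by (rule finite_subset[OF D(1) XF(2)])
    have cD: "card D \<le> m" using card_mono[OF fins(3), of D] D(1) XF(1) card_F by auto
    have "D \<noteq> {}" using D(2) m3 by auto
    then obtain v where v: "v \<in> D" by blast
    have cD0: "0 < card D" using v finD by (auto simp: card_gt_0_iff)
    have vX: "v \<in> X" using v D(1) by blast
    have gD: "sum g D = int (card D)" by (rule sum_g_F) (use D(1) XF(1) in auto)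
    define p where "p = nat (2 * int m - sum f D)"
    have p: "int p = 2 * int m - sum f D" "p \<le> m - 1" using D(2,3) m3 by (auto simp: p_def)
    have 1: "N dvd sum h D + int p * k1 + int (m - card D) * k2 - k0"
      by (rule bld) (use D(1) X1 p gD cD cD0 v in \<open>auto simp: of_nat_diff\<close>)
    have "N dvd (\<Sum>v\<in>D. h v - (k2 + f v * k1))" by (rule dvd_sum) (use hX D(1) in auto)
    then have 2: "N dvd sum h D - (int (card D) * k2 + sum f D * k1)"
      by (simp add: sum_subtractf sum.distrib sum_distrib_right)
    define a where "a = nat (f v)"
    have a: "int a = f v" "1 \<le> a" "a \<le> m - 1" using X1(1,2)[OF vX] m3 by (auto simp: a_def)
    have 3: "N dvd sum h {v} + int (m - a) * k1 + int (m - 1) * k2 - k0"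
      by (rule bld) (use X1[OF vX] a m3 in \<open>auto simp: of_nat_diff\<close>)
    have "N dvd ((sum h D + int p * k1 + int (m - card D) * k2 - k0)
       - (sum h D - (int (card D) * k2 + sum f D * k1)))
       - ((sum h {v} + int (m - a) * k1 + int (m - 1) * k2 - k0) - (h v - (k2 + f v * k1)))"
      by (rule dvd_diff[OF dvd_diff[OF 1 2] dvd_diff[OF 3 hX[OF vX]]])
    also have "\<dots> = int m * k1"
      unfolding p(1) using a cD m3 by (simp add: of_nat_diff algebra_simps)
    finally show False using not_dvd[OF b(1) e] by (simp add: k1_def)
  qed
  moreover have "[sum f X = 1] (mod int m)" using fF fX by simp
  moreover have "0 \<le> sum f X" by (rule sum_nonneg) (use ranges in auto)
  ultimately have "sum f X = 1"
    using m3 by (cases "sum f X = int m") (auto simp: cong_def)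
  moreover have "int (card X) \<le> sum f X"
  proof -
    have "(\<Sum>v\<in>X. 1) \<le> sum f X" by (rule sum_mono) (use X1(1) in auto)
    then show ?thesis by simp
  qed
  ultimately show ?thesis using XZ by (simp add: Z_def)
qed


lemma split_V0:
  assumes R: "R \<subseteq> V0"
  shows "R = R \<inter> E \<union> R \<inter> F" "(R \<inter> E) \<inter> (R \<inter> F) = {}" "finite (R \<inter> E)" "finite (R \<inter> F)"
    "R \<inter> E \<subseteq> E" "R \<inter> F \<subseteq> F" "card (R \<inter> E) + card (R \<inter> F) = card R" "sum g R = int (card (R \<inter> F))"
proof -
  show s: "R = R \<inter> E \<union> R \<inter> F" "(R \<inter> E) \<inter> (R \<inter> F) = {}" "finite (R \<inter> E)" "finite (R \<inter> F)"
    "R \<inter> E \<subseteq> E" "R \<inter> F \<subseteq> F"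
    using R sub(6,8) fins(2,3) by auto
  show "card (R \<inter> E) + card (R \<inter> F) = card R" using card_Un_disjoint[OF s(3,4,2)] s(1) by simp
  have "sum g (R \<inter> E) = 0" by (rule sum.neutral) (use E(4) in auto)
  then show "sum g R = int (card (R \<inter> F))"
    using sum.union_disjoint[OF s(3,4,2), of g] sum_g_F[OF s(6)] s(1) by simp
qed

text \<open>Here \<open>b\<close> lies over \<open>c (e - e')\<close> with \<open>c\<close> invertible modulo \<open>m\<close>, and \<open>m - c\<close> terms of \<open>F\<close> lie
  over \<open>e'\<close>.  If \<open>c > 1\<close> and \<open>k c = 1\<close> modulo \<open>m\<close>, there are two zero-sums containing \<open>k\<close> and
  \<open>k - 1\<close> copies of \<open>b\<close> whose comparison makes \<open>m\<close> times the lift of \<open>e\<close> vanish.\<close>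

lemma repeat_bad:
  assumes b: "bad b" and same: "\<And>v. v \<in> V - V0 \<Longrightarrow> f v = f b \<and> g v = g b"
    and E2: "E2 \<subseteq> V - V0" "card E2 = m - 1" and R: "R \<subseteq> V0" "card R = m"
    and z: "zs m f g (E2 \<union> R)"
    and Rrel: "\<And>k. k \<in> R \<Longrightarrow> \<exists>s. [f k = s * f b] (mod int m) \<and> [g k = 1 + s * g b] (mod int m)"
  shows "m - 1 \<le> card {v \<in> F. f v = 0}"
proof (rule ccontr)
  assume nZ: "\<not> ?thesis"
  note yb = y[OF b]
  define c where "c = m - y b"
  have c: "1 \<le> c" "c \<le> m - 2" "y b = m - c" "c < m"
    using yb m3 by (auto simp: c_def)
  have cg: "int c = int m - g b" using yb m3 by (auto simp: c_def of_nat_diff)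
  have cc: "0 < c" "c < card F" using c card_F by auto
  have bV: "b \<in> V - V0" using bad_g(3)[OF b] .
  have finR: "finite R" by (rule finite_subset[OF R(1) fins(1)])
  have finE2: "finite E2" by (rule finite_subset[OF E2(1) fins(5)])
  have fE2: "sum f E2 = int (m - 1) * f b" "sum g E2 = int (m - 1) * g b"
  proof -
    have "sum f E2 = (\<Sum>v\<in>E2. f b)" "sum g E2 = (\<Sum>v\<in>E2. g b)"
      by (intro sum.cong; use same E2(1) in auto)+
    then show "sum f E2 = int (m - 1) * f b" "sum g E2 = int (m - 1) * g b" using E2(2) by simp_all
  qed
  have dis: "E2 \<inter> R = {}" using E2(1) R(1) by auto
  have zf: "int m dvd int (m - 1) * f b + sum f R" and zg: "int m dvd int (m - 1) * g b + sum g R"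
    using z finR finE2 dis fE2 by (simp_all add: zs_def sum.union_disjoint)
  define U where "U = R \<inter> E"
  define Z where "Z = R \<inter> F"
  note RUZ = split_V0[OF R(1), folded U_def Z_def]
  have cUZ: "card U + card Z = m" and gR: "sum g R = int (card Z)" using RUZ(7,8) R(2) by simp_all
  have "U \<noteq> {}"
  proof
    assume "U = {}"
    then have "card Z = m" using cUZ by simp
    then have "int m dvd int (m - 1) * g b + int m" using zg gR by simp
    also have "int (m - 1) * g b + int m = int m * (g b + 1) - g b"
      using m3 by (simp add: of_nat_diff algebra_simps)
    finally have "int m dvd g b" by (simp add: dvd_diff_right_iff)
    then show False using bad_g(1,2)[OF b] by (auto dest: zdvd_imp_le)
  qed
  then obtain e where e: "e \<in> R" "e \<in> E" by (auto simp: U_def)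
  then obtain t where t: "[1 = t * f b] (mod int m)" "[0 = 1 + t * g b] (mod int m)"
    using Rrel[of e] E(3,4)[of e] by auto
  have fg: "f b + g b = int m"
  proof -
    have 1: "int m dvd 1 - t * f b" using t(1) by (simp add: cong_iff_dvd_diff)
    have 2: "int m dvd 1 + t * g b"
      using t(2) by (metis cong_0_iff cong_sym)
    have "int m dvd (1 - t * f b) * (f b + g b) + f b * ((1 + t * g b) - (1 - t * f b))"
      by (rule dvd_add[OF dvd_mult2[OF 1] dvd_mult[OF dvd_diff[OF 2 1]]])
    also have "(1 - t * f b) * (f b + g b) + f b * ((1 + t * g b) - (1 - t * f b)) = f b + g b"
      by (simp add: algebra_simps)
    finally obtain q where q: "f b + g b = int m * q" by blast
    have "0 < f b + g b" "f b + g b < int m * 2" using ranges[of b] bad_g(1)[OF b] by linarith+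
    then have "0 < int m * q" "int m * q < int m * 2" using q by simp_all
    then have "0 < q" "q < 2" using m3 by (simp_all add: zero_less_mult_iff)
    then show ?thesis using q by simp
  qed
  have fb: "f b = int c" "g b = int m - int c" using fg cg by simp_all
  have Z0: "f k = 0" if k: "k \<in> Z" for k
  proof -
    obtain s where s: "[f k = s * f b] (mod int m)" "[g k = 1 + s * g b] (mod int m)"
      using Rrel[of k] k RUZ(1) by auto
    have 1: "int m dvd 1 - t * f b" using t(1) by (simp add: cong_iff_dvd_diff)
    have "g k = 1" using gF k RUZ(6) by auto
    then have "int m dvd 1 - (1 + s * g b)" using s(2) by (simp only: cong_iff_dvd_diff)
    then have 2: "int m dvd s * g b" by simp
    have 3: "int m dvd f k - s * f b" using s(1) by (simp add: cong_iff_dvd_diff)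
    have "int m dvd (f k - s * f b) + (s * int m - s * g b)"
      by (rule dvd_add[OF 3 dvd_diff[OF dvd_triv_right 2]])
    also have "(f k - s * f b) + (s * int m - s * g b) = f k"
      unfolding fg[symmetric] by (simp add: algebra_simps)
    finally have "int m dvd f k" .
    then show ?thesis using ranges(1,2)[of k] by (auto dest: zdvd_imp_le)
  qed
  have fR: "sum f R = int (card U)"
  proof -
    have "sum f Z = (\<Sum>v\<in>Z. 0)" by (rule sum.cong) (use Z0 in auto)
    moreover have "sum f U = (\<Sum>v\<in>U. 1)" by (rule sum.cong) (use E(3) RUZ(5) in auto)
    ultimately show ?thesis using RUZ(1-4) by (simp add: sum.union_disjoint)
  qed
  have cU: "card U = c"
  proof -
    have "int m dvd int (m - 1) * int c + int (card U)" using zf fR fb by simp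
    also have "int (m - 1) * int c + int (card U) = int m * int c + (int (card U) - int c)"
      using m3 by (simp add: of_nat_diff algebra_simps)
    finally have "int m dvd int (card U) - int c" by (simp add: dvd_add_right_iff)
    then have "[int (card U) = int c] (mod int m)" by (simp add: cong_iff_dvd_diff)
    moreover have "card U \<le> card E" by (rule card_mono[OF fins(2) RUZ(5)])
    then have "card U < m" using E(2) m3 by simp
    ultimately have "int (card U) = int c" using c(4) by (intro cong_small_eq) auto
    then show ?thesis by simp
  qed
  have cZ: "card Z = m - c" using cU cUZ by simp
  have ZF: "Z \<subseteq> {v \<in> F. f v = 0}" using RUZ(6) Z0 by auto
  have "card Z \<le> card {v \<in> F. f v = 0}" by (rule card_mono) (use fins(3) ZF in auto)
  \<comment> \<open>For c = 1 the set Z would already have m - 1 elements.\<close>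
  then have c2: "2 \<le> c" using nZ cZ c(1) by linarith
  define X where "X = F - Z"
  have X: "X \<subseteq> F" "finite X" "X \<inter> Z = {}" "F = X \<union> Z" using fins(3) RUZ(6) by (auto simp: X_def)
  have cX: "card X = c" unfolding X_def using RUZ(4,6) cZ card_F c(4) by (simp add: card_Diff_subset)
  have fX: "[sum f X = 1] (mod int m)"
  proof -
    have "sum f X = sum f F" by (rule sum.mono_neutral_left) (use fins(3) Z0 in \<open>auto simp: X_def\<close>)
    then show ?thesis using fF by simp
  qed
  define k1 where "k1 = h e"
  have kE: "[h i = k1] (mod N)" if "i \<in> E" for i
    unfolding k1_def using that e(2) sub(4) by (intro kP[OF b]) auto
  have nd: "\<not> N dvd int m * k1" using not_dvd[OF b e(2)] by (simp add: k1_def)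
  define kb where "kb = h b"
  obtain L1 where L1: "L1 \<subseteq> F" "card L1 = m - y b"
    using obtain_subset_with_card_n[of "m - y b" F] card_F by (metis diff_le_self)
  have swapE: "[h v = h v'] (mod N)"
    if vv: "insert v A \<inter> E = {}" "insert v' A \<inter> E = {}" "insert v A \<subseteq> V" "insert v' A \<subseteq> V" "v \<notin> A" "v' \<notin> A"
      "cls m f g v v'" "int m dvd sum g (insert v A)" "card A = c" for v v' A
  proof -
    obtain J where J: "J \<subseteq> E" "card J = jj (insert v A)"
      by (rule obtain_subset_with_card_n[of "jj (insert v A)" E, unfolded E(2), OF jj_le])
    have z: "zs m f g (insert v A \<union> J)"
    proof (rule zs_complete)
      show "J \<subseteq> P" using J(1) sub(4) by (rule subset_trans)
      show "insert v A \<inter> J = {}" using vv(1) J(1) by auto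
    qed (fact vv(3) J(2) vv(8))+
    show ?thesis
    proof (rule swap[of v "A \<union> J" v'])
      show "zs m f g (insert v (A \<union> J))" using z by simp
      have "card (A \<union> J) \<le> card A + card J" by (rule card_Un_le)
      then show "card (A \<union> J) + 1 < 3 * m - 1" using vv(9) J(2) jj_le[of "insert v A"] c(4) m3 by linarith
      show "insert v (A \<union> J) \<subseteq> V" "insert v' (A \<union> J) \<subseteq> V" using vv(3,4) J(1) sub(1) by auto
      show "v \<notin> A \<union> J" "v' \<notin> A \<union> J" using vv(1,2,5,6) J(1) by auto
    qed (fact vv(7))
  qed
  have kB: "[h v = kb] (mod N)" if v: "v \<in> V - V0" for v
  proof -
    have vb: "f v = f b" "g v = g b" using same[OF v] by auto
    have badv: "bad v" using b v vb by (simp add: bad_def)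
    have L: "card L1 = m - y v" using L1(2) vb by (simp add: y_def)
    show ?thesis unfolding kb_def
    proof (rule swapE[of v L1 b])
      show "insert v L1 \<inter> E = {}" "insert b L1 \<inter> E = {}"
        using v bV L1(1) sub by auto
      show "insert v L1 \<subseteq> V" "insert b L1 \<subseteq> V" "v \<notin> L1" "b \<notin> L1"
        using v bV L1(1) sub by auto
      show "cls m f g v b" using vb by (simp add: cls_def)
      show "int m dvd sum g (insert v L1)" by (rule bad_sum_g(1)[OF badv L1(1) L])
      show "card L1 = c" using L1(2) by (simp add: c_def)
    qed
  qed
  obtain z0 where z0: "z0 \<in> Z" using cZ c(4) by fastforce
  define k2 where "k2 = h z0"
  have kZ: "[h v = k2] (mod N)" if v: "v \<in> Z" for v
  proof (cases "v = z0")
    case False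
    have vF: "v \<in> F" "z0 \<in> F" using v z0 RUZ(6) by auto
    obtain L where L: "L \<subseteq> F - {v, z0}" "card L = c - 1"
      by (rule two_set_subset[OF fins(3) vF False cc])
    have finL: "finite L" using finite_subset[OF L(1)] fins(3) by simp
    have bnF: "b \<notin> F" using bad_g(5)[OF b] .
    have vL: "v \<notin> L" "z0 \<notin> L" "b \<notin> L" "b \<noteq> v" "b \<noteq> z0" using L(1) vF bnF by auto
    have LF: "insert v L \<subseteq> F" "card (insert v L) = m - y b"
      using L vF finL vL cc by (auto simp: c_def)
    show ?thesis unfolding k2_def
    proof (rule swapE[of v "insert b L" z0])
      show "insert v (insert b L) \<inter> E = {}" "insert z0 (insert b L) \<inter> E = {}"
        using L(1) vF sub(6) bad_g(6)[OF b] by auto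
      show "insert v (insert b L) \<subseteq> V" "insert z0 (insert b L) \<subseteq> V"
        using L(1) vF sub(2) bV by auto
      show "v \<notin> insert b L" "z0 \<notin> insert b L" using vL by auto
      show "cls m f g v z0" using Z0[OF v] Z0[OF z0] gF vF by (simp add: cls_def)
      show "int m dvd sum g (insert v (insert b L))"
        using bad_sum_g(1)[OF b LF] by (simp add: insert_commute)
      show "card (insert b L) = c" using finL vL L(2) cc by simp
    qed
  qed (simp add: k2_def)
  have bld: "N dvd int k * kb + sum h L + int j * k1 - k0"
    if asm: "k \<le> m" "j \<le> m - 1" "L \<subseteq> F" "0 < k + card L + j" "k + card L + j < 3 * m - 1"
      "int m dvd int k * f b + sum f L + int j" "int m dvd int k * g b + int (card L)" for k j L
  proof -
    obtain K where K: "K \<subseteq> V - V0" "card K = k"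
      by (rule obtain_subset_with_card_n[of k "V - V0", unfolded card_B, OF asm(1)])
    obtain J where J: "J \<subseteq> E" "card J = j"
      by (rule obtain_subset_with_card_n[of j E, unfolded E(2), OF asm(2)])
    have f3: "finite K" "finite J" "finite L"
      using finite_subset[OF K(1) fins(5)] finite_subset[OF J(1) fins(2)] finite_subset[OF asm(3) fins(3)]
      by auto
    have d1: "L \<inter> J = {}" using asm(3) J(1) sub(6) by auto
    have d2: "K \<inter> (L \<union> J) = {}" using K(1) asm(3) J(1) sub(3) E(1) by auto
    have JP: "J \<subseteq> P" using J(1) sub(4) by (rule subset_trans)
    have "sum f K = (\<Sum>v\<in>K. f b)" "sum g K = (\<Sum>v\<in>K. g b)"
      by (intro sum.cong; use same K(1) in auto)+
    then have sK: "sum f K = int k * f b" "sum g K = int k * g b" using K(2) by simp_all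
    have "zs m f g (K \<union> (L \<union> J))"
      using f3 d1 d2 sK sum_P[OF JP] sum_g_F[OF asm(3)] J(2) asm(6,7)
      by (simp add: zs_def sum.union_disjoint add.assoc)
    moreover have cQ: "card (K \<union> (L \<union> J)) = k + (card L + j)"
      using f3 d1 d2 K(2) J(2) by (simp add: card_Un_disjoint)
    then have "K \<union> (L \<union> J) \<noteq> {}" using asm(4) by fastforce
    moreover have "K \<union> (L \<union> J) \<subseteq> V" using K(1) asm(3) J(1) sub(1,2) by auto
    ultimately have "[sum h (K \<union> (L \<union> J)) = k0] (mod N)"
      using asm(5) cQ by (intro uni') auto
    then have 1: "N dvd sum h K + (sum h L + sum h J) - k0"
      using f3 d1 d2 by (simp add: sum.union_disjoint cong_iff_dvd_diff)
    have "[sum h J = int (card J) * k1] (mod N)" by (rule sum_cong_const) (use kE J(1) in auto)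
    then have 2: "N dvd sum h J - int j * k1" using J(2) by (simp add: cong_iff_dvd_diff)
    have "[sum h K = int (card K) * kb] (mod N)" by (rule sum_cong_const) (use kB K(1) in auto)
    then have 3: "N dvd sum h K - int k * kb" using K(2) by (simp add: cong_iff_dvd_diff)
    show ?thesis using dvd_diff[OF dvd_diff[OF 1 2] 3] by (simp add: algebra_simps)
  qed
  have fZ: "sum f S = 0" if "S \<subseteq> Z" for S
    by (rule sum.neutral) (use Z0 that in auto)
  have hZ: "N dvd sum h Z - int (m - c) * k2"
    using sum_cong_const[of Z h k2 N] kZ cZ by (simp add: cong_iff_dvd_diff)
  \<comment> \<open>In K, b equals c e + (m - c) e'. One of m copies of b is exchanged for Z and c
    copies of e.\<close>
  have kbeq: "N dvd kb - (int (m - c) * k2 + int c * k1)"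
  proof -
    have 1: "N dvd int (m - 1) * kb + sum h Z + int c * k1 - k0"
    proof (rule bld)
      show "int m dvd int (m - 1) * f b + sum f Z + int c"
        unfolding fb(1) using fZ[of Z] m3 by (simp add: of_nat_diff algebra_simps)
      have "int (m - 1) * g b + int (card Z) = int m * (int m - int c)"
        unfolding fb(2) cZ using c m3 by (simp add: of_nat_diff algebra_simps)
      then show "int m dvd int (m - 1) * g b + int (card Z)" by simp
    qed (use RUZ(6) c m3 cZ in auto)
    have 2: "N dvd int m * kb + sum h {} + int 0 * k1 - k0"
      by (rule bld) (use m3 in auto)
    have "N dvd (int m * kb + sum h {} + int 0 * k1 - k0) -
      (int (m - 1) * kb + sum h Z + int c * k1 - k0) + (sum h Z - int (m - c) * k2)"
      by (rule dvd_add[OF dvd_diff[OF 2 1] hZ])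
    also have "\<dots> = kb - (int (m - c) * k2 + int c * k1)"
      using m3 by (simp add: of_nat_diff algebra_simps)
    finally show ?thesis .
  qed
  have jlow: "m - c - 1 \<le> j"
    if "L \<subseteq> F" "card L = c" "[int c + sum f L + int j = 0] (mod int m)" "j < m" for L j
  proof -
    have cL: "card L = m - y b" using that(2) by (simp add: c_def)
    have "jj (insert b L) = j"
      using that(3,4) bad_sum_g(5)[OF b that(1) cL] fb by (intro jj_eq) simp_all
    then show ?thesis using bad_jj[OF b that(1) cL] c(3) by simp
  qed
  have one: "N dvd kb + sum h L + int j * k1 - k0"
    if "L \<subseteq> F" "card L = c" "[int c + sum f L + int j = 0] (mod int m)" "j < m" for L j
  proof -
    have "N dvd int 1 * kb + sum h L + int j * k1 - k0"
    proof (rule bld)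
      show "int m dvd int 1 * f b + sum f L + int j" unfolding fb(1) using that(3) by (simp add: cong_0_iff)
      show "int m dvd int 1 * g b + int (card L)" unfolding fb(2) using that(2) by simp
    qed (use that(1,2,4) c m3 in auto)
    then show ?thesis by simp
  qed
  have hX0: "N dvd kb + sum h X + int (m - 1 - c) * k1 - k0"
  proof (rule one[OF X(1) cX])
    have "[int c + sum f X + int (m - 1 - c) = int c + 1 + int (m - 1 - c)] (mod int m)"
      by (intro cong_add fX) auto
    also have "int c + 1 + int (m - 1 - c) = int m" using c m3 by (simp add: of_nat_diff)
    finally show "[int c + sum f X + int (m - 1 - c) = 0] (mod int m)" by (simp add: cong_def)
  qed (use m3 in simp)
  \<comment> \<open>b and X need m - 1 - c copies of e. Exchanging i for z0 raises this number by f
    i; for f i > c it would wrap around modulo m and fall below the bound in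
    \<open>jlow\<close>.\<close>
  have Xi: "f i \<le> int c" "N dvd h i - (k2 + f i * k1)" if i: "i \<in> X" for i
  proof -
    define L where "L = insert z0 (X - {i})"
    have zX: "z0 \<notin> X" using z0 X(3) by auto
    have LF: "L \<subseteq> F" using X(1) z0 RUZ(6) by (auto simp: L_def)
    have cL: "card L = c" using X(2) i zX cX c(1) by (simp add: L_def)
    have fL: "sum f L = sum f X - f i"
      using X(2) i zX Z0[OF z0] by (simp add: L_def sum_diff1)
    have hL: "sum h L = k2 + sum h X - h i"
      using X(2) i zX by (simp add: L_def sum_diff1 k2_def)
    show fi: "f i \<le> int c"
    proof (rule ccontr)
      assume "\<not> f i \<le> int c"
      define j where "j = nat (f i - int c - 1)"
      have j: "int j = f i - int c - 1" "j < m" using \<open>\<not> f i \<le> int c\<close> ranges(2)[of i] by (auto simp: j_def)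
      have "[int c + sum f L + int j = sum f X - 1] (mod int m)" unfolding fL j(1) by simp
      also have "[sum f X - 1 = 1 - 1] (mod int m)" by (intro cong_diff fX) auto
      finally have "m - c - 1 \<le> j" using LF cL j(2) by (intro jlow) auto
      then have "int (m - c - 1) \<le> f i - int c - 1" using j(1) by linarith
      then show False using ranges(2)[of i] c m3 by (simp add: of_nat_diff)
    qed
    define j where "j = nat (int m + f i - int c - 1)"
    have j: "int j = int m + f i - int c - 1" "j < m"
      using fi ranges(1)[of i] c m3 by (auto simp: j_def)
    have eq: "int c + sum f L + int j = sum f X - 1 + int m" unfolding fL j(1) by simp
    have "[sum f X - 1 + int m = 1 - 1 + 0] (mod int m)"
      by (intro cong_add cong_diff fX) (auto simp: cong_def)
    then have "[int c + sum f L + int j = 0] (mod int m)" unfolding eq by (simp only: diff_self add_0_left)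
    then have 1: "N dvd kb + sum h L + int j * k1 - k0" using LF cL j(2) by (intro one) auto
    have "N dvd (kb + sum h X + int (m - 1 - c) * k1 - k0) - (kb + sum h L + int j * k1 - k0)"
      by (rule dvd_diff[OF hX0 1])
    also have "\<dots> = h i - (k2 + f i * k1)"
      unfolding hL j(1) using c m3 by (simp add: of_nat_diff algebra_simps)
    finally show "N dvd h i - (k2 + f i * k1)" .
  qed
  \<comment> \<open>If f were c on all of X, exchanging two terms of X for two of Z would wrap the
    number of copies of e around once, to c - 1, and make m k1 vanish.\<close>
  obtain i where i: "i \<in> X" "f i \<le> int c - 1"
  proof (rule ccontr)
    assume no: "\<not> thesis"
    have all: "f i = int c" if "i \<in> X" for i
      using Xi(1)[OF that] \<open>\<And>i. i \<in> X \<Longrightarrow> f i \<le> int c - 1 \<Longrightarrow> thesis\<close> no that by force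
    obtain X2 where X2: "X2 \<subseteq> X" "card X2 = 2" using obtain_subset_with_card_n[of 2 X] cX c2 by auto
    have "2 \<le> card Z" using cZ c(2) m3 by linarith
    then obtain Z2 where Z2: "Z2 \<subseteq> Z" "card Z2 = 2" by (rule obtain_subset_with_card_n)
    have f2: "finite X2" "finite Z2" "finite (X - X2)"
      using finite_subset[OF X2(1) X(2)] finite_subset[OF Z2(1) RUZ(4)] X(2) by auto
    define L where "L = (X - X2) \<union> Z2"
    have d: "(X - X2) \<inter> Z2 = {}" using X(3) Z2(1) by auto
    have LF: "L \<subseteq> F" using X(1) Z2(1) RUZ(6) by (auto simp: L_def)
    have cL: "card L = c"
      using f2 d X2 Z2(2) cX c2 X(2) by (simp add: L_def card_Un_disjoint card_Diff_subset)
    have "sum f X2 = (\<Sum>i\<in>X2. int c)" by (rule sum.cong) (use all X2(1) in auto)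
    then have "sum f X2 = 2 * int c" using X2(2) by simp
    then have fL: "sum f L = sum f X - 2 * int c"
      using f2 d fZ[OF Z2(1)] X2(1) X(2) by (simp add: L_def sum.union_disjoint sum_diff)
    have "[int c + sum f L + int (c - 1) = sum f X - 1] (mod int m)"
      unfolding fL using c by (simp add: of_nat_diff)
    also have "[sum f X - 1 = 1 - 1] (mod int m)" by (intro cong_diff fX) auto
    finally have 1: "N dvd kb + sum h L + int (c - 1) * k1 - k0"
      using LF cL c(4) by (intro one) auto
    have hL: "sum h L = sum h X - sum h X2 + sum h Z2"
      using f2 d X2(1) X(2) by (simp add: L_def sum.union_disjoint sum_diff)
    have "[sum h Z2 = int (card Z2) * k2] (mod N)" by (rule sum_cong_const) (use kZ Z2(1) in auto)
    then have 2: "N dvd sum h Z2 - 2 * k2" using Z2(2) by (simp add: cong_iff_dvd_diff)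
    have "[sum h X2 = int (card X2) * (k2 + int c * k1)] (mod N)"
      by (rule sum_cong_const) (use Xi(2) all X2(1) in \<open>auto simp: cong_iff_dvd_diff\<close>)
    then have 3: "N dvd sum h X2 - 2 * (k2 + int c * k1)" using X2(2) by (simp add: cong_iff_dvd_diff)
    have "N dvd (kb + sum h X + int (m - 1 - c) * k1 - k0) - (kb + sum h L + int (c - 1) * k1 - k0)
      - ((sum h X2 - 2 * (k2 + int c * k1)) - (sum h Z2 - 2 * k2))"
      by (rule dvd_diff[OF dvd_diff[OF hX0 1] dvd_diff[OF 3 2]])
    also have "\<dots> = int m * k1"
      unfolding hL using c m3 by (simp add: of_nat_diff algebra_simps)
    finally show False using nd by blast
  qed
  have iF: "i \<in> F" "i \<notin> Z" using i(1) X by auto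
  define k where "k = nat (t mod int m)"
  have k: "[int k * int c = 1] (mod int m)" "k < m"
  proof -
    have ik: "int k = t mod int m" using m3 by (simp add: k_def)
    have "[int k = t] (mod int m)" unfolding ik by simp
    then have "[int k * int c = t * int c] (mod int m)" by (rule cong_scalar_right)
    also have "[t * int c = 1] (mod int m)" using t(1) fb by (simp add: cong_sym)
    finally show "[int k * int c = 1] (mod int m)" .
    have "int k < int m" unfolding ik using m3 by simp
    then show "k < m" by simp
  qed
  have k1': "1 \<le> k"
  proof (rule ccontr)
    assume "\<not> 1 \<le> k"
    then have "k = 0" by simp
    then have "[0 = 1] (mod int m)" using k(1) by simp
    then show False using m3 by (simp add: cong_def)
  qed
  have kc: "int m dvd int k * int c - 1" using k(1) by (simp add: cong_iff_dvd_diff)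
  \<comment> \<open>k copies of b amount to e - e' in K, so z0 and m - 1 copies of e cancel
    them.\<close>
  have Q1: "N dvd int k * kb + sum h {z0} + int (m - 1) * k1 - k0"
  proof (rule bld)
    have "int k * f b + sum f {z0} + int (m - 1) = (int k * int c - 1) + int m"
      using fb Z0[OF z0] m3 by (simp add: of_nat_diff)
    then show "int m dvd int k * f b + sum f {z0} + int (m - 1)" by (simp only: dvd_add[OF kc dvd_refl])
    have "int k * g b + int (card {z0}) = int m * int k - (int k * int c - 1)"
      unfolding fb(2) by (simp add: algebra_simps)
    then show "int m dvd int k * g b + int (card {z0})" by (simp only: dvd_diff[OF dvd_triv_left kc])
  qed (use k(2) z0 RUZ(6) m3 in auto)
  \<comment> \<open>One b fewer is compensated by Z, i and this many copies of e; f i \<le> c - 1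
    makes the number non-negative.\<close>
  define j where "j = nat (int c - 1 - f i)"
  have j: "int j = int c - 1 - f i" "j < c" using i(2) ranges(1)[of i] c(1) by (auto simp: j_def)
  have cI: "card (insert i Z) = m - c + 1" using iF(2) RUZ(4) cZ by simp
  have Q2: "N dvd int (k - 1) * kb + sum h (insert i Z) + int j * k1 - k0"
  proof (rule bld)
    have "int (k - 1) * f b + sum f (insert i Z) + int j = int k * int c - 1"
      unfolding fb(1) j(1) using fZ[of Z] iF(2) RUZ(4) k1' by (simp add: of_nat_diff algebra_simps)
    then show "int m dvd int (k - 1) * f b + sum f (insert i Z) + int j" by (simp only: kc)
    have "int (k - 1) * g b + int (card (insert i Z)) = int m * int k - (int k * int c - 1)"
      unfolding cI fb(2) using k1' c(4) by (simp add: of_nat_diff algebra_simps)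
    then show "int m dvd int (k - 1) * g b + int (card (insert i Z))" by (simp only: dvd_diff[OF dvd_triv_left kc])
    show "k - 1 + card (insert i Z) + j < 3 * m - 1" unfolding cI using k(2) j(2) c m3 by linarith
    show "0 < k - 1 + card (insert i Z) + j" unfolding cI by simp
  qed (use k(2) j c iF(1) RUZ(6) in auto)
  have hI: "sum h (insert i Z) = h i + sum h Z" using iF(2) RUZ(4) by simp
  have "N dvd ((int k * kb + sum h {z0} + int (m - 1) * k1 - k0)
      - (int (k - 1) * kb + sum h (insert i Z) + int j * k1 - k0))
      + ((h i - (k2 + f i * k1)) + (sum h Z - int (m - c) * k2) - (kb - (int (m - c) * k2 + int c * k1)))"
    by (rule dvd_add[OF dvd_diff[OF Q1 Q2] dvd_diff[OF dvd_add[OF Xi(2)[OF i(1)] hZ] kbeq]])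
  also have "\<dots> = int m * k1"
    unfolding hI j(1) using k1' m3 by (simp add: of_nat_diff algebra_simps k2_def)
  finally show False using nd by blast
qed


text \<open>R is not F, because f is not constant on F. Once R meets E, the second coordinate leaves
  room for exactly one term in F, and the other m - 1 terms are all of E.\<close>

lemma repeat_good:
  assumes b: "b \<in> V" "f b = 0" "g b = 1"
    and E2: "card E2 = m - 1" "finite E2" "\<And>v. v \<in> E2 \<Longrightarrow> f v = f b \<and> g v = g b"
    and R: "R \<subseteq> V0" "card R = m" "E2 \<inter> R = {}"
    and z: "zs m f g (E2 \<union> R)"
    and Rrel: "\<And>k l. k \<in> R \<Longrightarrow> l \<in> R \<Longrightarrow> f k = f l"
  shows "E \<subseteq> R"
proof -
  have finR: "finite R" by (rule finite_subset[OF R(1) fins(1)])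
  have "R \<inter> E \<noteq> {}"
  proof
    assume "R \<inter> E = {}"
    then have "R \<subseteq> F" using R(1) sub(8) by auto
    then have RF: "R = F" using R(2) card_F fins(3) by (intro card_subset_eq) auto
    obtain r where r: "r \<in> R" using R(2) m3 by fastforce
    have "f v = f r" if "v \<in> F" for v
      by (rule Rrel) (use that r RF in simp_all)
    then have "sum f F = (\<Sum>v\<in>F. f r)" by (intro sum.cong) auto
    then have "sum f F = int m * f r" using card_F by simp
    then show False using fF m3 by (simp add: cong_def)
  qed
  then obtain r where r: "r \<in> R" "r \<in> E" by auto
  define U where "U = R \<inter> E"
  define Z where "Z = R \<inter> F"
  note RUZ = split_V0[OF R(1), folded U_def Z_def]
  have cUZ: "card U + card Z = m" and gR: "sum g R = int (card Z)" using RUZ(7,8) R(2) by simp_all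
  have "sum g E2 = (\<Sum>v\<in>E2. 1)" by (rule sum.cong) (use E2(3) b(3) in auto)
  then have gE2: "sum g E2 = int (m - 1)" using E2(1) by simp
  have "int m dvd int (m - 1) + int (card Z)"
    using z gE2 gR finR E2(2) R(3) by (simp add: zs_def sum.union_disjoint)
  also have "int (m - 1) + int (card Z) = int m + (int (card Z) - 1)" using m3 by (simp add: of_nat_diff)
  finally have "int m dvd int (card Z) - 1" by (simp add: dvd_add_right_iff)
  then have "[int (card Z) = 1] (mod int m)" by (simp add: cong_iff_dvd_diff)
  moreover have "U \<noteq> {}" using r by (auto simp: U_def)
  then have "0 < card U" using RUZ(3) by (simp add: card_gt_0_iff)
  then have "card Z < m" using cUZ by linarith
  ultimately have "int (card Z) = 1" using m3 by (intro cong_small_eq) auto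
  then have "card U = m - 1" using cUZ by linarith
  then have "U = E" using RUZ(5) E(2) fins(2) by (intro card_subset_eq) auto
  then show ?thesis by (auto simp: U_def)
qed

end

section \<open>Comparing two blocks of length 2m - 1\<close>

definition two_classes :: "nat \<Rightarrow> (nat \<Rightarrow> int) \<Rightarrow> (nat \<Rightarrow> int) \<Rightarrow> nat set \<Rightarrow> bool" where
  "two_classes m f g W \<longleftrightarrow> (\<exists>i\<in>W. \<exists>j\<in>W. \<not> cls m f g i j \<and>
     m - 1 \<le> card {k \<in> W. cls m f g k i} \<and> m - 1 \<le> card {k \<in> W. cls m f g k j})"

lemma two_classes_coords: "coords m f g f' g' \<Longrightarrow> two_classes m f' g' W \<longleftrightarrow> two_classes m f g W"
  by (simp add: two_classes_def coords_cls)

lemma two_classesI: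
  assumes "finite W" "A \<subseteq> W" "A' \<subseteq> W" "m - 1 \<le> card A" "m - 1 \<le> card A'" "i \<in> A" "j \<in> A'"
    "\<And>k. k \<in> A \<Longrightarrow> cls m f g k i" "\<And>k. k \<in> A' \<Longrightarrow> cls m f g k j" "\<not> cls m f g i j"
  shows "two_classes m f g W"
proof -
  have "card A \<le> card {k \<in> W. cls m f g k i}" "card A' \<le> card {k \<in> W. cls m f g k j}"
    using assms(1-3,8,9) by (auto intro!: card_mono)
  then show ?thesis using assms unfolding two_classes_def
    by (intro bexI[of _ i] bexI[of _ j]) auto
qed

context base
begin

lemma cls_eq: "cls m f g i j \<longleftrightarrow> f i = f j \<and> g i = g j"
  using ranges by (auto simp: cls_def cong_def)

lemma two_classes_V0:
  assumes "m - 1 \<le> card {v \<in> F. f v = 0}"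
  shows "two_classes m f g V0"
proof -
  obtain e where e: "e \<in> E" using E(2) m3 by fastforce
  have "0 < card {v \<in> F. f v = 0}" using assms m3 by linarith
  then obtain z where z: "z \<in> {v \<in> F. f v = 0}" by (auto simp: card_gt_0_iff)
  show ?thesis
    by (rule two_classesI[OF fins(1) E(1) _ _ assms e z])
      (use e z E gF sub(3) in \<open>auto simp: cls_eq\<close>)
qed

text \<open>Replacing e' by e' + a e changes the f-sum over the m terms of F by a multiple of m.
  Thus any term of F may be taken to lie over e'.\<close>

lemma shift:
  "base m N k0 V (\<lambda>i. (f i - a * g i) mod int m) g h V0 E"
  "coords m f g (\<lambda>i. (f i - a * g i) mod int m) g"
proof -
  let ?f = "\<lambda>i. (f i - a * g i) mod int m"
  show co: "coords m f g ?f g"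
  proof -
    have "coprime (1 * 1 - (- a) * 0) (int m)" by simp
    moreover have "[?f i = 1 * f i + (- a) * g i] (mod int m)" for i by simp
    moreover have "[g i = 0 * f i + 1 * g i] (mod int m)" for i by simp
    ultimately show ?thesis unfolding coords_def by blast
  qed
  interpret tb: two_block m N k0 V ?f g h
    by (rule two_block_coords[OF two_block_axioms co])
  have "adapted m ?f g V0 E"
  proof -
    have "[sum ?f F = (\<Sum>i\<in>F. f i - a)] (mod int m)"
    proof (rule cong_sum)
      fix i assume "i \<in> F"
      then show "[?f i = f i - a] (mod int m)" by (simp add: gF)
    qed
    also have "(\<Sum>i\<in>F. f i - a) = sum f F - int m * a" using card_F by (simp add: sum_subtractf)
    finally have "[sum ?f F = sum f F - int m * a] (mod int m)" .
    moreover have "[sum f F - int m * a = 1 - 0] (mod int m)"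
      by (intro cong_diff fF) (simp add: cong_0_iff)
    ultimately have "[sum ?f F = 1 - 0] (mod int m)" by (rule cong_trans)
    then have "[sum ?f (V0 - E) = 1] (mod int m)" by (simp only: F_def diff_zero)
    then show ?thesis unfolding adapted_def
      using E ranges gF m3 by (auto simp: F_def)
  qed
  then show "base m N k0 V ?f g h V0 E"
    using V0 card_V0 zV0 coords_zs[OF co, of V0]
    by (intro base.intro tb.two_block_axioms base_axioms.intro) auto
qed

end

lemma rel_zero: "rel m f g k l t e \<Longrightarrow> f e = 0 \<Longrightarrow> [f k = f l] (mod int m)"
  by (simp add: rel_def)

lemma adapted_rel:
  assumes "adapted m f g W E" "k \<in> W - E" "l \<in> W - E" "e \<in> E"
  shows "rel m f g k l (f k - f l) e"
  using assms by (auto simp: adapted_def rel_def)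

text \<open>If the class repeated in W misses V0, its m - 1 terms lie in the other block, whose last
  term is then equal to them because the block sums to zero; the rest R of W lies in V0. If b lies
  in e' + \<langle>e\<rangle>, then \<open>repeat_good\<close> gives W a second class; otherwise
  \<open>repeat_bad\<close> gives V0 one.\<close>

lemma repeat_two_classes:
  assumes base: "base m N k0 V f g h V0 E"
    and W: "W \<subseteq> V" "card W = 2 * m - 1" "zs m f g W"
    and co: "coords m f g f2 g2" and ad2: "adapted m f2 g2 W E2"
    and none: "\<And>v e. v \<in> V0 \<Longrightarrow> e \<in> E2 \<Longrightarrow> \<not> cls m f g v e"
  shows "two_classes m f g V0 \<or> two_classes m f g W"
proof -
  interpret base m N k0 V f g h V0 E by (rule base)
  have finW: "finite W" by (rule finV[OF W(1)])
  have E2: "E2 \<subseteq> W" "card E2 = m - 1" using ad2 by (auto simp: adapted_def)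
  have finE2: "finite E2" by (rule finite_subset[OF E2(1) finW])
  obtain b where b: "b \<in> E2" using E2(2) m3 by fastforce
  have clsE2: "cls m f g v b" if "v \<in> E2" for v
    using ad2 that b coords_cls[OF co, of v b] by (auto simp: adapted_def cls_def)
  have E2B: "E2 \<subseteq> V - V0"
  proof
    fix v assume v: "v \<in> E2"
    then have "v \<notin> V0" using none[of v v] by auto
    then show "v \<in> V - V0" using v E2(1) W(1) by auto
  qed
  have B: "f v = f b \<and> g v = g b" if v: "v \<in> V - V0" for v
  proof (cases "v \<in> E2")
    case True
    then show ?thesis using clsE2 by (simp add: cls_eq)
  next
    case False
    have "card (V - V0 - E2) = 1" using card_B E2(2) E2B finE2 m3 by (simp add: card_Diff_subset)
    then have "V - V0 - E2 = {v}" using v False by (metis Diff_iff card_1_singletonE singletonD)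
    then have VE: "V - V0 = insert v E2" using E2B v by auto
    have *: "x v = x b" if x: "\<And>i. i \<in> E2 \<Longrightarrow> x i = x b" "\<And>i. 0 \<le> x i \<and> x i < int m"
      "int m dvd sum x (V - V0)" for x
    proof -
      have "sum x E2 = (\<Sum>i\<in>E2. x b)" by (rule sum.cong) (use x(1) in auto)
      then have "sum x (V - V0) = x v + int (m - 1) * x b"
        unfolding VE using False finE2 E2(2) by simp
      also have "\<dots> = int m * x b + (x v - x b)" using m3 by (simp add: of_nat_diff algebra_simps)
      finally have "int m dvd x v - x b" using x(3) by (simp add: dvd_add_right_iff)
      then have "[x v = x b] (mod int m)" by (simp add: cong_iff_dvd_diff)
      then show ?thesis using x(2) by (intro cong_small_eq) auto
    qed
    show ?thesis
      using *[of f] *[of g] clsE2 ranges zB by (auto simp: cls_eq zs_def)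
  qed
  define R where "R = W - E2"
  have R: "card R = m" "E2 \<inter> R = {}" "E2 \<union> R = W"
    using W(2) E2 finE2 m3 by (auto simp: R_def card_Diff_subset)
  have Rn: "\<not> cls m f g k b" if "k \<in> R" for k
  proof -
    have "g2 k = 1" "g2 b = 0" using ad2 that b by (auto simp: R_def adapted_def)
    then have "\<not> cls m f2 g2 k b" using m3 by (simp add: cls_def cong_def)
    then show ?thesis using coords_cls[OF co] by simp
  qed
  have RV0: "R \<subseteq> V0"
  proof
    fix k assume k: "k \<in> R"
    then have "k \<in> V" using W(1) by (auto simp: R_def)
    then show "k \<in> V0" using B[of k] Rn[OF k] by (auto simp: cls_eq)
  qed
  have Rrel: "\<exists>t. rel m f g k l t b" if "k \<in> R" "l \<in> R" for k l
  proof -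
    have "k \<in> W - E2" "l \<in> W - E2" using that by (simp_all add: R_def)
    then show ?thesis using coords_rel[OF coords_sym[OF co] adapted_rel[OF ad2 _ _ b]] by blast
  qed
  have bV: "b \<in> V" "b \<in> V - V0" using b E2B by auto
  have zW: "zs m f g (E2 \<union> R)" using W(3) R(3) by simp
  show ?thesis
  proof (cases "g b = 1")
    case True
    let ?f = "\<lambda>i. (f i - f b * g i) mod int m"
    interpret s: base m N k0 V ?f g h V0 E by (rule shift(1))
    note cs = shift(2)[of "f b"]
    have "E \<subseteq> R"
    proof (rule s.repeat_good[OF bV(1) _ True E2(2) finE2 _ RV0 R(1,2)])
      show "zs m ?f g (E2 \<union> R)" using zW coords_zs[OF cs] by simp
      fix k l assume kl: "k \<in> R" "l \<in> R"
      then obtain t where "rel m f g k l t b" using Rrel by blast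
      then have "rel m ?f g k l t b" by (rule coords_rel[OF cs])
      moreover have "?f b = 0" using True by simp
      ultimately have "[?f k = ?f l] (mod int m)" by (rule rel_zero[of m ?f g k l t b])
      then show "?f k = ?f l" by (rule cong_small_eq[OF _ s.ranges(1,2) s.ranges(1,2)])
    qed (use True clsE2 in \<open>auto simp: cls_eq\<close>)
    then have EW: "E \<subseteq> W" by (auto simp: R_def)
    obtain e where e: "e \<in> E" using E(2) m3 by fastforce
    have "two_classes m f g W"
      by (rule two_classesI[OF finW EW E2(1) _ _ e b])
        (use E E2(2) e clsE2 True in \<open>auto simp: cls_eq\<close>)
    then show ?thesis by simp
  next
    case False
    obtain e where e: "e \<in> E" using E(2) m3 by fastforce
    have "\<not> cls m f g e b" using none e b E(1) by auto
    then have bad_b: "bad b" using False bV(2) E(3,4)[OF e] by (auto simp: bad_def cls_eq)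
    have "R \<inter> F \<noteq> {}"
    proof
      assume "R \<inter> F = {}"
      then have "R \<subseteq> E" using RV0 sub(8) by auto
      then have "card R \<le> card E" by (rule card_mono[OF fins(2)])
      then show False using R(1) E(2) m3 by simp
    qed
    then obtain r where r: "r \<in> R" "r \<in> F" by auto
    let ?f = "\<lambda>i. (f i - f r * g i) mod int m"
    interpret s: base m N k0 V ?f g h V0 E by (rule shift(1))
    note cs = shift(2)[of "f r"]
    have "m - 1 \<le> card {v \<in> s.F. ?f v = 0}"
    proof (rule s.repeat_bad[OF _ _ E2B E2(2) RV0 R(1)])
      show "s.bad b" using bad_b bad_g(1)[OF bad_b] by (auto simp: s.bad_def bad_def)
      show "zs m ?f g (E2 \<union> R)" using zW coords_zs[OF cs] by simp
      fix k assume "k \<in> R"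
      then obtain t where "rel m f g k r t b" using Rrel r by blast
      then have "rel m ?f g k r t b" by (rule coords_rel[OF cs])
      then show "\<exists>s. [?f k = s * ?f b] (mod int m) \<and> [g k = 1 + s * g b] (mod int m)"
        using gF[OF r(2)] by (auto simp: rel_def)
    qed (use B in auto)
    then have "two_classes m ?f g V0" by (rule s.two_classes_V0)
    then show ?thesis using two_classes_coords[OF cs] by simp
  qed
qed

text \<open>If W repeats e too, its other terms lie in b + \<langle>e\<rangle>, so they fill the
  other block and m - 1 copies of e would vanish. Otherwise \<open>repeat_two_classes\<close>, used
  in both directions, shows that the class repeated in W occurs in F, so it may be taken as e', and
  that e occurs in W. Then b and e differ by a multiple of e', and \<open>second_class\<close>
  applies.\<close>

lemma nonflat_no_bad:
  assumes base: "base m N k0 V f g h V0 E"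
    and b: "b \<in> V - V0" "g b \<noteq> 1" "\<not> (f b = 1 \<and> g b = 0)" "b \<in> W"
    and W: "W \<subseteq> V" "card W = 2 * m - 1" "zs m f g W"
    and co: "coords m f g f2 g2" and ad2: "adapted m f2 g2 W E2"
  shows "two_classes m f g V0 \<or> two_classes m f g W"
proof (rule ccontr)
  assume flat: "\<not> ?thesis"
  interpret base m N k0 V f g h V0 E by (rule base)
  have bad_b: "bad b" using b by (simp add: bad_def)
  have b2: "base m N k0 V f2 g2 h W E2"
    using two_block_coords[OF two_block_axioms co] W coords_zs[OF co, of W] ad2
    by (simp add: base_def base_axioms_def)
  interpret w: base m N k0 V f2 g2 h W E2 by (rule b2)
  have fl2: "\<not> (two_classes m f2 g2 W \<or> two_classes m f2 g2 V0)"
    using flat two_classes_coords[OF co] by simp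
  obtain e where e: "e \<in> E" using E(2) m3 by fastforce
  obtain e2 where e2: "e2 \<in> E2" using w.E(2) m3 by fastforce
  have clsE: "cls m f g v e" if "v \<in> E" for v using that e E by (auto simp: cls_eq)
  have clsE2: "cls m f g v e2" if "v \<in> E2" for v
    using that e2 w.E coords_cls[OF co, of v e2] by (auto simp: w.cls_eq)
  have be: "\<not> cls m f g b e" using b(3) E(3,4)[OF e] by (simp add: cls_eq)
  have Rrel: "\<exists>t. rel m f g k l t e2" if "k \<in> w.F" "l \<in> w.F" for k l
  proof -
    have "k \<in> W - E2" "l \<in> W - E2" using that by (simp_all add: w.F_def)
    then show ?thesis using coords_rel[OF coords_sym[OF co] adapted_rel[OF ad2 _ _ e2]] by blast
  qed
  show False
  proof (cases "cls m f g e2 e")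
    case True
    have bF: "b \<in> w.F"
    proof (rule ccontr)
      assume "b \<notin> w.F"
      then have "b \<in> E2" using b(4) w.sub(8) by auto
      then show False using cls_trans[OF clsE2 True] be by simp
    qed
    have "w.F \<subseteq> V - V0"
    proof
      fix k assume k: "k \<in> w.F"
      then obtain t where t: "rel m f g k b t e2" using Rrel bF by blast
      have "f e2 = 1" "g e2 = 0" using True E(3,4)[OF e] by (simp_all add: cls_eq)
      then have "[g k = g b] (mod int m)" using t by (simp add: rel_def)
      then have "g k = g b" using ranges by (intro cong_small_eq) auto
      then have g1: "2 \<le> g k" using bad_g(1)[OF bad_b] by simp
      have "k \<notin> V0"
      proof
        assume "k \<in> V0"
        then have "k \<in> E \<or> k \<in> F" using sub(8) by auto
        then show False using g1 E(4) gF by fastforce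
      qed
      then show "k \<in> V - V0" using k w.sub(2) by auto
    qed
    then have wF: "w.F = V - V0" using w.card_F card_B fins(5) by (intro card_subset_eq) auto
    have "sum f E2 = (\<Sum>i\<in>E2. 1)"
      by (rule sum.cong) (use clsE2 True E(3)[OF e] in \<open>auto simp: cls_eq\<close>)
    then have fE2: "sum f E2 = int (m - 1)" using w.E(2) by simp
    have "sum f W = sum f E2 + sum f w.F"
      using w.sub(6,8) w.fins by (metis sum.union_disjoint)
    then have "int m dvd int (m - 1) + sum f (V - V0)" using W(3) fE2 wF by (simp add: zs_def)
    moreover have "int m dvd sum f (V - V0)" using zB by (simp add: zs_def)
    ultimately have "int m dvd int (m - 1)" by (simp add: dvd_add_left_iff)
    then have "m dvd m - 1" by (simp only: int_dvd_int_iff)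
    then show False using m3 by (auto dest: dvd_imp_le)
  next
    case ne: False
    have "\<exists>v\<in>V0. \<exists>e'\<in>E2. cls m f g v e'"
    proof (rule ccontr)
      assume "\<not> ?thesis"
      then have "two_classes m f g V0 \<or> two_classes m f g W"
        by (intro repeat_two_classes[OF base W co ad2]) auto
      then show False using flat by blast
    qed
    then obtain v0 e' where ve: "v0 \<in> V0" "e' \<in> E2" "cls m f g v0 e'" by auto
    have v0: "v0 \<in> V0" "cls m f g v0 e2" using ve cls_trans[OF ve(3) clsE2] by simp_all
    have "\<exists>v\<in>W. \<exists>e'\<in>E. cls m f2 g2 v e'"
    proof (rule ccontr)
      assume "\<not> ?thesis"
      then have "two_classes m f2 g2 W \<or> two_classes m f2 g2 V0"
        using zV0 coords_zs[OF co, of V0]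
        by (intro repeat_two_classes[OF b2 V0 card_V0 _ coords_sym[OF co] ad]) auto
      then show False using fl2 by blast
    qed
    then obtain w0 e' where we: "w0 \<in> W" "e' \<in> E" "cls m f2 g2 w0 e'" by auto
    then have "cls m f g w0 e'" using coords_cls[OF co] by simp
    then have w0: "w0 \<in> W" "cls m f g w0 e" using we cls_trans[OF _ clsE] by simp_all
    have w0F: "w0 \<in> w.F"
    proof (rule ccontr)
      assume "w0 \<notin> w.F"
      then have "w0 \<in> E2" using w0(1) w.sub(8) by auto
      then show False using cls_trans[OF cls_sym[OF clsE2] w0(2)] ne by simp
    qed
    have v0F: "v0 \<in> F"
    proof (rule ccontr)
      assume "v0 \<notin> F"
      then have "v0 \<in> E" using v0(1) sub(8) by auto
      then show False using cls_trans[OF cls_sym[OF v0(2)] clsE] ne by simp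
    qed
    have ge2: "g e2 = 1" "f e2 = f v0" using v0(2) gF[OF v0F] by (auto simp: cls_eq)
    have bF: "b \<in> w.F"
    proof (rule ccontr)
      assume "b \<notin> w.F"
      then have "b \<in> E2" using b(4) w.sub(8) by auto
      then show False using clsE2[of b] ge2 b(2) by (simp add: cls_eq)
    qed
    obtain t where t: "rel m f g b w0 t e2" using Rrel bF w0F by blast
    let ?f = "\<lambda>i. (f i - f v0 * g i) mod int m"
    interpret s: base m N k0 V ?f g h V0 E by (rule shift(1))
    note cs = shift(2)[of "f v0"]
    have fe2: "?f v = 0 \<and> g v = 1" if "v \<in> E2" for v
      using clsE2[OF that] ge2 by (simp add: cls_eq)
    have "rel m ?f g b w0 t e2" by (rule coords_rel[OF cs t])
    then have "[?f b = ?f w0] (mod int m)"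
      using fe2[OF e2] by (intro rel_zero[of m ?f g b w0 t e2]) auto
    moreover have "?f w0 = 1"
      using w0(2) E(3,4)[OF e] m3 by (simp add: cls_eq)
    moreover have "?f b = ?f w0"
      by (rule cong_small_eq[OF \<open>[?f b = ?f w0] (mod int m)\<close> s.ranges(1,2) s.ranges(1,2)])
    ultimately have fb: "?f b = 1" by simp
    have sb: "s.bad b" using b bad_g(1)[OF bad_b] by (auto simp: s.bad_def)
    have "E2 \<subseteq> s.P2" unfolding s.P2_def using fe2 w.sub(1) by auto
    then have "card E2 \<le> card s.P2" by (rule card_mono[OF s.P2(2)])
    then have "m - 1 \<le> card s.P2" using w.E(2) by simp
    then have "m - 1 \<le> card {v \<in> s.F. ?f v = 0}" by (rule s.second_class[OF sb fb])
    then have "two_classes m ?f g V0" by (rule s.two_classes_V0)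
    then show False using two_classes_coords[OF cs] flat by simp
  qed
qed

section \<open>Blocks with two terms of multiplicity \<open>m - 1\<close>\<close>

context base
begin

definition Z where "Z = {v \<in> F. f v = 0}"

text \<open>Terms over e' do not contribute to the f-sum of F, which is 1 modulo m, so the one
  remaining term w lies over e + e'.\<close>

lemma flat_rest:
  assumes "m - 1 \<le> card Z"
  obtains w where "w \<in> F" "f w = 1" "F = insert w Z" "w \<notin> Z" "card Z = m - 1"
proof -
  have finZ: "finite Z" using fins(3) by (simp add: Z_def)
  have ZF: "Z \<subseteq> F" by (auto simp: Z_def)
  have sF: "sum f F = sum f (F - Z)"
    using fins(3) by (intro sum.mono_neutral_right) (auto simp: Z_def)
  have "F - Z \<noteq> {}"
  proof
    assume "F - Z = {}"
    then have "sum f F = 0" using sF by (simp only: sum.empty)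
    then have "[0 = 1] (mod int m)" using fF by simp
    then show False using m3 by (simp add: cong_def)
  qed
  then have "0 < card (F - Z)" using fins(3) by (simp add: card_gt_0_iff)
  moreover have "card (F - Z) = m - card Z" using ZF finZ card_F by (simp add: card_Diff_subset)
  ultimately have c1: "card (F - Z) = 1" "card Z = m - 1" using assms by linarith+
  then obtain w where w: "F - Z = {w}" by (auto simp: card_1_singleton_iff)
  have "[f w = 1] (mod int m)" using fF sF w by simp
  then have "f w = 1" using ranges(1,2)[of w] m3 by (intro cong_small_eq) auto
  moreover have "w \<in> F" "w \<notin> Z" "F = insert w Z" using w ZF by auto
  ultimately show ?thesis using that c1(2) by blast
qed

text \<open>Completing a subset \<open>D\<close> of the other block by copies of \<open>e\<close> and \<open>e'\<close> shows
  \<open>p m k1 + s m k2 = k0\<close>, where \<open>p m\<close> and \<open>s m\<close> are the coordinate sums of \<open>D\<close> rounded up to multiples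
  of \<open>m\<close>.  At the step where \<open>s\<close> passes from 1 to 2, \<open>p\<close> either stays, whence \<open>m k2 = 0\<close>, or
  increases by 1, which contradicts \<open>m k1 + m k2 = k0\<close>.\<close>

lemma flat_dvd:
  assumes flat: "m - 1 \<le> card Z" and bad: "bad b" and z: "z \<in> Z"
  shows "N dvd int m * h z"
proof -
  obtain w where w: "w \<in> F" "f w = 1" "F = insert w Z" "w \<notin> Z" "card Z = m - 1"
    by (rule flat_rest[OF flat])
  have finZ: "finite Z" using fins(3) by (simp add: Z_def)
  have ZV: "Z \<subseteq> V" using sub(2) by (auto simp: Z_def)
  have fZ: "f v = 0" "g v = 1" if "v \<in> Z" for v using that gF by (auto simp: Z_def)
  have ZP2: "Z \<subseteq> P2" using ZV fZ by (auto simp: P2_def)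
  have wE: "w \<notin> E" "w \<in> V" "w \<notin> P2" "w \<in> V0" "g w = 1" using w(1,2) sub gF by (auto simp: P2_def)
  have BE: "(V - V0) \<inter> E = {}" "(V - V0) \<inter> Z = {}" using E(1) sub(3) by (auto simp: Z_def)
  \<comment> \<open>With f v = 0, copies of e' alone would complete v, but \<open>bad_jj\<close>
    demands at least one copy of e.\<close>
  have f1: "1 \<le> f v" if v: "bad v" for v
  proof (rule ccontr)
    assume "\<not> 1 \<le> f v"
    then have f0: "f v = 0" using ranges(1)[of v] by simp
    have le: "m - y v \<le> card Z" using y(2)[OF v] w(5) by simp
    obtain S where S: "S \<subseteq> Z" "card S = m - y v" by (rule obtain_subset_with_card_n[OF le])
    have SF: "S \<subseteq> F" using S(1) by (auto simp: Z_def)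
    have "sum f S = 0" by (rule sum.neutral) (use S(1) fZ in auto)
    then have "jj (insert v S) = 0"
      using bad_sum_g(5)[OF v SF S(2)] f0 m3 by (intro jj_eq) simp_all
    then show False using bad_jj[OF v SF S(2)] y(2)[OF v] by simp
  qed
  note yb = y[OF bad]
  define x where "x = nat (f b)"
  have x: "int x = f b" "1 \<le> x" "x < m" using f1[OF bad] ranges(2)[of b] by (auto simp: x_def)
  note bg = bad_g[OF bad]
  obtain e where e: "e \<in> E" using E(2) m3 by fastforce
  define k1 where "k1 = h e"
  have kE: "[h i = k1] (mod N)" if "i \<in> P" for i
    unfolding k1_def using that e sub(4) by (intro kP[OF bad]) auto
  define k2 where "k2 = h z"
  have zP2: "z \<in> P2" using z ZP2 by blast
  have cP2: "m - 1 \<le> card P2" using flat card_mono[OF P2(2) ZP2] by simp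
  note kP2' = kP2[OF bad cP2 _ zP2, folded k2_def]
  note bld = relation_E_P2[OF bad e zP2 ZP2 flat, folded k1_def k2_def]
  have bw: "b \<noteq> w" using bg(5) w(1) by auto
  have bB: "b \<in> V - E - Z" using bg(3) BE by auto
  \<comment> \<open>Adding w to the completion of b saves one copy each of e and e'; f b \<ge> 1
    keeps the count m - f b within E.\<close>
  have hw: "N dvd h w - k1 - k2"
  proof -
    have 1: "N dvd sum h {b} + int (m - x) * k1 + int (m - y b) * k2 - k0"
      by (rule bld) (use bg(3) BE x yb m3 in \<open>auto simp: of_nat_diff\<close>)
    have 2: "N dvd sum h {b, w} + int (m - x - 1) * k1 + int (m - y b - 1) * k2 - k0"
    proof (rule bld)
      show "int m dvd sum f {b, w} + int (m - x - 1)"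
        using bw w(2) x yb m3 by (simp add: of_nat_diff)
      show "int m dvd sum g {b, w} + int (m - y b - 1)"
        using bw wE(5) x yb m3 by (simp add: of_nat_diff)
      show "card {b, w} \<le> m" using m3 by (simp add: card_insert_if)
    qed (use bB wE w(4) x yb in auto)
    have "N dvd (sum h {b, w} + int (m - x - 1) * k1 + int (m - y b - 1) * k2 - k0)
      - (sum h {b} + int (m - x) * k1 + int (m - y b) * k2 - k0)"
      by (rule dvd_diff[OF 2 1])
    also have "\<dots> = h w - k1 - k2"
      using bw x yb m3 by (simp add: of_nat_diff algebra_simps)
    finally show ?thesis .
  qed
  have M12: "N dvd int m * k1 + int m * k2 - k0"
  proof -
    have "N dvd sum h {w} + int (m - 1) * k1 + int (m - 1) * k2 - k0"
      by (rule bld) (use wE w bB bw m3 in \<open>auto simp: of_nat_diff\<close>)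
    then have "N dvd (sum h {w} + int (m - 1) * k1 + int (m - 1) * k2 - k0) - (h w - k1 - k2)"
      using hw by (rule dvd_diff)
    also have "\<dots> = int m * k1 + int m * k2 - k0" using m3 by (simp add: of_nat_diff algebra_simps)
    finally show ?thesis .
  qed
  show ?thesis
  \<comment> \<open>A term over e in the other block vanishes with m - 1 copies of e, so m k1 = k0
    and \<open>M12\<close> gives the claim. Otherwise all g-values of that block are at least 1 and
    its g-sum exceeds m.\<close>
  proof (cases "\<exists>p\<in>V - V0. p \<in> P")
    case True
    then obtain p where p: "p \<in> V - V0" "p \<in> P" by blast
    have "N dvd sum h {p} + int (m - 1) * k1 + int 0 * k2 - k0"
      by (rule bld) (use p BE m3 in \<open>auto simp: P_def of_nat_diff\<close>)
    moreover have "N dvd h p - k1" using kE[OF p(2)] by (simp add: cong_iff_dvd_diff)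
    ultimately have "N dvd (int m * k1 + int m * k2 - k0)
      - ((sum h {p} + int (m - 1) * k1 + int 0 * k2 - k0) - (h p - k1))"
      by (intro dvd_diff[OF M12 dvd_diff])
    also have "\<dots> = int m * k2" using m3 by (simp add: of_nat_diff algebra_simps)
    finally show ?thesis by (simp add: k2_def)
  next
    case noP: False
    have g1: "1 \<le> g v" if v: "v \<in> V - V0" for v
    proof (rule ccontr)
      assume "\<not> 1 \<le> g v"
      then have g0: "g v = 0" using ranges(3)[of v] by simp
      then have "\<not> bad v" using bad_g(1)[of v] by auto
      then have "v \<in> P" using v g0 by (auto simp: bad_def P_def)
      then show False using noP v by blast
    qed
    have hB: "N dvd h v - (f v * k1 + g v * k2)" if v: "v \<in> V - V0" for v
    proof (cases "f v = 0")
      case True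
      have "\<not> bad v" using f1[of v] True by auto
      then have "g v = 1" using v g1[OF v] by (auto simp: bad_def)
      then have "v \<in> P2" using v True by (simp add: P2_def)
      then show ?thesis using kP2'[of v] True \<open>g v = 1\<close> by (simp add: cong_iff_dvd_diff)
    next
      case False
      define p where "p = nat (int m - f v)"
      define q where "q = nat (int m - g v)"
      have pq: "int p = int m - f v" "int q = int m - g v" "p \<le> m - 1" "q \<le> m - 1"
        using ranges[of v] False g1[OF v] by (auto simp: p_def q_def)
      have "N dvd sum h {v} + int p * k1 + int q * k2 - k0"
        by (rule bld) (use v BE pq m3 in auto)
      then have "N dvd (sum h {v} + int p * k1 + int q * k2 - k0) - (int m * k1 + int m * k2 - k0)"
        using M12 by (rule dvd_diff)
      also have "\<dots> = h v - (f v * k1 + g v * k2)" unfolding pq(1,2) by (simp add: algebra_simps)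
      finally show ?thesis .
    qed
    have step: "N dvd p * (int m * k1) + s * (int m * k2) - k0"
      if asm: "D \<subseteq> V - V0" "D \<noteq> {}" "0 \<le> p * int m - sum f D" "p * int m - sum f D < int m"
        "0 \<le> s * int m - sum g D" "s * int m - sum g D < int m" for D p s
    proof -
      define i where "i = nat (p * int m - sum f D)"
      define j where "j = nat (s * int m - sum g D)"
      have ij: "int i = p * int m - sum f D" "int j = s * int m - sum g D" "i \<le> m - 1" "j \<le> m - 1"
        using asm(3-6) by (auto simp: i_def j_def)
      have 1: "N dvd sum h D + int i * k1 + int j * k2 - k0"
      proof (rule bld[OF _ asm(2) _ _ _ ij(3,4)])
        show "card D \<le> m" using card_mono[OF fins(5) asm(1)] card_B by simp
        show "D \<subseteq> V" "D \<inter> E = {}" "D \<inter> Z = {}" using asm(1) BE by auto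
        show "int m dvd sum f D + int i" unfolding ij(1) by simp
        show "int m dvd sum g D + int j" unfolding ij(2) by simp
      qed
      have "N dvd (\<Sum>v\<in>D. h v - (f v * k1 + g v * k2))" by (rule dvd_sum) (use hB asm(1) in auto)
      then have 2: "N dvd sum h D - (sum f D * k1 + sum g D * k2)"
        by (simp add: sum_subtractf sum.distrib sum_distrib_right)
      have "N dvd (sum h D + int i * k1 + int j * k2 - k0) - (sum h D - (sum f D * k1 + sum g D * k2))"
        by (rule dvd_diff[OF 1 2])
      also have "\<dots> = p * (int m * k1) + s * (int m * k2) - k0"
        unfolding ij(1,2) by (simp add: algebra_simps)
      finally show ?thesis .
    qed
    have "(\<Sum>v\<in>V - V0. 1) < sum g (V - V0)"
      using g1 bg(1,3) fins(5) by (intro sum_strict_mono_ex1) (auto intro!: bexI[of _ b])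
    then have gt: "int m < sum g (V - V0)" using card_B by simp
    have m0: "0 \<le> int m" by simp
    obtain D v where D: "D \<subseteq> V - V0" "v \<in> V - V0 - D" "sum g D \<le> int m" "int m < sum g D + g v"
      by (rule subset_sum_crossing[OF fins(5) m0 gt])
    have finD: "finite D" by (rule finite_subset[OF D(1) fins(5)])
    have D0: "D \<noteq> {}" using D(4) ranges(4)[of v] by auto
    have gD: "1 \<le> sum g D"
    proof -
      obtain d where d: "d \<in> D" using D0 by blast
      have "g d \<le> sum g D" using d finD ranges(3) by (intro member_le_sum) auto
      then show ?thesis using g1[of d] d D(1) by auto
    qed
    define p where "p = - ((- sum f D) div int m)"
    define p' where "p' = - ((- sum f (insert v D)) div int m)"
    \<comment> \<open>The multipliers \<open>p\<close> and \<open>p'\<close> are ceilings, written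
      through rounding down; the excess over the f-sum is the number of copies of e, from 0 to m -
      1.\<close>
    have ceil: "0 \<le> - ((- a) div int m) * int m - a \<and> - ((- a) div int m) * int m - a < int m" for a
    proof -
      have "- ((- a) div int m) * int m - a = - a - int m * ((- a) div int m)"
        by (simp add: mult.commute)
      also have "\<dots> = (- a) mod int m" by (rule minus_mult_div_eq_mod)
      finally have "- ((- a) div int m) * int m - a = (- a) mod int m" .
      then show ?thesis using m3 by simp
    qed
    have s1: "N dvd p * (int m * k1) + 1 * (int m * k2) - k0"
      by (rule step[OF D(1) D0]) (use ceil[of "sum f D"] D(3) gD in \<open>auto simp: p_def\<close>)
    have gI: "sum g (insert v D) = sum g D + g v" using D(2) finD by (simp add: add.commute)
    have fI: "sum f (insert v D) = sum f D + f v" using D(2) finD by (simp add: add.commute)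
    have s2: "N dvd p' * (int m * k1) + 2 * (int m * k2) - k0"
    proof (rule step)
      show "insert v D \<subseteq> V - V0" using D by auto
      show "0 \<le> 2 * int m - sum g (insert v D)" "2 * int m - sum g (insert v D) < int m"
        unfolding gI using D(3,4) ranges(4)[of v] by linarith+
    qed (use ceil[of "sum f (insert v D)"] in \<open>auto simp: p'_def\<close>)
    have "p' = p \<or> p' = p + 1"
    proof -
      have lt: "(p' - p) * int m < 2 * int m" "(- 1) * int m < (p' - p) * int m"
        using ceil[of "sum f D"] ceil[of "sum f (insert v D)"] fI ranges(1,2)[of v]
        by (auto simp: p_def p'_def left_diff_distrib)
      have "p' - p < 2" "- 1 < p' - p"
        by (rule mult_right_less_imp_less[OF lt(1)], simp, rule mult_right_less_imp_less[OF lt(2)], simp)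
      then show ?thesis by linarith
    qed
    then show ?thesis
    proof
      assume pp: "p' = p"
      have "N dvd (p * (int m * k1) + 2 * (int m * k2) - k0) - (p * (int m * k1) + 1 * (int m * k2) - k0)"
        by (rule dvd_diff[OF s2[unfolded pp] s1])
      also have "\<dots> = int m * h z" by (simp add: k2_def)
      finally show ?thesis .
    next
      assume pp: "p' = p + 1"
      have "N dvd (int m * k1 + int m * k2 - k0)
        - ((p' * (int m * k1) + 2 * (int m * k2) - k0) - (p * (int m * k1) + 1 * (int m * k2) - k0))"
        by (rule dvd_diff[OF M12 dvd_diff[OF s2 s1]])
      also have "\<dots> = - k0" unfolding pp by (simp add: algebra_simps)
      finally show ?thesis using nz by simp
    qed
  qed
qed

text \<open>Outside Z the block consists of E and w, all with f-coordinate 1, so the roles of e and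
  e' can be exchanged.\<close>

lemma swapped:
  assumes flat: "m - 1 \<le> card Z"
  shows "base m N k0 V g f h V0 Z"
proof -
  obtain w where w: "w \<in> F" "f w = 1" "F = insert w Z" "w \<notin> Z" "card Z = m - 1"
    by (rule flat_rest[OF flat])
  have "V0 - Z = insert w E" using w sub(6,8) by auto
  moreover have "w \<notin> E" using w(1) sub(6) by auto
  moreover have "sum g E = 0" by (rule sum.neutral) (use E(4) in auto)
  ultimately have V0Z: "V0 - Z = insert w E" "sum g (V0 - Z) = 1"
    using gF[OF w(1)] fins(2) by simp_all
  have "adapted m g f V0 Z"
    unfolding adapted_def
  proof (intro conjI ballI allI)
    show "Z \<subseteq> V0" using sub(3) by (auto simp: Z_def)
    show "card Z = m - 1" by (rule w(5))
    show "[sum g (V0 - Z) = 1] (mod int m)" using V0Z(2) by simp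
    show "f i = 1" if "i \<in> V0 - Z" for i using that unfolding V0Z(1) using w(2) E(3) by blast
  qed (use ranges gF in \<open>auto simp: Z_def\<close>)
  moreover have "two_block m N k0 V g f h"
    using two_block_axioms unfolding two_block_def zs_def by (simp add: conj_commute)
  ultimately show ?thesis
    using V0 card_V0 zV0 by (simp add: base_def base_axioms_def zs_def conj_commute)
qed

end

text \<open>\<open>V\<close> and \<open>V'\<close> may involve different blocks of length m, but
  they share \<open>V0\<close>, so both statements concern the same lift \<open>h z\<close> of
  e'.\<close>

lemma flat_conflict:
  assumes b1: "base m N k0 V f g h V0 E" and b2: "base m N k0 V' f g h V0 E"
    and flat: "m - 1 \<le> card {v \<in> V0 - E. f v = 0}"
    and x: "x \<in> V - V0" "g x \<noteq> 1" "\<not> (f x = 1 \<and> g x = 0)"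
    and x': "x' \<in> V' - V0" "f x' \<noteq> 1" "\<not> (f x' = 0 \<and> g x' = 1)"
  shows False
proof -
  interpret b1: base m N k0 V f g h V0 E by (rule b1)
  interpret b2: base m N k0 V' f g h V0 E by (rule b2)
  have fl: "m - 1 \<le> card b1.Z" using flat by (simp add: b1.Z_def b1.F_def)
  then have "0 < card b1.Z" using b1.m3 by linarith
  then obtain z where z: "z \<in> b1.Z" by (auto simp: card_gt_0_iff)
  have "b1.bad x" using x by (simp add: b1.bad_def)
  then have d: "N dvd int m * h z" by (rule b1.flat_dvd[OF fl _ z])
  interpret s: base m N k0 V' g f h V0 b1.Z by (rule b2.swapped[OF fl])
  have "s.bad x'" using x' by (auto simp: s.bad_def)
  then show False using s.not_dvd z d by blast
qed

section \<open>Decompositions into zero-sum blocks\<close>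

definition blocks :: "nat \<Rightarrow> ('i \<Rightarrow> int) \<Rightarrow> ('i \<Rightarrow> int) \<Rightarrow> 'i set \<Rightarrow> 'i set set \<Rightarrow> bool" where
  "blocks m x y I P \<longleftrightarrow> \<Union>P = I \<and> disjoint P \<and> (\<forall>Q\<in>P. Q \<noteq> {} \<and> zs m x y Q)"

lemma blocks_finite: "blocks m x y I P \<Longrightarrow> finite I \<Longrightarrow> finite P"
  by (rule finite_subset[of _ "Pow I"]) (auto simp: blocks_def)

lemma blocks_disjoint: "blocks m x y I P \<Longrightarrow> Q \<in> P \<Longrightarrow> R \<in> P \<Longrightarrow> Q \<noteq> R \<Longrightarrow> Q \<inter> R = {}"
  by (simp add: blocks_def disjoint_def)

lemma sum_Union_blocks:
  assumes "blocks m x y I P" "finite I" "A \<subseteq> P"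
  shows "sum h (\<Union>A) = (\<Sum>Q\<in>A. sum h Q)"
proof (rule sum.Union_disjoint[simplified o_def])
  show "\<forall>Q\<in>A. finite Q"
    using assms finite_subset unfolding blocks_def by (metis Union_upper subsetD)
  show "\<forall>Q\<in>A. \<forall>R\<in>A. Q \<noteq> R \<longrightarrow> Q \<inter> R = {}"
    using assms(1,3) unfolding blocks_def disjoint_def by blast
qed

lemma blocks_replace:
  assumes P: "blocks m x y I P" and I: "finite I" and A: "A \<subseteq> P" and R: "blocks m x y (\<Union>A) R"
  shows "blocks m x y I (P - A \<union> R)" "card (P - A \<union> R) = card P - card A + card R"
proof -
  have d: "Q \<inter> U = {}" if "Q \<in> P - A" "U \<in> R" for Q U
  proof -
    have "U \<subseteq> \<Union>A" using R that(2) by (auto simp: blocks_def)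
    moreover have "Q \<inter> S = {}" if "S \<in> A" for S
    proof (rule blocks_disjoint[OF P])
      show "Q \<in> P" "S \<in> P" "Q \<noteq> S" using \<open>Q \<in> P - A\<close> that A by auto
    qed
    ultimately show ?thesis by blast
  qed
  have U: "\<Union>(P - A) \<union> \<Union>A = I" using P A by (auto simp: blocks_def)
  show "blocks m x y I (P - A \<union> R)" unfolding blocks_def
  proof (intro conjI ballI)
    show "\<Union>(P - A \<union> R) = I" using U R by (simp add: blocks_def)
    show "disjoint (P - A \<union> R)"
      unfolding disjoint_def
    proof (intro ballI impI)
      fix Q U assume a: "Q \<in> P - A \<union> R" "U \<in> P - A \<union> R" "Q \<noteq> U"
      have "Q \<inter> U = {}" if "Q \<in> P" "U \<in> P" using P that a(3) by (auto simp: blocks_def disjoint_def)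
      moreover have "Q \<inter> U = {}" if "Q \<in> R" "U \<in> R" using R that a(3) by (auto simp: blocks_def disjoint_def)
      ultimately show "Q \<inter> U = {}" using a(1,2) d by (metis DiffD1 Int_commute UnE)
    qed
  qed (use P R in \<open>auto simp: blocks_def\<close>)
  have fP: "finite P" by (rule blocks_finite[OF P I])
  have fA: "finite A" by (rule finite_subset[OF A fP])
  have "\<Union>A \<subseteq> I" using P A by (auto simp: blocks_def)
  then have fR: "finite R" using blocks_finite[OF R] finite_subset[OF _ I] by blast
  have "(P - A) \<inter> R = {}"
  proof (rule ccontr)
    assume "(P - A) \<inter> R \<noteq> {}"
    then obtain Q where Q: "Q \<in> P - A" "Q \<in> R" by auto
    then have "Q = {}" using d[OF Q] by simp
    then show False using Q(2) R by (auto simp: blocks_def)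
  qed
  then show "card (P - A \<union> R) = card P - card A + card R"
    using fP fA fR A by (simp add: card_Un_disjoint card_Diff_subset)
qed

lemma blocks_pair:
  assumes "finite U" "zs m x y U" "Q \<subseteq> U" "Q \<noteq> {}" "Q \<noteq> U" "zs m x y Q"
  shows "blocks m x y U {Q, U - Q}" "card {Q, U - Q} = 2"
proof -
  have "zs m x y (U - Q)" by (rule zs_Diff) (use assms in auto)
  moreover have "U - Q \<noteq> {}" "Q \<noteq> U - Q" using assms(3-5) by blast+
  ultimately show "blocks m x y U {Q, U - Q}" "card {Q, U - Q} = 2"
    using assms(3,4,6) by (auto simp: blocks_def disjoint_def)
qed

text \<open>With n = k + 1 the length is k m + 2m - 1, enough for n zero-sum blocks over K. Their
  y-sums divided by m are n elements of the cyclic group of order n.\<close>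

lemma davenport_upper:
  fixes x y :: "nat \<Rightarrow> int"
  assumes "m > 0" "n > 0" "finite A" "m * n + m - 1 \<le> card A"
  obtains Q where "Q \<subseteq> A" "Q \<noteq> {}" "int m dvd sum x Q" "int (m * n) dvd sum y Q"
proof -
  obtain k where n: "n = Suc k" using assms(2) by (cases n) auto
  have cA: "k * m + 2 * m - 1 \<le> card A" using assms(4) n by (simp add: algebra_simps)
  from eta_dav[OF assms(1)] have ed: "eta_bound m" "dav_bound m" by simp_all
  from extract_blocks_extra[OF ed assms(3) cA, of x y] obtain B where
    B: "\<And>j. j < Suc k \<Longrightarrow> B j \<subseteq> A \<and> B j \<noteq> {} \<and> zs m x y (B j)"
      "disjoint_family_on B {..<Suc k}" by blast
  obtain J where J: "J \<subseteq> {..<Suc k}" "J \<noteq> {}" "int n dvd (\<Sum>j\<in>J. sum y (B j) div int m)"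
    by (rule cyclic_zero_sum_exists[of "{..<Suc k}" n "\<lambda>j. sum y (B j) div int m"]) (use n in auto)
  have finJ: "finite J" by (rule finite_subset[OF J(1)]) simp
  have fB: "finite (B j)" if "j \<in> J" for j
    using B(1)[of j] J(1) that finite_subset[OF _ assms(3)] by blast
  have dJ: "\<forall>i\<in>J. \<forall>j\<in>J. i \<noteq> j \<longrightarrow> B i \<inter> B j = {}"
    using B(2) J(1) unfolding disjoint_family_on_def by blast
  have sums: "sum h (\<Union>j\<in>J. B j) = (\<Sum>j\<in>J. sum h (B j))" for h :: "nat \<Rightarrow> int"
    using finJ fB dJ by (intro sum.UNION_disjoint) auto
  have "int m dvd sum x (\<Union>j\<in>J. B j)"
    unfolding sums
  proof (rule dvd_sum)
    fix j assume "j \<in> J"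
    then show "int m dvd sum x (B j)" using B(1)[of j] J(1) unfolding zs_def by blast
  qed
  moreover have "int (m * n) dvd sum y (\<Union>j\<in>J. B j)"
  proof -
    have "(\<Sum>j\<in>J. sum y (B j)) = (\<Sum>j\<in>J. int m * (sum y (B j) div int m))"
    proof (rule sum.cong[OF refl])
      fix j assume "j \<in> J"
      then have "int m dvd sum y (B j)" using B(1)[of j] J(1) unfolding zs_def by blast
      then show "sum y (B j) = int m * (sum y (B j) div int m)" by simp
    qed
    then show ?thesis unfolding sums using J(3) by (simp add: sum_distrib_left[symmetric])
  qed
  moreover have "B j \<subseteq> A" "B j \<noteq> {}" if "j \<in> J" for j
    using B(1)[of j] J(1) that by blast+
  then have "(\<Union>j\<in>J. B j) \<subseteq> A" "(\<Union>j\<in>J. B j) \<noteq> {}" using J(2) by blast+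
  ultimately show ?thesis using that by blast
qed

lemma adapted_values: "adapted m f g W E \<Longrightarrow> i \<in> W \<Longrightarrow> g i = 1 \<or> g i = 0 \<and> f i = 1"
  by (cases "i \<in> E") (simp_all add: adapted_def)

text \<open>The minimal zero-sum sequence obtained from T. K is read off from both coordinates
  modulo m; a block that vanishes in K has as y-sum a multiple of m modulo mn, an element of N, so y
  takes the place of h.\<close>

locale extremal =
  fixes m n :: nat and I :: "nat set" and x y :: "nat \<Rightarrow> int"
  assumes m3: "3 \<le> m" and n1: "1 \<le> n" and finI: "finite I" and cardI: "card I = m * n + m - 1"
    and zI: "int m dvd sum x I" "int (m * n) dvd sum y I"
    and minI: "\<And>Q. Q \<subseteq> I \<Longrightarrow> Q \<noteq> {} \<Longrightarrow> Q \<noteq> I \<Longrightarrow> \<not> (int m dvd sum x Q \<and> int (m * n) dvd sum y Q)"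
    and PB: "property_B m"
begin

lemma zsI: "zs m x y I"
  using zI by (auto simp: zs_def intro: dvd_mult_left)

lemma block: 
  assumes "blocks m x y I P" "Q \<in> P"
  shows "Q \<subseteq> I" "Q \<noteq> {}" "zs m x y Q" "finite Q" "int m dvd sum y Q"
proof -
  show "Q \<subseteq> I" "Q \<noteq> {}" "zs m x y Q" using assms by (auto simp: blocks_def)
  then show "finite Q" "int m dvd sum y Q" using finite_subset[OF _ finI] by (auto simp: zs_def)
qed

lemma subfamily:
  assumes P: "blocks m x y I P" and A: "A \<subseteq> P" "A \<noteq> {}" "A \<noteq> P"
  shows "\<not> int n dvd (\<Sum>Q\<in>A. sum y Q div int m)"
proof
  assume d: "int n dvd (\<Sum>Q\<in>A. sum y Q div int m)"
  have "sum y (\<Union>A) = (\<Sum>Q\<in>A. sum y Q)" by (rule sum_Union_blocks[OF P finI A(1)])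
  also have "\<dots> = (\<Sum>Q\<in>A. int m * (sum y Q div int m))"
  proof (rule sum.cong[OF refl])
    fix Q assume "Q \<in> A"
    then have "int m dvd sum y Q" using block(5)[OF P] A(1) by auto
    then show "sum y Q = int m * (sum y Q div int m)" by simp
  qed
  also have "\<dots> = int m * (\<Sum>Q\<in>A. sum y Q div int m)" by (simp add: sum_distrib_left)
  finally have "int (m * n) dvd sum y (\<Union>A)" using d by simp
  moreover have "int m dvd sum x (\<Union>A)"
    unfolding sum_Union_blocks[OF P finI A(1)]
    by (rule dvd_sum) (use block(3)[OF P] A(1) in \<open>auto simp: zs_def\<close>)
  moreover have "\<Union>A \<subseteq> I" using P A(1) by (auto simp: blocks_def)
  moreover have "\<Union>A \<noteq> {}"
  proof -
    obtain Q where "Q \<in> A" using A(2) by blast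
    moreover have "Q \<noteq> {}" using block(2)[OF P] A(1) \<open>Q \<in> A\<close> by blast
    ultimately show ?thesis by blast
  qed
  moreover have "\<Union>A \<noteq> I"
  proof
    assume eq: "\<Union>A = I"
    obtain Q where Q: "Q \<in> P" "Q \<notin> A" using A(1,3) by blast
    obtain q where q: "q \<in> Q" using block(2)[OF P Q(1)] by blast
    then have "q \<in> \<Union>A" using eq block(1)[OF P Q(1)] by blast
    then obtain S where S: "S \<in> A" "q \<in> S" by blast
    have "S \<in> P" "Q \<noteq> S" using S(1) A(1) Q(2) by auto
    then have "Q \<inter> S = {}" by (rule blocks_disjoint[OF P Q(1)])
    then show False using q S(2) by blast
  qed
  ultimately show False using minI by blast
qed

text \<open>Among more than n blocks, some n would contain a subfamily with sum zero in N, and this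
  subfamily is proper.\<close>

lemma card_blocks_le:
  assumes P: "blocks m x y I P"
  shows "card P \<le> n"
proof (rule ccontr)
  assume "\<not> card P \<le> n"
  then have "n \<le> card P" by simp
  then obtain A where A: "A \<subseteq> P" "card A = n" "finite A" by (rule obtain_subset_with_card_n)
  obtain J where J: "J \<subseteq> A" "J \<noteq> {}" "int n dvd (\<Sum>Q\<in>J. sum y Q div int m)"
    by (rule cyclic_zero_sum_exists[OF A(3), of n "\<lambda>Q. sum y Q div int m"]) (use A(2) n1 in auto)
  have "J \<noteq> P" using J(1) A(2) card_mono[OF A(3) J(1)] \<open>\<not> card P \<le> n\<close> by auto
  then show False using subfamily[OF P _ J(2)] J(1,3) A(1) by auto
qed

lemma sums_cong:
  assumes P: "blocks m x y I P" "card P = n" and Q: "Q \<in> P" "R \<in> P"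
  shows "[sum y Q = sum y R] (mod int (m * n))"
proof -
  have "[sum y Q div int m = sum y R div int m] (mod int n)"
    by (rule cyclic_extremal_all_cong[OF blocks_finite[OF P(1) finI] P(2) _ Q])
      (rule subfamily[OF P(1)])
  then have "int n dvd sum y Q div int m - sum y R div int m" by (simp add: cong_iff_dvd_diff)
  then have "int m * int n dvd int m * (sum y Q div int m - sum y R div int m)" by (rule mult_dvd_mono[OF dvd_refl])
  then show ?thesis using block(5)[OF P(1) Q(1)] block(5)[OF P(1) Q(2)]
    by (simp add: cong_iff_dvd_diff right_diff_distrib)
qed

text \<open>Splitting a block would give n + 1 blocks.\<close>

lemma block_minimal:
  assumes P: "blocks m x y I P" "card P = n" and B: "B \<in> P" and Q: "Q \<subseteq> B" "Q \<noteq> {}" "Q \<noteq> B"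
  shows "\<not> zs m x y Q"
proof
  assume z: "zs m x y Q"
  note b = block[OF P(1) B]
  have R: "blocks m x y (\<Union>{B}) {Q, B - Q}" "card {Q, B - Q} = 2"
    using blocks_pair[OF b(4,3) Q z] by simp_all
  have "{B} \<subseteq> P" using B by simp
  from blocks_replace[OF P(1) finI this R(1)] R(2)
  have "blocks m x y I (P - {B} \<union> {Q, B - Q})" "card (P - {B} \<union> {Q, B - Q}) = n - 1 + 2"
    using P(2) by simp_all
  then show False using card_blocks_le n1 by fastforce
qed

definition decomp where
  "decomp P S \<longleftrightarrow> blocks m x y I P \<and> card P = n \<and> S \<in> P \<and> card S = 2 * m - 1 \<and> (\<forall>B\<in>P - {S}. card B = m)"

lemma decompD:
  assumes "decomp P S"
  shows "blocks m x y I P" "card P = n" "S \<in> P" "card S = 2 * m - 1" "\<And>B. B \<in> P \<Longrightarrow> B \<noteq> S \<Longrightarrow> card B = m"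
  using assms by (auto simp: decomp_def)

text \<open>Removing n - 1 zero-sums of length at most m leaves at least 2m - 1 terms, which form a
  block themselves; being minimal, it cannot have 2m terms. So every length estimate is an
  equality.\<close>

lemma decomp_exists: obtains P S where "decomp P S"
proof -
  obtain k where n: "n = Suc k" using n1 by (cases n) auto
  have m0: "m > 0" using m3 by simp
  have cI: "card I = k * m + 2 * m - 1" using cardI n by (simp add: algebra_simps)
  then have "k * m + 2 * m - 2 \<le> card I" by simp
  from extract_blocks[OF conjunct1[OF eta_dav[OF m0]] finI this, of x y] obtain B where
    B: "\<And>j. j < k \<Longrightarrow> B j \<subseteq> I \<and> B j \<noteq> {} \<and> card (B j) \<le> m \<and> zs m x y (B j)"
      "disjoint_family_on B {..<k}" by blast
  let ?U = "\<Union>j<k. B j"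
  have UI: "?U \<subseteq> I" using B(1) by auto
  have dB: "\<forall>i\<in>{..<k}. \<forall>j\<in>{..<k}. i \<noteq> j \<longrightarrow> B i \<inter> B j = {}"
    using B(2) unfolding disjoint_family_on_def by blast
  have fB: "finite (B j)" if "j < k" for j using B(1)[OF that] finite_subset[OF _ finI] by blast
  have cU: "card ?U = (\<Sum>j<k. card (B j))" using fB dB by (intro card_UN_disjoint) auto
  have cUle: "(\<Sum>j<k. card (B j)) \<le> k * m"
  proof -
    have "(\<Sum>j<k. card (B j)) \<le> (\<Sum>j<k. m)" using B(1) by (intro sum_mono) auto
    then show ?thesis by simp
  qed
  define S where "S = I - ?U"
  have cS: "card S = k * m + 2 * m - 1 - card ?U"
    unfolding S_def using card_Diff_subset[OF finite_subset[OF UI finI] UI] cI by simp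
  then have cS1: "2 * m - 1 \<le> card S" using cU cUle by linarith
  then have S0: "S \<noteq> {}" using m3 by auto
  have zU: "zs m x y ?U"
  proof -
    have sums: "sum h ?U = (\<Sum>j<k. sum h (B j))" for h :: "nat \<Rightarrow> int"
      using fB dB by (intro sum.UNION_disjoint) auto
    have d: "int m dvd sum x (B j)" "int m dvd sum y (B j)" if "j < k" for j
      using B(1)[OF that] by (simp_all add: zs_def)
    have "int m dvd (\<Sum>j<k. sum x (B j))" "int m dvd (\<Sum>j<k. sum y (B j))"
      by (rule dvd_sum, simp add: d)+
    then show ?thesis unfolding zs_def sums by blast
  qed
  have zS: "zs m x y S" unfolding S_def by (rule zs_Diff[OF finI UI zsI zU])
  define P where "P = insert S (B ` {..<k})"
  have inj: "inj_on B {..<k}"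
  proof (rule inj_onI)
    fix i j assume ij: "i \<in> {..<k}" "j \<in> {..<k}" "B i = B j"
    show "i = j"
    proof (rule ccontr)
      assume "i \<noteq> j"
      then have "B i \<inter> B j = {}" using dB ij(1,2) by blast
      then show False using B(1)[of i] ij by auto
    qed
  qed
  have SB: "S \<inter> B j = {}" if "j < k" for j using that by (auto simp: S_def)
  have "S \<notin> B ` {..<k}" using SB S0 by auto
  then have cP: "card P = n" using inj n by (simp add: P_def card_image)
  have bP: "blocks m x y I P" unfolding blocks_def
  proof (intro conjI ballI)
    show "\<Union>P = I" using UI by (auto simp: P_def S_def)
    show "disjoint P" unfolding disjoint_def
    proof (intro ballI impI)
      fix Q R assume QR: "Q \<in> P" "R \<in> P" "Q \<noteq> R"
      show "Q \<inter> R = {}"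
      proof (cases "Q = S \<or> R = S")
        case True
        then show ?thesis using SB QR by (auto simp: P_def)
      next
        case False
        then obtain i j where ij: "i < k" "j < k" "Q = B i" "R = B j"
          using QR(1,2) by (auto simp: P_def)
        then have "i \<noteq> j" using QR(3) by blast
        then show ?thesis unfolding ij(3,4) using dB ij(1,2) by blast
      qed
    qed
    fix Q assume "Q \<in> P"
    then show "Q \<noteq> {}" "zs m x y Q" using S0 zS B(1) by (auto simp: P_def)
  qed
  have SP: "S \<in> P" by (simp add: P_def)
  have cS2: "card S = 2 * m - 1"
  proof (rule ccontr)
    assume "card S \<noteq> 2 * m - 1"
    then have big: "2 * m \<le> card S" using cS1 by linarith
    obtain s where s: "s \<in> S" using S0 by blast
    have finS: "finite S" using finI by (simp add: S_def)
    have c: "2 * m - 1 \<le> card (S - {s})" using big s finS by simp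
    obtain R where R: "R \<subseteq> S - {s}" "R \<noteq> {}" "zs m x y R"
      by (rule dav[OF m0 _ c]) (use finS in auto)
    have "R \<subseteq> S" "R \<noteq> S" using R(1) s by auto
    then show False using block_minimal[OF bP cP SP _ R(2)] R(3) by blast
  qed
  have "(\<Sum>j<k. card (B j)) = k * m" using cS cS2 cU cUle cI m3 by linarith
  then have "(\<Sum>j<k. m - card (B j)) = 0"
    using B(1) by (subst sum_subtractf_nat) auto
  then have "m \<le> card (B j)" if "j < k" for j using that by simp
  then have cB: "card (B j) = m" if "j < k" for j using B(1)[OF that] that by (simp add: le_antisym)
  have "decomp P S" unfolding decomp_def
    using bP cP SP cS2 cB by (auto simp: P_def)
  then show ?thesis using that by blast
qed

lemma decomp_replace:
  assumes D: "decomp P S" and B: "B \<in> P" "B \<noteq> S"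
    and Q: "Q \<subseteq> B \<union> S" "Q \<noteq> {}" "Q \<noteq> B \<union> S" "zs m x y Q"
  shows "blocks m x y I (P - {B, S} \<union> {Q, (B \<union> S) - Q})" "card (P - {B, S} \<union> {Q, (B \<union> S) - Q}) = n"
proof -
  note d = decompD[OF D]
  note b = block[OF d(1) B(1)] and s = block[OF d(1,3)]
  have sP: "{B, S} \<subseteq> P" using B d(3) by simp
  have BS: "B \<inter> S = {}" by (rule blocks_disjoint[OF d(1) B(1) d(3) B(2)])
  have c2: "card {B, S} = 2" using B(2) by simp
  have n2: "2 \<le> n" using card_mono[OF blocks_finite[OF d(1) finI] sP] d(2) c2 by simp
  have R: "blocks m x y (\<Union>{B, S}) {Q, (B \<union> S) - Q}" "card {Q, (B \<union> S) - Q} = 2"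
    using blocks_pair[OF _ zs_Un[OF b(4) s(4) BS b(3) s(3)] Q] b(4) s(4) by simp_all
  show "blocks m x y I (P - {B, S} \<union> {Q, (B \<union> S) - Q})" "card (P - {B, S} \<union> {Q, (B \<union> S) - Q}) = n"
    using blocks_replace[OF d(1) finI sP R(1)] R(2) c2 d(2) n2 by simp_all
qed

lemma two_block_decomp:
  assumes D: "decomp P S" and B: "B \<in> P" "B \<noteq> S"
  shows "two_block m (int (m * n)) (sum y S) (B \<union> S) x y y"
proof -
  note d = decompD[OF D]
  note b = block[OF d(1) B(1)] and s = block[OF d(1,3)]
  have BS: "B \<inter> S = {}" using d(1,3) B unfolding blocks_def disjoint_def by blast
  have sP: "{B, S} \<subseteq> P" using B d(3) by simp
  have finP: "finite P" by (rule blocks_finite[OF d(1) finI])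
  have c2: "card {B, S} = 2" using B(2) by simp
  then have n2: "2 \<le> n" using card_mono[OF finP sP] d(2) by simp
  have zV: "zs m x y (B \<union> S)" by (rule zs_Un[OF b(4) s(4) BS b(3) s(3)])
  have nzero: "\<not> int (m * n) dvd sum y Q" if Q: "Q \<subseteq> I" "Q \<noteq> {}" "Q \<noteq> I" "zs m x y Q" for Q
    using minI[OF Q(1-3)] Q(4) by (auto simp: zs_def)
  have BI: "B \<union> S \<subseteq> I" using b(1) s(1) by simp
  have SI: "S \<noteq> I" using b(1,2) BS by auto
  show ?thesis
  proof
    show "3 \<le> m" by (rule m3)
    show "finite (B \<union> S)" using b(4) s(4) by simp
    show "card (B \<union> S) = 3 * m - 1"
      using card_Un_disjoint[OF b(4) s(4) BS] d(5)[OF B] d(4) m3 by simp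
    show "zs m x y (B \<union> S)" by (rule zV)
    show "\<not> int (m * n) dvd sum y S" by (rule nzero[OF s(1,2) SI s(3)])
    fix Q assume Q: "Q \<subseteq> B \<union> S" "Q \<noteq> {}" "Q \<noteq> B \<union> S" "zs m x y Q"
    note P' = decomp_replace[OF D B Q]
    \<comment> \<open>A third block, untouched by the replacement, links the new sum to the old one.
      For n = 2 there is none, but N then has a single nonzero element.\<close>
    show "[sum y Q = sum y S] (mod int (m * n))"
    proof (cases "n = 2")
      case False
      then have "card {B, S} < card P" using n2 c2 d(2) by simp
      then have "\<not> P \<subseteq> {B, S}" using card_mono[of "{B, S}" P] by auto
      then obtain C where C: "C \<in> P" "C \<notin> {B, S}" by blast
      have "[sum y Q = sum y C] (mod int (m * n))"
        by (rule sums_cong[OF P']) (use C in auto)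
      also have "[sum y C = sum y S] (mod int (m * n))"
        by (rule sums_cong[OF d(1,2) C(1) d(3)])
      finally show ?thesis .
    next
      case True
      obtain u v where uv: "sum y Q = int m * u" "sum y S = int m * v"
        using Q(4) s(3) unfolding zs_def by (auto elim!: dvdE)
      have QI: "Q \<subseteq> I" "Q \<noteq> I" using Q(1,3) BI by auto
      have "\<not> int m * 2 dvd int m * u" "\<not> int m * 2 dvd int m * v"
        using nzero[OF QI(1) Q(2) QI(2) Q(4)] nzero[OF s(1,2) SI s(3)] uv True by simp_all
      then have "odd u" "odd v" using m3 by simp_all
      then have "2 dvd u - v" by simp
      then have "int m * 2 dvd int m * (u - v)" by simp
      then show ?thesis using uv True by (simp add: cong_iff_dvd_diff right_diff_distrib)
    qed
  qed
qed

lemma adapted_decomp: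
  assumes D: "decomp P S"
  obtains f g E where "coords m x y f g" "adapted m f g S E"
proof -
  note d = decompD[OF D]
  show ?thesis
  proof (rule adapted_exists[OF PB _ d(4)])
    show "finite S" "zs m x y S" using block[OF d(1,3)] by auto
    show "\<not> zs m x y Q" if "Q \<subseteq> S" "Q \<noteq> {}" "Q \<noteq> S" for Q
      by (rule block_minimal[OF d(1-3) that])
  qed (rule that)
qed

lemma base_decomp:
  assumes D: "decomp P S" and B: "B \<in> P" "B \<noteq> S" and co: "coords m x y f g" and ad: "adapted m f g S E"
  shows "base m (int (m * n)) (sum y S) (B \<union> S) f g y S E"
  using two_block_coords[OF two_block_decomp[OF D B] co] ad decompD(4)[OF D]
    block(3)[OF decompD(1,3)[OF D]] coords_zs[OF co, of S]
  by (simp add: base_def base_axioms_def)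

lemma B_not_S:
  assumes D: "decomp P S" and B: "B \<in> P" "B \<noteq> S" "b \<in> B"
  shows "b \<in> (B \<union> S) - S"
  using decompD(1,3)[OF D] B unfolding blocks_def disjoint_def by blast

definition good where
  "good f g \<longleftrightarrow> coords m x y f g \<and>
     (\<forall>i\<in>I. [g i = 1] (mod int m) \<or> [g i = 0] (mod int m) \<and> [f i = 1] (mod int m))"

lemma goodI:
  assumes "coords m x y f g" "\<And>i. i \<in> I \<Longrightarrow> g i = 1 \<or> g i = 0 \<and> f i = 1"
  shows "good f g"
  unfolding good_def
proof (intro conjI ballI assms(1))
  fix i assume "i \<in> I"
  then show "[g i = 1] (mod int m) \<or> [g i = 0] (mod int m) \<and> [f i = 1] (mod int m)"
    using assms(2)[of i] by auto
qed

lemma nonflat_good: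
  assumes nf: "\<And>P S. decomp P S \<Longrightarrow> \<not> two_classes m x y S"
  obtains f g where "good f g"
proof -
  obtain P S where D: "decomp P S" by (rule decomp_exists)
  note d = decompD[OF D]
  obtain f g E where co: "coords m x y f g" and ad: "adapted m f g S E" by (rule adapted_decomp[OF D])
  have B: "g b = 1 \<or> g b = 0 \<and> f b = 1" if B: "B \<in> P" "B \<noteq> S" "b \<in> B" for B b
  proof (rule ccontr)
    assume bad: "\<not> ?thesis"
    let ?V = "B \<union> S"
    note bs = base_decomp[OF D B(1,2) co ad]
    interpret base m "int (m * n)" "sum y S" ?V f g y S E by (rule bs)
    interpret tb: two_block m "int (m * n)" "sum y S" ?V x y y by (rule two_block_decomp[OF D B(1,2)])
    have bV: "b \<in> ?V - S" by (rule B_not_S[OF D B])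
    have bV': "b \<in> ?V" using bV by blast
    \<comment> \<open>Leaving out b keeps enough terms for a zero-sum of length at most m, which
      \<open>short\<close> raises to m; the complement is a block of length 2m - 1 containing
      b.\<close>
    have c: "3 * m - 2 \<le> card (?V - {b})" using card_Diff_singleton[OF bV'] card_V by simp
    obtain Q where Q: "Q \<subseteq> ?V - {b}" "Q \<noteq> {}" "card Q \<le> m" "zs m x y Q"
      by (rule eta[OF _ _ c]) (use m3 fin in auto)
    have QV: "Q \<subseteq> ?V" "Q \<noteq> ?V" using Q(1) bV by auto
    have cQ: "card Q = m" using tb.short[OF QV(1) Q(2,4)] Q(3) by simp
    define W where "W = ?V - Q"
    have zW: "zs m x y W" unfolding W_def by (rule zs_Diff[OF fin QV(1) tb.zV Q(4)])
    have cW: "card W = 2 * m - 1"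
      unfolding W_def using card_Diff_subset[OF finV[OF QV(1)] QV(1)] card_V cQ by simp
    have bW: "b \<in> W" "W \<subseteq> ?V" using Q(1) bV by (auto simp: W_def)
    note P' = decomp_replace[OF D B(1,2) QV(1) Q(2) QV(2) Q(4), folded W_def]
    have D': "decomp (P - {B, S} \<union> {Q, W}) W"
      unfolding decomp_def using P' cW cQ d(5) by auto
    obtain f2 g2 E2 where co2: "coords m x y f2 g2" and ad2: "adapted m f2 g2 W E2"
      by (rule adapted_decomp[OF D'])
    have co12: "coords m f g f2 g2" by (rule coords_trans[OF coords_sym[OF co] co2])
    have "two_classes m f g S \<or> two_classes m f g W"
      by (rule nonflat_no_bad[OF bs bV _ _ bW(1) bW(2) cW _ co12 ad2])
        (use bad zW coords_zs[OF co, of W] in auto)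
    then show False using nf[OF D] nf[OF D'] two_classes_coords[OF co] by simp
  qed
  have "good f g"
  proof (rule goodI[OF co])
    fix i assume "i \<in> I"
    then obtain B' where B': "B' \<in> P" "i \<in> B'" using d(1) by (auto simp: blocks_def)
    show "g i = 1 \<or> g i = 0 \<and> f i = 1"
      using B[OF B'(1) _ B'(2)] adapted_values[OF ad] B'(2) by (cases "B' = S") simp_all
  qed
  then show ?thesis using that by blast
qed

lemma flat_good:
  assumes D: "decomp P S" and fl: "two_classes m x y S"
  obtains f g where "good f g"
proof -
  note d = decompD[OF D]
  obtain f g E where co: "coords m x y f g" and ad: "adapted m f g S E" by (rule adapted_decomp[OF D])
  show ?thesis
  proof (cases "P = {S}")
    case True
    then have "I = S" using d(1) by (simp add: blocks_def)
    then have "good f g" using adapted_values[OF ad] by (intro goodI[OF co]) simp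
    then show ?thesis by (rule that)
  next
    case False
    then obtain B0 where B0: "B0 \<in> P" "B0 \<noteq> S" using d(3) by blast
    interpret base m "int (m * n)" "sum y S" "B0 \<union> S" f g y S E by (rule base_decomp[OF D B0 co ad])
    have "two_classes m f g S" using fl two_classes_coords[OF co] by simp
    then obtain i j where ij: "i \<in> S" "j \<in> S" "\<not> cls m f g i j"
      "m - 1 \<le> card {k \<in> S. cls m f g k i}" "m - 1 \<le> card {k \<in> S. cls m f g k j}"
      unfolding two_classes_def by blast
    \<comment> \<open>Two distinct classes cannot both be that of e, so one of them lies in F; a
      shift takes it as e'.\<close>
    obtain z where z: "z \<in> F" "m - 1 \<le> card {k \<in> S. cls m f g k z}"
    proof (cases "i \<in> F")
      case True
      then show ?thesis using that ij by blast
    next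
      case False
      then have "i \<in> E" using ij(1) sub(8) by auto
      then have "j \<notin> E" using ij(3) E(3,4) by (auto simp: cls_eq)
      then have "j \<in> F" using ij(2) sub(8) by auto
      then show ?thesis using that ij by blast
    qed
    let ?f = "\<lambda>i. (f i - f z * g i) mod int m"
    note sh = shift[of "f z"]
    have co': "coords m x y ?f g" by (rule coords_trans[OF co sh(2)])
    have ad': "adapted m ?f g S E" using sh(1) by (simp add: base_def base_axioms_def)
    have flat: "m - 1 \<le> card {v \<in> S - E. ?f v = 0}"
    proof -
      have "{k \<in> S. cls m f g k z} \<subseteq> {v \<in> S - E. ?f v = 0}"
        using E(4) gF[OF z(1)] by (auto simp: cls_eq)
      then have "card {k \<in> S. cls m f g k z} \<le> card {v \<in> S - E. ?f v = 0}"
        using fins(1) by (intro card_mono) auto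
      then show ?thesis using z(2) by simp
    qed
    interpret s: base m "int (m * n)" "sum y S" "B0 \<union> S" ?f g y S E by (rule sh(1))
    have fl': "m - 1 \<le> card s.Z" using flat by (simp add: s.Z_def s.F_def)
    obtain w where w: "w \<in> s.F" "?f w = 1" "s.F = insert w s.Z" by (rule s.flat_rest[OF fl'])
    show ?thesis
    proof (cases "\<exists>B b. B \<in> P \<and> B \<noteq> S \<and> b \<in> B \<and> g b \<noteq> 1 \<and> \<not> (?f b = 1 \<and> g b = 0)")
      case False
      have "good ?f g"
      proof (rule goodI[OF co'])
        fix i assume "i \<in> I"
        then obtain B where B: "B \<in> P" "i \<in> B" using d(1) by (auto simp: blocks_def)
        show "g i = 1 \<or> g i = 0 \<and> ?f i = 1"
        proof (cases "B = S")
          case True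
          then show ?thesis using adapted_values[OF ad'] B(2) by blast
        next
          case neq: False
          then show ?thesis using False B by blast
        qed
      qed
      then show ?thesis by (rule that)
    next
      case True
      then obtain B1 b1 where b1: "B1 \<in> P" "B1 \<noteq> S" "b1 \<in> B1" "g b1 \<noteq> 1" "\<not> (?f b1 = 1 \<and> g b1 = 0)"
        by blast
      note bs1 = base_decomp[OF D b1(1,2) co' ad']
      \<comment> \<open>Once b1 violates the first candidate, no term of any other block, whether
        the block of b1 or not, can violate the second.\<close>
      have no: "?f b = 1 \<or> ?f b = 0 \<and> g b = 1" if b: "B \<in> P" "B \<noteq> S" "b \<in> B" for B b
      proof (rule ccontr)
        assume "\<not> ?thesis"
        then show False
          using flat_conflict[OF bs1 base_decomp[OF D b(1,2) co' ad'] flat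
              B_not_S[OF D b1(1-3)] b1(4,5) B_not_S[OF D b]] by blast
      qed
      have sw: "coords m x y g ?f"
      proof -
        have "coords m ?f g g ?f"
          unfolding coords_def
          by (rule exI[of _ 0], rule exI[of _ 1], rule exI[of _ 1], rule exI[of _ 0]) simp
        then show ?thesis by (rule coords_trans[OF co'])
      qed
      have "good g ?f"
      proof (rule goodI[OF sw])
        fix i assume "i \<in> I"
        then obtain B where B: "B \<in> P" "i \<in> B" using d(1) by (auto simp: blocks_def)
        show "?f i = 1 \<or> ?f i = 0 \<and> g i = 1"
        proof (cases "B = S")
          case False
          then show ?thesis using no B by blast
        next
          case True
          then consider "i \<in> E" | "i = w" | "i \<in> s.Z" using B(2) s.sub(8) w(3) by auto
          then show ?thesis
          proof cases
            case 1
            then show ?thesis by (intro disjI1 s.E(3))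
          next
            case 2
            then show ?thesis using w(2) by blast
          next
            case 3
            then have "?f i = 0 \<and> i \<in> s.F" unfolding s.Z_def by blast
            then show ?thesis using s.gF by blast
          qed
        qed
      qed
      then show ?thesis by (rule that)
    qed
  qed
qed

lemma good_exists: obtains f g where "good f g"
  using nonflat_good flat_good by metis

end

section \<open>The Davenport constant and the passage from sequences to indices\<close>

lemma davenport_lower_zero_sumfree:
  assumes "2 \<le> m" "1 \<le> n"
  shows "zero_sumfree m (m * n) (replicate_mset (m - 1) (1, 0) + replicate_mset (m * n - 1) (0, 1))"
  unfolding zero_sumfree_def
proof (intro allI impI notI)
  fix S assume S: "S \<subseteq># replicate_mset (m - 1) (1, 0) + replicate_mset (m * n - 1) (0::nat, 1::nat) \<and> S \<noteq> {#}"
    and z: "zero_sum m (m * n) S"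
  define a where "a = count S (1, 0)"
  define b where "b = count S (0, 1)"
  have le: "count S v \<le> count (replicate_mset (m - 1) (1, 0) + replicate_mset (m * n - 1) (0::nat, 1::nat)) v" for v
    using S by (intro mset_subset_eq_count) simp
  have a: "a \<le> m - 1" and b: "b \<le> m * n - 1" using le[of "(1, 0)"] le[of "(0, 1)"] by (simp_all add: a_def b_def)
  have S': "S = replicate_mset a (1, 0) + replicate_mset b (0, 1)"
  proof (rule multiset_eqI)
    fix v
    show "count S v = count (replicate_mset a (1, 0) + replicate_mset b (0, 1)) v"
      using le[of v] by (cases "v = (1, 0) \<or> v = (0, 1)") (auto simp: a_def b_def split: if_splits)
  qed
  have mn: "0 < m * n" using assms by simp
  have "a mod m = 0" "b mod (m * n) = 0"
    using z unfolding S' zero_sum_def by (simp_all add: sum_mset_replicate_mset)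
  moreover have "a < m" "b < m * n" using a b assms(1) mn by linarith+
  ultimately have "a = 0" "b = 0" by simp_all
  then show False using S S' by simp
qed

lemma nth_index_sums:
  fixes xs :: "elt list"
  assumes "Q \<subseteq> {..<length xs}"
  shows "zero_sum m k (image_mset (nth xs) (mset_set Q)) \<longleftrightarrow>
     int m dvd (\<Sum>i\<in>Q. int (fst (xs ! i))) \<and> int k dvd (\<Sum>i\<in>Q. int (snd (xs ! i)))"
    "image_mset (nth xs) (mset_set Q) \<subseteq># mset xs"
proof -
  have "int p dvd (\<Sum>i\<in>Q. int (u (xs ! i))) \<longleftrightarrow> (\<Sum>i\<in>Q. u (xs ! i)) mod p = 0" for p and u :: "elt \<Rightarrow> nat"
    by (simp only: of_nat_sum[symmetric] int_dvd_int_iff mod_eq_0_iff_dvd)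
  then show "zero_sum m k (image_mset (nth xs) (mset_set Q)) \<longleftrightarrow>
     int m dvd (\<Sum>i\<in>Q. int (fst (xs ! i))) \<and> int k dvd (\<Sum>i\<in>Q. int (snd (xs ! i)))"
    by (simp add: zero_sum_def image_mset.compositionality o_def sum_unfold_sum_mset)
  have "mset xs = image_mset (nth xs) (mset_set {..<length xs})"
    by (metis atLeast0LessThan map_nth mset_map mset_upt)
  moreover have "mset_set Q \<subseteq># mset_set {..<length xs}" using assms by (simp add: subset_imp_msubset_mset_set)
  ultimately show "image_mset (nth xs) (mset_set Q) \<subseteq># mset xs"
    by (simp only: image_mset_subseteq_mono)
qed

lemma zero_sumfree_size:
  assumes "2 \<le> m" "1 \<le> n" "zero_sumfree m (m * n) T"
  shows "size T < m * n + m - 1"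
proof (rule ccontr)
  assume big: "\<not> size T < m * n + m - 1"
  obtain xs where xs: "mset xs = T" using ex_mset by blast
  have c: "m * n + m - 1 \<le> card {..<length xs}" using big xs by auto
  obtain Q where Q: "Q \<subseteq> {..<length xs}" "Q \<noteq> {}"
    "int m dvd (\<Sum>i\<in>Q. int (fst (xs ! i)))" "int (m * n) dvd (\<Sum>i\<in>Q. int (snd (xs ! i)))"
    by (rule davenport_upper[OF _ _ finite_lessThan c,
          of "\<lambda>i. int (fst (xs ! i))" "\<lambda>i. int (snd (xs ! i))"]) (use assms(1,2) in auto)
  have "finite Q" by (rule finite_subset[OF Q(1)]) simp
  then have "image_mset (nth xs) (mset_set Q) \<noteq> {#}" using Q(2) by (simp add: mset_set_empty_iff)
  then show False
    using assms(3) nth_index_sums[OF Q(1)] Q(3,4) xs unfolding zero_sumfree_def by blast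
qed

lemma davenport_rank_two:
  assumes "2 \<le> m" "1 \<le> n"
  shows "m * n + m - 1 \<le> davenport m (m * n)"
proof -
  let ?Pr = "\<lambda>t. 0 < t \<and> (\<forall>S. seq_over m (m * n) S \<and> t \<le> size S \<longrightarrow> \<not> zero_sumfree m (m * n) S)"
  \<comment> \<open>Any witness makes the set under \<open>LEAST\<close> non-empty, so
    \<open>davenport\<close> itself has the defining property; the zero-sumfree example then
    excludes smaller values.\<close>
  have "?Pr (m * n + m)" using zero_sumfree_size[OF assms] assms by fastforce
  then have P: "?Pr (davenport m (m * n))" unfolding davenport_def by (rule LeastI)
  let ?T = "replicate_mset (m - 1) (1, 0) + replicate_mset (m * n - 1) (0::nat, 1::nat)"
  have mn: "m * 1 \<le> m * n" by (rule mult_le_mono2) (rule assms(2))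
  have "seq_over m (m * n) ?T" using assms mn by (auto simp: seq_over_def grp_def)
  then have "\<not> davenport m (m * n) \<le> size ?T"
    using P davenport_lower_zero_sumfree[OF assms] by blast
  then show ?thesis using assms mn by simp
qed

lemma sum_mset_cong_const:
  fixes u :: "'v \<Rightarrow> int"
  assumes "\<And>v. v \<in># M \<Longrightarrow> [u v = c] (mod N)"
  shows "[(\<Sum>v\<in>#M. u v) = int (size M) * c] (mod N)"
  using assms
proof (induction M)
  case (add v M)
  have "[u v + (\<Sum>v\<in>#M. u v) = c + int (size M) * c] (mod N)"
    using add.prems by (intro cong_add add.IH) auto
  then show ?case by (simp add: algebra_simps)
qed simp

text \<open>Stated for multisets of group elements: S' may contain a term more often than T does, so
  it need not come from a set of indices.\<close>

lemma length_ge_of_coordinates: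
  fixes f g :: "'v \<Rightarrow> int"
  assumes val: "\<And>v. v \<in># S \<Longrightarrow> [g v = 1] (mod int m) \<or> [g v = 0] (mod int m) \<and> [f v = 1] (mod int m)"
    and S: "S \<noteq> {#}" and z: "int m dvd (\<Sum>v\<in>#S. f v)" "int m dvd (\<Sum>v\<in>#S. g v)"
  shows "m \<le> size S"
proof -
  define A where "A = filter_mset (\<lambda>v. [g v = 1] (mod int m)) S"
  define B where "B = filter_mset (\<lambda>v. \<not> [g v = 1] (mod int m)) S"
  have SAB: "S = A + B" by (simp add: A_def B_def)
  have "[(\<Sum>v\<in>#A. g v) = int (size A) * 1] (mod int m)"
    by (rule sum_mset_cong_const) (simp add: A_def)
  moreover have "[(\<Sum>v\<in>#B. g v) = int (size B) * 0] (mod int m)"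
    by (rule sum_mset_cong_const) (use val in \<open>auto simp: B_def\<close>)
  ultimately have "[(\<Sum>v\<in>#A. g v) + (\<Sum>v\<in>#B. g v) = int (size A) * 1 + int (size B) * 0] (mod int m)"
    by (rule cong_add)
  moreover have "(\<Sum>v\<in>#S. g v) = (\<Sum>v\<in>#A. g v) + (\<Sum>v\<in>#B. g v)" by (simp add: SAB)
  ultimately have "[(\<Sum>v\<in>#S. g v) = int (size A)] (mod int m)" by simp
  then have "int m dvd int (size A)" using z(2) by (simp add: cong_dvd_iff)
  then have dA: "m dvd size A" by (simp only: int_dvd_int_iff)
  show ?thesis
  proof (cases "A = {#}")
    case False
    then have "m \<le> size A" using dA by (intro dvd_imp_le) (simp_all add: nonempty_has_size)
    then show ?thesis using SAB by simp
  next
    case True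
    then have "S = B" using SAB by simp
    have "[(\<Sum>v\<in>#S. f v) = int (size S) * 1] (mod int m)"
    proof (rule sum_mset_cong_const)
      fix v assume v: "v \<in># S"
      then have "\<not> [g v = 1] (mod int m)" unfolding \<open>S = B\<close> by (simp add: B_def)
      then show "[f v = 1] (mod int m)" using val[OF v] by blast
    qed
    then have "int m dvd int (size S)" using z(1) by (simp add: cong_dvd_iff)
    then have "m dvd size S" by (simp only: int_dvd_int_iff)
    then show ?thesis using S by (intro dvd_imp_le) (simp_all add: nonempty_has_size)
  qed
qed

theorem theorem5p3:
  fixes m n :: nat and T U :: "elt multiset"
  assumes "2 \<le> m" and "1 \<le> n"
    and "seq_over m (m * n) T"
    and "zero_sumfree m (m * n) T"
    and "size T = davenport m (m * n) - 1"
    and "U \<noteq> {#}"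
    and "seq_over m (m * n) U"
    and "set_mset U \<subseteq> set_mset T"
    and "property_B m"
  shows "\<forall>S'. S' \<subseteq># T + U \<and> S' \<noteq> {#} \<and> zero_sum m (m * n) S' \<longrightarrow> m \<le> size S'"
proof (intro allI impI)
  fix S' assume S': "S' \<subseteq># T + U \<and> S' \<noteq> {#} \<and> zero_sum m (m * n) S'"
  have supp: "v \<in># T" if "v \<in># S'" for v
  proof -
    have "v \<in># T + U" using S' that by (blast dest: mset_subset_eqD)
    then show ?thesis using assms(8) by auto
  qed
  show "m \<le> size S'"
  \<comment> \<open>A single term of S' also occurs in T, where it would be a zero-sum.\<close>
  proof (cases "m = 2")
    case True
    show ?thesis
    proof (rule ccontr)
      assume "\<not> m \<le> size S'"
      moreover have "0 < size S'" using S' by (simp add: nonempty_has_size)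
      ultimately have "size S' = 1" using True by linarith
      then obtain v where v: "S' = {#v#}" using size_1_singleton_mset by blast
      then have "S' \<subseteq># T" using supp by simp
      then show False using S' assms(4) unfolding zero_sumfree_def by blast
    qed
  next
    case False
    then have m3: "3 \<le> m" using assms(1) by simp
    obtain xs where xs: "mset xs = T" using ex_mset by blast
    define L where "L = length xs"
    have "L = size T" using xs by (auto simp: L_def)
    moreover have "m * n + m - 1 \<le> davenport m (m * n)" by (rule davenport_rank_two[OF assms(1,2)])
    moreover have "size T < m * n + m - 1" by (rule zero_sumfree_size[OF assms(1,2,4)])
    ultimately have L: "Suc L = m * n + m - 1" using assms(5) by linarith
    \<comment> \<open>Index L carries minus the sum of T, taken in the integers, so the total is
      literally 0.\<close>
    define x where "x i = (if i < L then int (fst (xs ! i)) else - (\<Sum>j<L. int (fst (xs ! j))))" for i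
    define y where "y i = (if i < L then int (snd (xs ! i)) else - (\<Sum>j<L. int (snd (xs ! j))))" for i
    have total: "sum x {..<Suc L} = 0" "sum y {..<Suc L} = 0" by (simp_all add: x_def y_def)
    have free: "\<not> (int m dvd sum x Q \<and> int (m * n) dvd sum y Q)" if Q: "Q \<subseteq> {..<L}" "Q \<noteq> {}" for Q
    proof -
      have QL: "Q \<subseteq> {..<length xs}" using Q(1) by (simp add: L_def)
      have "finite Q" by (rule finite_subset[OF Q(1)]) simp
      then have "image_mset (nth xs) (mset_set Q) \<noteq> {#}" using Q(2) by (simp add: mset_set_empty_iff)
      then have "\<not> zero_sum m (m * n) (image_mset (nth xs) (mset_set Q))"
        using assms(4) nth_index_sums(2)[OF QL] xs unfolding zero_sumfree_def by blast
      moreover have "sum x Q = (\<Sum>i\<in>Q. int (fst (xs ! i)))" "sum y Q = (\<Sum>i\<in>Q. int (snd (xs ! i)))"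
        by (intro sum.cong; use Q(1) in \<open>auto simp: x_def y_def\<close>)+
      ultimately show ?thesis using nth_index_sums(1)[OF QL] by simp
    qed
    interpret extremal m n "{..<Suc L}" x y
    proof
      show "\<not> (int m dvd sum x Q \<and> int (m * n) dvd sum y Q)"
        if Q: "Q \<subseteq> {..<Suc L}" "Q \<noteq> {}" "Q \<noteq> {..<Suc L}" for Q
      proof (cases "L \<in> Q")
        case False
        then have "Q \<subseteq> {..<L}" using Q(1) by (auto simp: lessThan_Suc)
        then show ?thesis by (rule free[OF _ Q(2)])
      next
        case True
        \<comment> \<open>A subset using index L is replaced by its complement, which lies in T and
          has the opposite sums.\<close>
        have "{..<Suc L} - Q \<subseteq> {..<L}" "{..<Suc L} - Q \<noteq> {}" using Q True by (auto simp: lessThan_Suc)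
        then have "\<not> (int m dvd sum x ({..<Suc L} - Q) \<and> int (m * n) dvd sum y ({..<Suc L} - Q))"
          by (rule free)
        moreover have "sum x ({..<Suc L} - Q) = - sum x Q" "sum y ({..<Suc L} - Q) = - sum y Q"
          using sum_diff[OF finite_lessThan Q(1), of x] sum_diff[OF finite_lessThan Q(1), of y] total
          by linarith+
        ultimately show ?thesis by (simp only: dvd_minus_iff not_False_eq_True)
      qed
    qed (use m3 assms(2,9) L total in simp_all)
    obtain f g where fg: "good f g" by (rule good_exists)
    then obtain a b c d where
      f: "\<And>i. [f i = a * x i + b * y i] (mod int m)" and
      g: "\<And>i. [g i = c * x i + d * y i] (mod int m)"
      unfolding good_def by (elim conjE coordsE) blast
    \<comment> \<open>The coordinates are linear in x and y, so they extend to all group elements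
      and apply to S' term by term.\<close>
    define F where "F v = a * int (fst v) + b * int (snd v)" for v :: elt
    define G where "G v = c * int (fst v) + d * int (snd v)" for v :: elt
    show ?thesis
    proof (rule length_ge_of_coordinates)
      fix v assume "v \<in># S'"
      then have "v \<in># mset xs" unfolding xs by (rule supp)
      then have "v \<in> set xs" by simp
      then obtain i where i: "i < L" "v = xs ! i" by (auto simp: in_set_conv_nth L_def)
      have "[f i = F v] (mod int m)" "[g i = G v] (mod int m)"
        using f[of i] g[of i] i by (simp_all add: F_def G_def x_def y_def)
      moreover have "[g i = 1] (mod int m) \<or> [g i = 0] (mod int m) \<and> [f i = 1] (mod int m)"
        using fg i(1) unfolding good_def by simp
      ultimately show "[G v = 1] (mod int m) \<or> [G v = 0] (mod int m) \<and> [F v = 1] (mod int m)"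
        by (blast intro: cong_trans cong_sym)
    next
      have 1: "int m dvd (\<Sum>v\<in>#S'. int (fst v))"
      proof -
        have "m dvd (\<Sum>v\<in>#S'. fst v)" using S' by (simp add: zero_sum_def mod_eq_0_iff_dvd)
        then have "int m dvd int (\<Sum>v\<in>#S'. fst v)" by (simp only: int_dvd_int_iff)
        then show ?thesis by (simp add: of_nat_sum_mset image_mset.compositionality o_def)
      qed
      have 2: "int m dvd (\<Sum>v\<in>#S'. int (snd v))"
      proof -
        have "m * n dvd (\<Sum>v\<in>#S'. snd v)" using S' by (simp add: zero_sum_def mod_eq_0_iff_dvd)
        then have "m dvd (\<Sum>v\<in>#S'. snd v)" by (rule dvd_mult_left)
        then have "int m dvd int (\<Sum>v\<in>#S'. snd v)" by (simp only: int_dvd_int_iff)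
        then show ?thesis by (simp add: of_nat_sum_mset image_mset.compositionality o_def)
      qed
      show "int m dvd (\<Sum>v\<in>#S'. F v)" "int m dvd (\<Sum>v\<in>#S'. G v)"
        using 1 2 by (simp_all add: F_def G_def sum_mset.distrib sum_mset_distrib_left[symmetric])
    qed (use S' in blast)
  qed
qed

end
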